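(* There exists a randomized sequential algorithm that takes as input a directed graph $\hat{G}=(\hat{V},\hat{E})$ and has the following guarantees, where $n=|\hat{V}|$, $m=|\hat{E}|$, and without loss of generality $m\geq n/2$: (1) the running time is $O(m\log^2 n)$; (2) the algorithm produces a set $S^*$ of shortcuts of size $O(n\log^2 n)$; and (3) with high probability, the diameter of $G_{S^*}=(\hat{V},\hat{E}\cup S^* )$ is $O(n^{2/3}\log^{4/3}n)$.
   Context: For a directed graph $G$, write $u\preceq v$ if there is a (possibly empty) directed path from $u$ to $v$ in $G$. A shortcut is any arc $(u,v)$ with $u\preceq v$ in $G$. The diameter of a directed graph means the maximum, over all ordered pairs $(u,v)$ with $u\preceq v$, of the minimum number of arcs on a directed $u$-to-$v$ path. "With high probability" means the failure probability can be driven down to $1/n^c$ for any constant $c$ by increasing the constants hidden in the big-$O$ bounds (here, of the running time and number of shortcuts). *)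

theory Defs
  imports "HOL-Probability.Probability_Mass_Function" "HOL-Analysis.Analysis"
begin

section \<open>Directed graphs\<close>

text \<open>
  A directed graph has the vertices \<open>0, \<dots>, n - 1\<close> and a set \<open>E\<close> of ordered pairs as arcs
  (loops are allowed).  There is a directed walk from \<open>u\<close> to \<open>v\<close> with exactly \<open>k\<close> arcs iff
  \<open>(u, v) \<in> E ^^ k\<close>; reachability is therefore \<open>(u, v) \<in> E\<^sup>*\<close>, and the least such \<open>k\<close>
  is attained by a path.
\<close>

definition is_digraph :: "nat \<Rightarrow> (nat \<times> nat) set \<Rightarrow> bool" where
  "is_digraph n E \<longleftrightarrow> E \<subseteq> {..<n} \<times> {..<n}"

definition shortcuts :: "nat \<Rightarrow> (nat \<times> nat) set \<Rightarrow> (nat \<times> nat) set" where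
  "shortcuts n E = {(u, v). u < n \<and> v < n \<and> (u, v) \<in> E\<^sup>*}"

definition distance :: "(nat \<times> nat) set \<Rightarrow> nat \<Rightarrow> nat \<Rightarrow> nat" where
  "distance E u v = (LEAST k. (u, v) \<in> E ^^ k)"

definition digraph_diameter :: "nat \<Rightarrow> (nat \<times> nat) set \<Rightarrow> nat" where
  "digraph_diameter n E = Max {distance E u v | u v. u < n \<and> v < n \<and> (u, v) \<in> E\<^sup>*}"


section \<open>Randomized word RAM\<close>

text \<open>
  Programs are structured programs over registers and a random-access memory.  All results of
  operations are reduced modulo \<open>B\<close>, so that a memory cell is a word of \<open>log B\<close> bits.  Every
  primitive operation, including the drawing of a uniform random number below a given word,
  takes one step.  A program mentions only finitely many registers and constants, and it does
  not depend on the input.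
\<close>

datatype binop = Add | Sub | Mul | Div | Mod | Less | Equal

fun eval_binop :: "binop \<Rightarrow> nat \<Rightarrow> nat \<Rightarrow> nat" where
  "eval_binop Add a b = a + b"
| "eval_binop Sub a b = a - b"
| "eval_binop Mul a b = a * b"
| "eval_binop Div a b = a div b"
| "eval_binop Mod a b = a mod b"
| "eval_binop Less a b = of_bool (a < b)"
| "eval_binop Equal a b = of_bool (a = b)"

type_synonym reg = nat

datatype prog =
    Skip
  | Const reg nat
  | Op binop reg reg reg
  | Load reg reg
  | Store reg reg
  | Rand reg reg
  | Seq prog prog
  | IfNZ reg prog prog
  | WhileNZ reg prog

record state =
  regs :: "reg \<Rightarrow> nat"
  mem :: "nat \<Rightarrow> nat"

type_synonym config = "prog \<times> state"

definition set_reg :: "reg \<Rightarrow> nat \<Rightarrow> state \<Rightarrow> state" where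
  "set_reg r x s = s\<lparr>regs := (regs s)(r := x)\<rparr>"

text \<open>
  \<open>Op\<close>, \<open>Load\<close> and \<open>Rand\<close> have the target register first; \<open>Store a r\<close> writes register \<open>r\<close> to
  the address in register \<open>a\<close>.  Drawing a number below \<open>0\<close> yields \<open>0\<close>.
\<close>

primrec step :: "nat \<Rightarrow> prog \<Rightarrow> state \<Rightarrow> config pmf" where
  "step B Skip s = return_pmf (Skip, s)"
| "step B (Const r x) s = return_pmf (Skip, set_reg r (x mod B) s)"
| "step B (Op f r r1 r2) s =
     return_pmf (Skip, set_reg r (eval_binop f (regs s r1) (regs s r2) mod B) s)"
| "step B (Load r a) s = return_pmf (Skip, set_reg r (mem s (regs s a)) s)"
| "step B (Store a r) s = return_pmf (Skip, s\<lparr>mem := (mem s)(regs s a := regs s r)\<rparr>)"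
| "step B (Rand r r1) s =
     (if regs s r1 = 0 then return_pmf (Skip, set_reg r 0 s)
      else map_pmf (\<lambda>x. (Skip, set_reg r x s)) (pmf_of_set {..<regs s r1}))"
| "step B (Seq p q) s =
     (if p = Skip then return_pmf (q, s)
      else map_pmf (\<lambda>(p', s'). (Seq p' q, s')) (step B p s))"
| "step B (IfNZ r p q) s = return_pmf (if regs s r \<noteq> 0 then p else q, s)"
| "step B (WhileNZ r p) s =
     return_pmf (if regs s r \<noteq> 0 then Seq p (WhileNZ r p) else Skip, s)"

primrec run :: "nat \<Rightarrow> nat \<Rightarrow> config \<Rightarrow> config pmf" where
  "run B 0 c = return_pmf c"
| "run B (Suc t) c = bind_pmf (run B t c) (\<lambda>(p, s). step B p s)"

definition halted :: "config \<Rightarrow> bool" where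
  "halted c \<longleftrightarrow> fst c = Skip"


section \<open>Input and output of graph programs\<close>

text \<open>
  The graph is given as a list of its arcs in arbitrary order.  Registers 0, 1, 2 initially hold
  the number of vertices, the number of arcs, and a tuning parameter \<open>k\<close>; tail and head of the
  \<open>i\<close>-th arc are in the cells \<open>2 * i\<close> and \<open>2 * i + 1\<close>; everything else is 0.
\<close>

definition input_state :: "nat \<Rightarrow> nat \<Rightarrow> (nat \<times> nat) list \<Rightarrow> state" where
  "input_state k n es =
     \<lparr>regs = (\<lambda>_. 0)(0 := n, 1 := length es, 2 := k),
      mem = (\<lambda>a. if a < 2 * length es
                  then (if even a then fst (es ! (a div 2)) else snd (es ! (a div 2)))
                  else 0)\<rparr>"

text \<open>
  The constant \<open>d\<close> is the usual word-size constant of the word RAM: words have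
  \<open>d * log (n + m + k + 2)\<close> bits, which is \<open>O(log n)\<close> for constant \<open>k\<close>.
\<close>

definition word_bound :: "nat \<Rightarrow> nat \<Rightarrow> nat \<Rightarrow> (nat \<times> nat) list \<Rightarrow> nat" where
  "word_bound d k n es = (n + length es + k + 2) ^ d"

text \<open>The output is an array of arcs with its length in register 0 and its address in register 1.\<close>

definition output_arcs :: "config \<Rightarrow> (nat \<times> nat) set" where
  "output_arcs c = (let s = snd c; a = regs s 1 in
     {(mem s (a + 2 * i), mem s (a + 2 * i + 1)) | i. i < regs s 0})"

definition run_on :: "prog \<Rightarrow> nat \<Rightarrow> nat \<Rightarrow> nat \<Rightarrow> (nat \<times> nat) list \<Rightarrow> nat \<Rightarrow> config pmf" where
  "run_on P d k n es t = run (word_bound d k n es) t (P, input_state k n es)"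

end

theory Submission
  imports Defs
begin

text \<open>
  The vertices are partitioned into classes.  A uniformly random pivot \<open>x\<close> is joined by shortcuts
  to all vertices \<open>F\<close> that it reaches and all vertices \<open>B\<close> that reach it inside its class, and the
  class is split into \<open>F - B\<close>, \<open>B - F\<close> and the rest, while \<open>F \<inter> B\<close> is discarded.

  Follow a path that lies in one class, and let \<open>a\<close> and \<open>d\<close> be the numbers of vertices of the class
  that reach it and that are reached by it.  A pivot counted by both bridges the whole path with two
  shortcuts.  A pivot that only reaches the path cuts it into two pieces lying in different classes,
  and of any two vertices above the path at most one survives the choice of the other as a pivot;
  so on average the two pieces keep at most half of \<open>a\<close>, while their shares of \<open>d\<close> add up to at
  most \<open>d\<close>.  By Cauchy-Schwarz the sum of \<open>sqrt (a d)\<close> over the pieces shrinks by a factor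
  \<open>sqrt 2\<close> with every generation, although the number of pieces at most doubles.  As a path has at
  most \<open>sqrt (a d)\<close> vertices, stopping after \<open>h\<close> generations bounds the expected length by
  \<open>3 * 2 ^ h + n / sqrt 2 ^ h\<close>, which is \<open>O(n powr (2/3))\<close> for the best \<open>h\<close>.  Applied to a path
  with a single vertex, the same halving shows that a vertex is visited \<open>O(log n)\<close> times on average.

  By Markov's inequality one repetition of \<open>O(n log n)\<close> draws with cut-off budgets for its work and
  its output shortens a given path with probability at least \<open>1/2\<close>, so \<open>O(log n)\<close> repetitions and a
  union bound over all pairs of vertices suffice.
\<close>

section \<open>Reachability inside the classes\<close>

text \<open>Each pivot is drawn uniformly from all \<open>n\<close> vertices and not from a chosen
  class, so one list of independent draws serves every class at once, and drawing a discarded vertex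
  changes nothing. Since most draws may miss a given path, generations cannot be counted directly:
  \<open>EL_dst\<close> shows that averaging over a single draw, whether it misses, cuts or bridges
  the path, preserves the bound, and the term \<open>length p * (1 - 1 / n) ^ t\<close> pays for
  ending after \<open>t\<close> draws. The number \<open>h\<close> of generations lives only in this
  estimate; the program never sees it.

  Time and size must be bounded on every run, while the analysis controls only expectations; this is
  what forces the cut-off budgets. The two halves of the proof meet in the function
  \<open>all_arcs\<close> from lists of draws to sets of shortcuts: the probabilistic half evaluates
  it on a random list, and the program half shows that, given the list, exactly this set is
  output.\<close>

definition class_rel :: "(nat \<times> nat) set \<Rightarrow> (nat \<Rightarrow> nat) \<Rightarrow> nat \<Rightarrow> (nat \<times> nat) set" where
  "class_rel E lab c = {(u, v) \<in> E. lab u = c \<and> lab v = c}"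

text \<open>The condition on label 1 makes a discarded vertex reach nothing, not even itself, so
  that such a pivot yields no arcs and no relabelling.\<close>

definition reach :: "(nat \<times> nat) set \<Rightarrow> (nat \<Rightarrow> nat) \<Rightarrow> nat \<Rightarrow> nat set" where
  "reach E lab x = {v. lab x \<noteq> 1 \<and> (x, v) \<in> (class_rel E lab (lab x))\<^sup>*}"

text \<open>Two vertices are in the same class iff they have the same label; label 1 marks discarded vertices.\<close>

definition relabel :: "(nat \<times> nat) set \<Rightarrow> (nat \<Rightarrow> nat) \<Rightarrow> nat \<Rightarrow> nat \<Rightarrow> nat \<Rightarrow> nat \<Rightarrow> nat" where
  "relabel E lab qf qb x v =
     (if v \<in> reach E lab x then if v \<in> reach (E\<inverse>) lab x then 1 else qf
      else if v \<in> reach (E\<inverse>) lab x then qb else lab v)"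

text \<open>The vertices of the class that reach the path. Those reached by the path are
  \<open>anc (E\<inverse>) lab p\<close>, so facts about one side carry over to the other by
  reversing all arcs.\<close>

definition anc :: "(nat \<times> nat) set \<Rightarrow> (nat \<Rightarrow> nat) \<Rightarrow> nat list \<Rightarrow> nat set" where
  "anc E lab p = (\<Union>v\<in>set p. reach (E\<inverse>) lab v)"

definition fresh :: "(nat \<Rightarrow> nat) \<Rightarrow> nat \<Rightarrow> nat \<Rightarrow> bool" where
  "fresh lab qf qb \<longleftrightarrow> (\<forall>v. lab v \<noteq> qf \<and> lab v \<noteq> qb) \<and> qf \<noteq> qb \<and> qf \<noteq> 1 \<and> qb \<noteq> 1"

lemma class_rel_converse: "class_rel (E\<inverse>) lab c = (class_rel E lab c)\<inverse>"
  by (auto simp: class_rel_def)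

lemma relabel_converse: "relabel (E\<inverse>) lab qb qf x = relabel E lab qf qb x"
  by (auto simp: relabel_def fun_eq_iff)

lemma fresh_sym: "fresh lab qf qb \<Longrightarrow> fresh lab qb qf"
  by (auto simp: fresh_def)

lemma class_rel_star_label: "(u, v) \<in> (class_rel E lab c)\<^sup>* \<Longrightarrow> u = v \<or> lab u = c \<and> lab v = c"
proof (induction rule: rtrancl_induct)
  case (step y z)
  then show ?case by (auto simp: class_rel_def)
qed simp

lemma reach_label: "v \<in> reach E lab x \<Longrightarrow> lab v = lab x \<and> lab x \<noteq> 1"
  using class_rel_star_label unfolding reach_def by fastforce

text \<open>A path inside a class has the same live label at both ends, so it can be read
  backwards.\<close>

lemma reach_converse: "v \<in> reach (E\<inverse>) lab x \<longleftrightarrow> x \<in> reach E lab v"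
proof
  assume a: "v \<in> reach (E\<inverse>) lab x"
  then show "x \<in> reach E lab v"
    using reach_label[OF a] by (simp add: reach_def class_rel_converse rtrancl_converse)
next
  assume a: "x \<in> reach E lab v"
  then show "v \<in> reach (E\<inverse>) lab x"
    using reach_label[OF a] by (simp add: reach_def class_rel_converse rtrancl_converse)
qed

lemma reach_refl: "lab x \<noteq> 1 \<Longrightarrow> x \<in> reach E lab x"
  by (simp add: reach_def)

lemma reach_trans: "y \<in> reach E lab x \<Longrightarrow> z \<in> reach E lab y \<Longrightarrow> z \<in> reach E lab x"
  using reach_label[of y E lab x] by (auto simp: reach_def)

lemma reach_step: "y \<in> reach E lab x \<Longrightarrow> (y, z) \<in> E \<Longrightarrow> lab z = lab x \<Longrightarrow> z \<in> reach E lab x"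
  using reach_label[of y E lab x]
  by (auto simp: reach_def class_rel_def intro: rtrancl_into_rtrancl)

lemma reach_rtrancl: "v \<in> reach E lab x \<Longrightarrow> (x, v) \<in> E\<^sup>*"
  using rtrancl_mono[of "class_rel E lab (lab x)" E] by (auto simp: reach_def class_rel_def)

lemma reach_bounded: "is_digraph n E \<Longrightarrow> x < n \<Longrightarrow> reach E lab x \<subseteq> {..<n}"
proof
  fix v assume E: "is_digraph n E" and x: "x < n" and "v \<in> reach E lab x"
  then have "(x, v) \<in> E\<^sup>*" by (simp add: reach_rtrancl)
  then show "v \<in> {..<n}"
    using x E by (induction rule: rtrancl_induct) (auto simp: is_digraph_def)
qed

lemma is_digraph_converse: "is_digraph n (E\<inverse>) \<longleftrightarrow> is_digraph n E"
  by (auto simp: is_digraph_def)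

lemma anc_bounded: "is_digraph n E \<Longrightarrow> set p \<subseteq> {..<n} \<Longrightarrow> anc E lab p \<subseteq> {..<n}"
  using reach_bounded[of n "E\<inverse>"] unfolding anc_def is_digraph_converse by blast

text \<open>Serves both kinds of new class: the remainder, which keeps its label, and the part with
  a fresh label. It suffices that arcs inside the new class already lay inside the old one.\<close>

lemma anc_mono:
  assumes "set p' \<subseteq> set p" "\<And>v. v \<in> set p' \<Longrightarrow> lab' v = c'" "\<And>v. v \<in> set p \<Longrightarrow> lab v = c"
    "class_rel E lab' c' \<subseteq> class_rel E lab c" "c \<noteq> 1"
  shows "anc E lab' p' \<subseteq> anc E lab p"
proof
  fix y assume "y \<in> anc E lab' p'"
  then obtain v where v: "v \<in> set p'" "v \<in> reach E lab' y" by (auto simp: anc_def reach_converse)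
  have "lab' v = c'" "lab v = c" using assms v by auto
  moreover have "lab' y = c'" using reach_label[OF v(2)] \<open>lab' v = c'\<close> by simp
  ultimately have "(y, v) \<in> (class_rel E lab c)\<^sup>*"
    using v(2) rtrancl_mono[OF assms(4)] by (auto simp: reach_def)
  moreover from this have "lab y = c" using class_rel_star_label \<open>lab v = c\<close> by metis
  ultimately have "v \<in> reach E lab y" using assms(5) by (simp add: reach_def)
  then show "y \<in> anc E lab p" using v assms(1) by (auto simp: anc_def reach_converse)
qed

lemma anc_label: "y \<in> anc E lab p \<Longrightarrow> (\<And>v. v \<in> set p \<Longrightarrow> lab v = c) \<Longrightarrow> lab y = c"
  using reach_label by (fastforce simp: anc_def)

lemma class_rel_relabel_old:
  assumes "fresh lab qf qb" "c \<noteq> qf" "c \<noteq> qb" "c \<noteq> 1"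
  shows "class_rel E (relabel E0 lab qf qb x) c \<subseteq> class_rel E lab c"
  using assms by (auto simp: class_rel_def relabel_def split: if_splits)

text \<open>By freshness only vertices just renamed carry \<open>qf\<close>, and all of them come
  from the class of the pivot.\<close>

lemma class_rel_relabel_fresh:
  assumes "fresh lab qf qb"
  shows "class_rel E (relabel E0 lab qf qb x) qf \<subseteq> class_rel E lab (lab x)"
  using assms reach_label[of _ E0 lab x]
  by (auto simp: class_rel_def relabel_def fresh_def split: if_splits)

section \<open>Paths inside a class and how a pivot cuts them\<close>

lemma relabel_dead: "lab v = 1 \<Longrightarrow> relabel E lab qf qb x v = 1"
  using reach_label[of v E lab x] reach_label[of v "E\<inverse>" lab x] by (auto simp: relabel_def)

definition walk :: "(nat \<times> nat) set \<Rightarrow> nat list \<Rightarrow> bool" where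
  "walk E p \<longleftrightarrow> p \<noteq> [] \<and> distinct p \<and> successively (\<lambda>u v. (u, v) \<in> E) p"

definition piece :: "nat \<Rightarrow> (nat \<times> nat) set \<Rightarrow> (nat \<Rightarrow> nat) \<Rightarrow> nat list \<Rightarrow> bool" where
  "piece n E lab p \<longleftrightarrow> walk E p \<and> set p \<subseteq> {..<n} \<and> (\<exists>c. c \<noteq> 1 \<and> (\<forall>v\<in>set p. lab v = c))"

text \<open>Being reached by the pivot is inherited along a path within its class, so a cut at the
  first reached vertex separates all unreached vertices from all reached ones.\<close>

definition untouched :: "(nat \<times> nat) set \<Rightarrow> (nat \<Rightarrow> nat) \<Rightarrow> nat \<Rightarrow> nat list \<Rightarrow> nat list" where
  "untouched E lab x p = takeWhile (\<lambda>v. v \<notin> reach E lab x) p"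

definition touched :: "(nat \<times> nat) set \<Rightarrow> (nat \<Rightarrow> nat) \<Rightarrow> nat \<Rightarrow> nat list \<Rightarrow> nat list" where
  "touched E lab x p = dropWhile (\<lambda>v. v \<notin> reach E lab x) p"

text \<open>The vertices that still reach one of the two parts after the pivot \<open>x\<close>.
  Bridging pivots are given no survivors, so that a sum over all of \<open>anc E lab p\<close>
  counts them as zero.\<close>

definition survivors :: "(nat \<times> nat) set \<Rightarrow> (nat \<Rightarrow> nat) \<Rightarrow> nat \<Rightarrow> nat \<Rightarrow> nat list \<Rightarrow> nat \<Rightarrow> nat set" where
  "survivors E lab qf qb p x =
     (if x \<in> anc E lab p - anc (E\<inverse>) lab p
      then anc E (relabel E lab qf qb x) (untouched E lab x p) \<union>
           anc E (relabel E lab qf qb x) (touched E lab x p)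
      else {})"

lemma self_subset_anc: "piece n E lab p \<Longrightarrow> set p \<subseteq> anc E lab p"
  by (auto simp: piece_def anc_def intro!: bexI reach_refl)

lemma walk_converse: "walk (E\<inverse>) (rev p) \<longleftrightarrow> walk E p"
  by (auto simp: walk_def)

lemma piece_converse: "piece n (E\<inverse>) lab (rev p) \<longleftrightarrow> piece n E lab p"
  by (simp add: piece_def walk_converse)

lemma anc_rev: "anc E lab (rev p) = anc E lab p"
  by (simp add: anc_def)

lemma walk_reach_dropWhile:
  assumes "walk E p" "\<forall>v\<in>set p. lab v = lab x"
  shows "set (dropWhile (\<lambda>v. v \<notin> reach E lab x) p) \<subseteq> reach E lab x"
proof -
  have *: "set (a # q) \<subseteq> reach E lab x"
    if "successively (\<lambda>u v. (u, v) \<in> E) (a # q)" "\<forall>v\<in>set (a#q). lab v = lab x" "a \<in> reach E lab x" for a q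
    using that
  proof (induction q arbitrary: a)
    case (Cons b q)
    then have "b \<in> reach E lab x" using reach_step[of a E lab x b] by auto
    then show ?case using Cons by auto
  qed simp
  show ?thesis
  proof (cases "dropWhile (\<lambda>v. v \<notin> reach E lab x) p")
    case (Cons a q)
    then have a: "a \<in> reach E lab x" by (metis dropWhile_eq_Cons_conv)
    have "p = takeWhile (\<lambda>v. v \<notin> reach E lab x) p @ a # q" using Cons by (metis takeWhile_dropWhile_id)
    then have "successively (\<lambda>u v. (u, v) \<in> E) (a # q)" "\<forall>v\<in>set (a#q). lab v = lab x"
      using assms unfolding walk_def by (metis successively_append_iff, metis Un_iff set_append)
    then show ?thesis using * a Cons by auto
  qed (auto simp del: dropWhile_eq_Nil_conv)
qed

text \<open>No vertex of the path reaches the pivot, so none is discarded or gets \<open>qb\<close>: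
  the prefix keeps its label and the rest becomes \<open>qf\<close>. The inclusions hold for an
  arbitrary arc set \<open>D\<close> because they are needed for \<open>E\<close> and for its
  converse.\<close>

lemma pivot_above:
  assumes p: "piece n E lab p" and x: "x \<in> anc E lab p - anc (E\<inverse>) lab p" and f: "fresh lab qf qb"
  defines "lab' \<equiv> relabel E lab qf qb x"
  shows "\<forall>v\<in>set p. lab v = lab x" "lab x \<noteq> 1"
    "p = untouched E lab x p @ touched E lab x p" "touched E lab x p \<noteq> []"
    "set (touched E lab x p) \<subseteq> reach E lab x"
    "\<forall>v\<in>set (untouched E lab x p). lab' v = lab x"
    "\<forall>v\<in>set (touched E lab x p). lab' v = qf"
    "anc D lab' (untouched E lab x p) \<subseteq> anc D lab p"
    "anc D lab' (touched E lab x p) \<subseteq> anc D lab p"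
    "anc D lab' (untouched E lab x p) \<inter> anc D lab' (touched E lab x p) = {}"
proof -
  from p obtain c where c: "c \<noteq> 1" "\<forall>v\<in>set p. lab v = c" by (auto simp: piece_def)
  obtain w where w: "w \<in> set p" "w \<in> reach E lab x" using x by (auto simp: anc_def reach_converse)
  have "lab x = c" using reach_label[OF w(2)] w(1) c by simp
  with c show 1: "\<forall>v\<in>set p. lab v = lab x" and 2: "lab x \<noteq> 1" by auto
  show 3: "p = untouched E lab x p @ touched E lab x p" by (simp add: untouched_def touched_def)
  then have sub: "set (untouched E lab x p) \<subseteq> set p" "set (touched E lab x p) \<subseteq> set p"
    by (metis set_append Un_upper1, metis set_append Un_upper2)
  show "touched E lab x p \<noteq> []" using w by (auto simp: touched_def)
  show 5: "set (touched E lab x p) \<subseteq> reach E lab x"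
    using walk_reach_dropWhile 1 p by (simp add: piece_def touched_def)
  have nb: "v \<notin> reach (E\<inverse>) lab x" if "v \<in> set p" for v
    using x that by (auto simp: anc_def reach_converse)
  have nf: "v \<notin> reach E lab x" if "v \<in> set (untouched E lab x p)" for v
    using that by (auto simp: untouched_def dest: set_takeWhileD)
  show 6: "\<forall>v\<in>set (untouched E lab x p). lab' v = lab x"
    using nb nf sub 1 by (auto simp: lab'_def relabel_def)
  show 7: "\<forall>v\<in>set (touched E lab x p). lab' v = qf"
    using nb 5 sub by (auto simp: lab'_def relabel_def)
  have q: "lab x \<noteq> qf" "lab x \<noteq> qb" "qf \<noteq> 1" using f by (auto simp: fresh_def)
  show "anc D lab' (untouched E lab x p) \<subseteq> anc D lab p"
    using anc_mono[OF sub(1), of lab' "lab x" lab "lab x" D] 6 1 2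
      class_rel_relabel_old[OF f q(1,2) 2] by (auto simp: lab'_def)
  show "anc D lab' (touched E lab x p) \<subseteq> anc D lab p"
    using anc_mono[OF sub(2), of lab' qf lab "lab x" D] 7 1 2
      class_rel_relabel_fresh[OF f] by (auto simp: lab'_def)
  show "anc D lab' (untouched E lab x p) \<inter> anc D lab' (touched E lab x p) = {}"
    using anc_label[of _ D lab' "untouched E lab x p" "lab x"] anc_label[of _ D lab' "touched E lab x p" qf] 6 7 q
    by fastforce
qed

lemma survivors_subset:
  assumes "piece n E lab p" "fresh lab qf qb"
  shows "survivors E lab qf qb p x \<subseteq> anc E lab p"
  using pivot_above(8,9)[OF assms(1) _ assms(2), of x E] by (auto simp: survivors_def)

text \<open>If \<open>x\<close> reaches \<open>y\<close>, then the pivot \<open>y\<close> separates \<open>x\<close> from the path; if they are unrelated, then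
  the one that reaches less of the path is lost when the other one is the pivot.\<close>

lemma survivors_cases:
  assumes p: "piece n E lab p" and f: "fresh lab qf qb" and y: "y \<in> survivors E lab qf qb p x"
  shows "y \<notin> reach (E\<inverse>) lab x \<and> x \<in> anc E lab p - anc (E\<inverse>) lab p \<and>
    (y \<in> reach E lab x \<or> (\<exists>v\<in>set (untouched E lab x p). v \<in> reach E lab y))"
proof -
  have x: "x \<in> anc E lab p - anc (E\<inverse>) lab p" using y by (auto simp: survivors_def split: if_splits)
  note pa = pivot_above[OF p x f]
  let ?l = "relabel E lab qf qb x"
  have q: "lab x \<noteq> qf" "lab x \<noteq> qb" "qf \<noteq> 1" "lab x \<noteq> 1" "qf \<noteq> qb" "\<forall>v. lab v \<noteq> qf" using f pa(2) by (auto simp: fresh_def)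
  consider "y \<in> anc E ?l (untouched E lab x p)" | "y \<in> anc E ?l (touched E lab x p)"
    using y x by (auto simp: survivors_def)
  then show ?thesis
  proof cases
    case 1
    then have "?l y = lab x" using anc_label pa(6) by metis
    then have a: "y \<notin> reach (E\<inverse>) lab x" using q by (auto simp: relabel_def split: if_splits)
    have "anc E ?l (untouched E lab x p) \<subseteq> anc E lab (untouched E lab x p)"
    proof (rule anc_mono)
      show "\<And>v. v \<in> set (untouched E lab x p) \<Longrightarrow> lab v = lab x"
        using pa(1,3) by (metis Un_iff set_append)
    qed (use pa(6) class_rel_relabel_old[OF f q(1,2,4)] q in \<open>(blast | simp)+\<close>)
    with 1 have "y \<in> anc E lab (untouched E lab x p)" by auto
    then show ?thesis using a x by (auto simp: anc_def reach_converse)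
  next
    case 2
    then have "?l y = qf" using anc_label pa(7) by metis
    then have "y \<in> reach E lab x \<and> y \<notin> reach (E\<inverse>) lab x" using q by (auto simp: relabel_def split: if_splits)
    then show ?thesis using x by auto
  qed
qed

lemma survivors_asym:
  assumes p: "piece n E lab p" and f: "fresh lab qf qb"
    and y: "y \<in> survivors E lab qf qb p x" and x: "x \<in> survivors E lab qf qb p y"
  shows False
proof -
  note a = survivors_cases[OF p f y] and b = survivors_cases[OF p f x]
  have "y \<notin> reach E lab x" "x \<notin> reach E lab y" using a b by (auto simp: reach_converse)
  with a b obtain v w where v: "v \<in> set (untouched E lab x p)" "v \<in> reach E lab y"
    and w: "w \<in> set (untouched E lab y p)" "w \<in> reach E lab x" by auto
  \<comment> \<open>Both untouched parts are prefixes of \<open>p\<close>, hence nested; yet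
    \<open>v\<close> lies only in the one and \<open>w\<close> only in the other.\<close>
  obtain i j where ij: "untouched E lab x p = take i p" "untouched E lab y p = take j p"
    unfolding untouched_def by (metis takeWhile_eq_take)
  have "v \<notin> set (untouched E lab y p)" "w \<notin> set (untouched E lab x p)"
    using v w by (auto simp: untouched_def dest: set_takeWhileD)
  then show False using v w ij set_take_subset_set_take[of i j p] set_take_subset_set_take[of j i p]
    by (cases "i \<le> j") auto
qed

text \<open>The pairs \<open>(x, y)\<close> with \<open>y \<in> S x\<close> and the reversed pairs
  form two disjoint subsets of \<open>A \<times> A\<close> of equal size.\<close>

lemma card_asym_le:
  assumes "finite A" "\<And>x. x \<in> A \<Longrightarrow> S x \<subseteq> A" "\<And>x y. y \<in> S x \<Longrightarrow> x \<in> S y \<Longrightarrow> False"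
  shows "2 * (\<Sum>x\<in>A. card (S x)) \<le> card A * card A"
proof -
  let ?K = "Sigma A S"
  have fin: "finite ?K" using assms(1,2) by (meson finite_SigmaI finite_subset)
  have "?K \<inter> ?K\<inverse> = {}" using assms(3) by auto
  moreover have "?K \<union> ?K\<inverse> \<subseteq> A \<times> A" using assms(2) by auto
  ultimately have "card ?K + card (?K\<inverse>) \<le> card (A \<times> A)"
    using assms(1) fin card_Un_disjoint[of ?K "?K\<inverse>"] card_mono[of "A \<times> A" "?K \<union> ?K\<inverse>"] by simp
  moreover have "card ?K = (\<Sum>x\<in>A. card (S x))"
    using assms(1,2) by (intro card_SigmaI) (auto intro: finite_subset)
  ultimately show ?thesis by (simp add: card_cartesian_product)
qed

lemma sum_survivors:
  assumes "is_digraph n E" "piece n E lab p" "fresh lab qf qb"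
  shows "2 * (\<Sum>x\<in>anc E lab p. card (survivors E lab qf qb p x)) \<le> card (anc E lab p) * card (anc E lab p)"
proof (rule card_asym_le)
  show "finite (anc E lab p)"
    using anc_bounded[OF assms(1)] assms(2) by (meson finite_lessThan finite_subset piece_def)
qed (use survivors_subset[OF assms(2,3)] survivors_asym[OF assms(2,3)] in blast)+

lemma card_survivors:
  assumes E: "is_digraph n E" and p: "piece n E lab p" and f: "fresh lab qf qb"
    and x: "x \<in> anc E lab p - anc (E\<inverse>) lab p"
  shows "card (anc E (relabel E lab qf qb x) (untouched E lab x p)) +
    card (anc E (relabel E lab qf qb x) (touched E lab x p)) = card (survivors E lab qf qb p x)"
proof -
  note pa = pivot_above[OF p x f]
  have "finite (anc E lab p)"
    using anc_bounded[OF E] p by (meson finite_lessThan finite_subset piece_def)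
  then show ?thesis
    using pa(8-10)[of E] x by (simp add: survivors_def card_Un_disjoint finite_subset)
qed

text \<open>The two parts lie in different classes, so their ancestor sets are disjoint, and so are
  their descendant sets: the former together form \<open>survivors\<close>, the latter stay within
  the old descendants. A part may be empty, since the pivot may reach the whole path.\<close>

lemma split_above:
  assumes E: "is_digraph n E" and p: "piece n E lab p" and f: "fresh lab qf qb"
    and x: "x \<in> anc E lab p - anc (E\<inverse>) lab p"
  defines "lab' \<equiv> relabel E lab qf qb x"
  obtains p1 p2 where "p = p1 @ p2" "p1 \<noteq> [] \<Longrightarrow> piece n E lab' p1" "p2 \<noteq> [] \<Longrightarrow> piece n E lab' p2"
    "card (anc E lab' p1) + card (anc E lab' p2) \<le> card (survivors E lab qf qb p x)"
    "card (anc (E\<inverse>) lab' p1) + card (anc (E\<inverse>) lab' p2) \<le> card (anc (E\<inverse>) lab p)"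
proof -
  note pa = pivot_above[OF p x f]
  let ?p1 = "untouched E lab x p" and ?p2 = "touched E lab x p"
  have w: "walk E p" "set p \<subseteq> {..<n}" using p by (auto simp: piece_def)
  have w': "successively (\<lambda>u v. (u, v) \<in> E) (?p1 @ ?p2)" "distinct (?p1 @ ?p2)"
     "set (?p1 @ ?p2) \<subseteq> {..<n}"
    using w pa(3) by (auto simp: walk_def)
  have "qf \<noteq> 1" using f by (simp add: fresh_def)
  then have P: "?p1 \<noteq> [] \<Longrightarrow> piece n E lab' ?p1" "?p2 \<noteq> [] \<Longrightarrow> piece n E lab' ?p2"
    using w' pa(2,6,7) unfolding piece_def walk_def lab'_def successively_append_iff by auto
  have fin: "finite (anc (E\<inverse>) lab p)"
    using anc_bounded[of n "E\<inverse>"] E w by (meson finite_lessThan finite_subset is_digraph_converse)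
  have "card (anc (E\<inverse>) lab' ?p1) + card (anc (E\<inverse>) lab' ?p2)
      = card (anc (E\<inverse>) lab' ?p1 \<union> anc (E\<inverse>) lab' ?p2)"
    using pa(8-10)[of "E\<inverse>"] fin unfolding lab'_def by (simp add: card_Un_disjoint finite_subset)
  also have "\<dots> \<le> card (anc (E\<inverse>) lab p)"
    using pa(8-10)[of "E\<inverse>"] fin unfolding lab'_def by (intro card_mono) auto
  finally show ?thesis
    using that[OF pa(3) P] card_survivors[OF E p f x] lab'_def by simp
qed

text \<open>This is \<open>split_above\<close> for the reversed graph and the reversed path; the
  reversal exchanges the two fresh labels.\<close>

lemma split_below:
  assumes E: "is_digraph n E" and p: "piece n E lab p" and f: "fresh lab qf qb"
    and x: "x \<in> anc (E\<inverse>) lab p - anc E lab p"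
  defines "lab' \<equiv> relabel E lab qf qb x"
  obtains p1 p2 where "p = p1 @ p2" "p1 \<noteq> [] \<Longrightarrow> piece n E lab' p1" "p2 \<noteq> [] \<Longrightarrow> piece n E lab' p2"
    "card (anc E lab' p1) + card (anc E lab' p2) \<le> card (anc E lab p)"
    "card (anc (E\<inverse>) lab' p1) + card (anc (E\<inverse>) lab' p2) \<le> card (survivors (E\<inverse>) lab qb qf (rev p) x)"
proof -
  have "is_digraph n (E\<inverse>)" "piece n (E\<inverse>) lab (rev p)" "fresh lab qb qf"
    "x \<in> anc (E\<inverse>) lab (rev p) - anc ((E\<inverse>)\<inverse>) lab (rev p)"
    using assms by (simp_all add: is_digraph_converse piece_converse fresh_sym anc_rev)
  from split_above[OF this] obtain p1 p2 where *: "rev p = p1 @ p2"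
    "p1 \<noteq> [] \<Longrightarrow> piece n (E\<inverse>) lab' p1" "p2 \<noteq> [] \<Longrightarrow> piece n (E\<inverse>) lab' p2"
    "card (anc (E\<inverse>) lab' p1) + card (anc (E\<inverse>) lab' p2) \<le> card (survivors (E\<inverse>) lab qb qf (rev p) x)"
    "card (anc E lab' p1) + card (anc E lab' p2) \<le> card (anc E lab p)"
    unfolding relabel_converse lab'_def anc_rev converse_converse by blast
  have "piece n E lab' (rev q)" if "piece n (E\<inverse>) lab' q" for q
    using that piece_converse[of n E lab' "rev q"] by simp
  moreover have "p = rev p2 @ rev p1" using *(1) by (metis rev_append rev_rev_ident)
  ultimately show ?thesis using *(2-5) by (intro that[of "rev p2" "rev p1"]) (simp_all add: anc_rev)
qed

text \<open>Such a pivot can still remove other vertices from the class of the path, so ancestors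
  and descendants may get lost but none are gained.\<close>

lemma piece_unrelated:
  assumes p: "piece n E lab p" and x: "x \<notin> anc E lab p" "x \<notin> anc (E\<inverse>) lab p" and f: "fresh lab qf qb"
  defines "lab' \<equiv> relabel E lab qf qb x"
  shows "piece n E lab' p" "anc D lab' p \<subseteq> anc D lab p"
proof -
  obtain c where c: "c \<noteq> 1" "\<forall>v\<in>set p. lab v = c" "p \<noteq> []" using p by (auto simp: piece_def walk_def)
  have l: "lab' v = lab v" if "v \<in> set p" for v
    using x that by (auto simp: lab'_def relabel_def anc_def reach_converse)
  then show "piece n E lab' p" using p by (auto simp: piece_def)
  have "c \<noteq> qf" "c \<noteq> qb" using f c by (auto simp: fresh_def neq_Nil_conv)
  then have cr: "class_rel D (relabel E lab qf qb x) c \<subseteq> class_rel D lab c"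
    using f c class_rel_relabel_old by blast
  show "anc D lab' p \<subseteq> anc D lab p"
    using anc_mono[of p p lab' c lab c D] l c cr by (auto simp: lab'_def)
qed

lemma finite_anc: "is_digraph n E \<Longrightarrow> piece n E' lab p \<Longrightarrow> finite (anc E lab p)"
  using anc_bounded by (meson finite_lessThan finite_subset piece_def)

section \<open>Expectations over independent uniform draws\<close>

text \<open>Expectation over \<open>t\<close> independent uniform draws below \<open>n\<close>, with
  the first draw split off so that induction follows the process. Finite sums avoid all
  integrability questions; \<open>prob_replicate\<close> translates into probabilities.\<close>

primrec EL :: "nat \<Rightarrow> nat \<Rightarrow> (nat list \<Rightarrow> real) \<Rightarrow> real" where
  "EL n 0 f = f []"
| "EL n (Suc t) f = (\<Sum>x<n. EL n t (\<lambda>xs. f (x # xs))) / real n"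

lemma EL_mono:
  assumes "\<And>xs. length xs = t \<Longrightarrow> set xs \<subseteq> {..<n} \<Longrightarrow> f xs \<le> g xs"
  shows "EL n t f \<le> EL n t g"
  using assms
proof (induction t arbitrary: f g)
  case (Suc t)
  have "EL n t (\<lambda>xs. f (x # xs)) \<le> EL n t (\<lambda>xs. g (x # xs))" if "x < n" for x
    using Suc.prems that by (intro Suc.IH) auto
  then show ?case by (auto intro!: divide_right_mono sum_mono)
qed simp

lemma EL_add: "EL n t (\<lambda>xs. f xs + g xs) = EL n t f + EL n t g"
  by (induction t arbitrary: f g) (simp_all add: sum.distrib add_divide_distrib)

lemma EL_scale: "EL n t (\<lambda>xs. c * f xs) = c * EL n t f"
  by (induction t arbitrary: f) (simp_all flip: sum_distrib_left)

lemma EL_const: "n > 0 \<Longrightarrow> EL n t (\<lambda>xs. c) = c"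
  by (induction t) simp_all

lemma EL_le_const:
  assumes "n > 0" "\<And>xs. f xs \<le> c" shows "EL n t f \<le> c"
  using EL_mono[of t n f "\<lambda>_. c"] assms by (simp add: EL_const)

lemma EL_sum: "EL n t (\<lambda>xs. \<Sum>i\<in>I. f i xs) = (\<Sum>i\<in>I. EL n t (f i))"
proof (induction t arbitrary: f)
  case (Suc t)
  then show ?case by (simp flip: sum_divide_distrib) (subst sum.swap, simp)
qed simp

lemma EL_markov:
  assumes "n > 0" "\<And>xs. f xs \<ge> 0" "a > 0"
  shows "EL n t (\<lambda>xs. of_bool (f xs \<ge> a)) \<le> EL n t f / a"
proof -
  have "EL n t (\<lambda>xs. of_bool (f xs \<ge> a)) \<le> EL n t (\<lambda>xs. (1 / a) * f xs)"
    using assms by (intro EL_mono) (auto simp: of_bool_def)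
  then show ?thesis by (simp only: EL_scale) simp
qed

section \<open>Expected number of visits\<close>

definition star :: "(nat \<times> nat) set \<Rightarrow> (nat \<Rightarrow> nat) \<Rightarrow> nat \<Rightarrow> (nat \<times> nat) set" where
  "star E lab x = {x} \<times> reach E lab x \<union> reach (E\<inverse>) lab x \<times> {x}"

primrec arcs_of :: "(nat \<times> nat) set \<Rightarrow> (nat \<Rightarrow> nat) \<Rightarrow> nat \<Rightarrow> nat list \<Rightarrow> (nat \<times> nat) set" where
  "arcs_of E lab q [] = {}"
| "arcs_of E lab q (x # xs) = star E lab x \<union> arcs_of E (relabel E lab q (q + 1) x) (q + 2) xs"

text \<open>With out- and in-degrees as weights this is the number of scanned arcs, with weights 1
  the number of recorded shortcuts, so one estimate serves both budgets.\<close>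

primrec visit_weight :: "(nat \<times> nat) set \<Rightarrow> (nat \<Rightarrow> nat) \<Rightarrow> (nat \<Rightarrow> nat) \<Rightarrow> (nat \<Rightarrow> nat) \<Rightarrow> nat \<Rightarrow> nat list \<Rightarrow> nat" where
  "visit_weight E f g lab q [] = 0"
| "visit_weight E f g lab q (x # xs) = sum f (reach E lab x) + sum g (reach (E\<inverse>) lab x) +
     visit_weight E f g (relabel E lab q (q + 1) x) (q + 2) xs"

text \<open>The logarithm of \<open>1 + y\<close> to base 4/3. This is the largest base for which
  halving any \<open>y \<ge> 1\<close> saves a full unit: \<open>4/3 * (1 + y/2) \<le> 1 + y\<close>
  is an equality at \<open>y = 1\<close>.\<close>

definition visit_bound :: "real \<Rightarrow> real" where "visit_bound y = ln (1 + y) / ln (4 / 3)"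

lemma visit_bound_mono: "0 \<le> x \<Longrightarrow> x \<le> y \<Longrightarrow> visit_bound x \<le> visit_bound y"
  by (simp add: visit_bound_def divide_right_mono)

lemma visit_bound_nonneg: "0 \<le> x \<Longrightarrow> 0 \<le> visit_bound x"
  by (simp add: visit_bound_def)

text \<open>A concave function lies below its tangent at \<open>z\<close>. With \<open>z\<close>
  half the number of ancestors this plays the part of Jensen's inequality.\<close>

lemma visit_bound_tangent:
  assumes "0 \<le> y" "0 \<le> z"
  shows "visit_bound y \<le> visit_bound z + (y - z) / ((1 + z) * ln (4 / 3))"
proof -
  have "ln ((1 + y) / (1 + z)) \<le> (1 + y) / (1 + z) - 1" using assms by (intro ln_le_minus_one) auto
  also have "\<dots> = (y - z) / (1 + z)" using assms by (simp add: field_simps)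
  finally have "ln (1 + y) \<le> ln (1 + z) + (y - z) / (1 + z)" using assms by (simp add: ln_div)
  then have "visit_bound y \<le> (ln (1 + z) + (y - z) / (1 + z)) / ln (4/3)"
    unfolding visit_bound_def by (intro divide_right_mono) auto
  then show ?thesis by (simp add: visit_bound_def add_divide_distrib)
qed

lemma visit_bound_half: "1 \<le> y \<Longrightarrow> visit_bound (y / 2) + 1 \<le> visit_bound y"
proof -
  assume y: "1 \<le> y"
  then have "ln (4/3 * (1 + y / 2)) \<le> ln (1 + y)" by (subst ln_le_cancel_iff) auto
  moreover have "ln (4/3 * (1 + y / 2)) = ln (4/3) + ln (1 + y / 2)" using y by (intro ln_mult_pos) auto
  ultimately have "(ln (4/3) + ln (1 + y / 2)) / ln (4/3) \<le> visit_bound y"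
    unfolding visit_bound_def by (intro divide_right_mono) auto
  then show ?thesis by (simp add: visit_bound_def add_divide_distrib)
qed

text \<open>Only ancestors of \<open>v\<close> visit it as pivots. On average they leave at most
  half of the ancestors, so by concavity the logarithm falls by 1, which pays for the visit; all
  other pivots never increase it.\<close>

lemma visit_step:
  assumes E: "is_digraph n E" and v: "v < n" "lab v \<noteq> 1" and f: "fresh lab qf qb"
  shows "(\<Sum>x<n. of_bool (v \<in> reach E lab x) +
      (if relabel E lab qf qb x v = 1 then 0 else visit_bound (card (anc E (relabel E lab qf qb x) [v]))))
    \<le> real n * visit_bound (card (anc E lab [v]))" (is "(\<Sum>x<n. ?t x) \<le> _")
proof -
  have p: "piece n E lab [v]" using v by (auto simp: piece_def walk_def)
  let ?A = "anc E lab [v]" and ?a = "real (card (anc E lab [v]))"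
  let ?s = "\<lambda>x. card (survivors E lab qf qb [v] x)"
  have fin: "finite ?A" using finite_anc[OF E p] .
  have A: "?A \<subseteq> {..<n}" using anc_bounded[OF E, of "[v]"] v by simp
  have "v \<in> ?A" using v by (auto simp: anc_def reach_refl)
  then have a1: "?a \<ge> 1" using fin by (metis One_nat_def Suc_leI card_gt_0_iff empty_iff of_nat_1 of_nat_mono)
  have out: "?t x \<le> visit_bound ?a" if "x \<notin> ?A" for x
  proof (cases "x \<in> anc (E\<inverse>) lab [v]")
    case True
    then have "v \<in> reach (E\<inverse>) lab x" "v \<notin> reach E lab x" using that by (auto simp: anc_def reach_converse)
    have x: "x \<in> anc (E\<inverse>) lab [v] - ?A" using True that by simp
    show ?thesis
    proof -
      obtain p1 p2 where s: "[v] = p1 @ p2"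
        "card (anc E (relabel E lab qf qb x) p1) + card (anc E (relabel E lab qf qb x) p2) \<le> card ?A"
        using split_below[OF E p f x] by blast
      have "p1 = [v] \<or> p2 = [v]" using s(1) by (cases p1) auto
      then have "card (anc E (relabel E lab qf qb x) [v]) \<le> card ?A" using s(2) by auto
      then show ?thesis using \<open>v \<notin> reach E lab x\<close> by (auto intro!: visit_bound_mono visit_bound_nonneg)
    qed
  next
    case False
    then have "v \<notin> reach E lab x" using that by (auto simp: anc_def reach_converse)
    moreover have "card (anc E (relabel E lab qf qb x) [v]) \<le> card ?A"
      using piece_unrelated(2)[OF p that False f] fin by (intro card_mono)
    ultimately show ?thesis by (auto intro!: visit_bound_mono visit_bound_nonneg)
  qed
  have ins: "?t x \<le> 1 + visit_bound (?s x)" if "x \<in> ?A" for x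
  proof (cases "x \<in> anc (E\<inverse>) lab [v]")
    case True
    then have "relabel E lab qf qb x v = 1" using that by (auto simp: anc_def reach_converse relabel_def)
    then show ?thesis by (auto simp: visit_bound_def)
  next
    case False
    then have x: "x \<in> ?A - anc (E\<inverse>) lab [v]" using that by simp
    have "card (anc E (relabel E lab qf qb x) [v]) \<le> ?s x"
    proof -
      obtain p1 p2 where s: "[v] = p1 @ p2"
        "card (anc E (relabel E lab qf qb x) p1) + card (anc E (relabel E lab qf qb x) p2) \<le> ?s x"
        using split_above[OF E p f x] by blast
      have "p1 = [v] \<or> p2 = [v]" using s(1) by (cases p1) auto
      then show ?thesis using s(2) by auto
    qed
    then have "visit_bound (card (anc E (relabel E lab qf qb x) [v])) \<le> visit_bound (?s x)" by (intro visit_bound_mono) auto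
    moreover have "0 \<le> visit_bound (?s x)" by (simp add: visit_bound_def)
    ultimately show ?thesis by auto
  qed
  \<comment> \<open>Tangents at \<open>?a / 2\<close>; their linear terms add up to at most 0 by
    \<open>sum_survivors\<close>.\<close>
  have "(\<Sum>x\<in>?A. 1 + visit_bound (?s x)) \<le> (\<Sum>x\<in>?A. 1 + (visit_bound (?a / 2) + (?s x - ?a / 2) / ((1 + ?a / 2) * ln (4 / 3))))"
    by (intro sum_mono add_left_mono visit_bound_tangent) auto
  also have "\<dots> = ?a * (1 + visit_bound (?a / 2)) + ((\<Sum>x\<in>?A. real (?s x)) - ?a * (?a / 2)) / ((1 + ?a / 2) * ln (4 / 3))"
    by (simp add: sum.distrib sum_subtractf flip: sum_divide_distrib) (simp add: algebra_simps)
  also have "\<dots> \<le> ?a * (1 + visit_bound (?a / 2))"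
  proof -
    have "real (2 * (\<Sum>x\<in>?A. ?s x)) \<le> real (card ?A * card ?A)"
      using sum_survivors[OF E p f] of_nat_mono by blast
    then have "(\<Sum>x\<in>?A. real (?s x)) - ?a * (?a / 2) \<le> 0" by simp
    then show ?thesis by (simp add: divide_le_0_iff)
  qed
  also have "\<dots> \<le> ?a * visit_bound ?a" using visit_bound_half[OF a1] by (intro mult_left_mono) auto
  finally have "(\<Sum>x\<in>?A. ?t x) \<le> ?a * visit_bound ?a" using sum_mono[of ?A ?t, OF ins] by simp
  moreover have "(\<Sum>x\<in>{..<n} - ?A. ?t x) \<le> (\<Sum>x\<in>{..<n} - ?A. visit_bound ?a)" using out by (intro sum_mono) auto
  moreover have "(\<Sum>x\<in>{..<n} - ?A. visit_bound ?a) = (real n - ?a) * visit_bound ?a"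
    using A fin card_mono[OF _ A] by (simp add: card_Diff_subset of_nat_diff)
  moreover have "(\<Sum>x<n. ?t x) = (\<Sum>x\<in>?A. ?t x) + (\<Sum>x\<in>{..<n} - ?A. ?t x)"
    using A sum.subset_diff[of ?A "{..<n}" ?t] by simp
  ultimately show ?thesis by (simp add: algebra_simps)
qed

text \<open>Label 0 is the initial class, 1 means discarded, and every draw consumes
  \<open>q\<close> and \<open>q + 1\<close>; so all numbers from \<open>q\<close> on are
  fresh.\<close>

definition labels_below :: "(nat \<Rightarrow> nat) \<Rightarrow> nat \<Rightarrow> bool" where
  "labels_below lab q \<longleftrightarrow> 2 \<le> q \<and> (\<forall>v. lab v < q)"

lemma labels_below_fresh: "labels_below lab q \<Longrightarrow> fresh lab q (q + 1)"
  by (auto simp: labels_below_def fresh_def dest!: spec)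

lemma labels_below_relabel: "labels_below lab q \<Longrightarrow> labels_below (relabel E lab q (q + 1) x) (q + 2)"
  unfolding labels_below_def relabel_def by (auto simp: less_SucI)

lemma weighted_sum_swap:
  fixes a b :: "nat \<Rightarrow> real" and n :: nat
  shows "(\<Sum>x<n. \<Sum>v<n. a v * T v x + b v * U v x) = (\<Sum>v<n. a v * (\<Sum>x<n. T v x) + b v * (\<Sum>x<n. U v x))"
  by (subst sum.swap) (simp add: sum.distrib sum_distrib_left)

text \<open>Potential argument over the draws: a vertex pays for forward visits with the logarithm
  of its ancestors and for backward visits with that of its descendants. A discarded vertex is never
  visited again and needs no potential.\<close>

lemma EL_visit_weight:
  assumes E: "is_digraph n E" and "n > 0"
  shows "labels_below lab q \<Longrightarrow> EL n t (\<lambda>xs. real (visit_weight E f g lab q xs)) \<le>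
    (\<Sum>v<n. if lab v = 1 then 0 else real (f v) * visit_bound (card (anc E lab [v])) + real (g v) * visit_bound (card (anc (E\<inverse>) lab [v])))"
proof (induction t arbitrary: lab q)
  case 0
  show ?case by (auto intro!: sum_nonneg simp: visit_bound_def)
next
  case (Suc t)
  note fr = labels_below_fresh[OF Suc.prems]
  let ?l = "\<lambda>x. relabel E lab q (q + 1) x"
  let ?t = "\<lambda>E lab v x. of_bool (v \<in> reach E lab x) + (if ?l x v = 1 then 0 else visit_bound (card (anc E (?l x) [v])))"
  have Ec: "is_digraph n (E\<inverse>)" using E by (simp add: is_digraph_converse)
  have sm: "real (sum h (reach D lab x)) = (\<Sum>v<n. real (h v) * of_bool (v \<in> reach D lab x))" 
    if "is_digraph n D" "x < n" for h :: "nat \<Rightarrow> nat" and D x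
  proof -
    have "reach D lab x = {v \<in> {..<n}. v \<in> reach D lab x}" using reach_bounded[OF that] by auto
    then have "real (sum h (reach D lab x)) = (\<Sum>v\<in>{v \<in> {..<n}. v \<in> reach D lab x}. real (h v))"
      by simp
    also have "\<dots> = (\<Sum>v<n. if v \<in> reach D lab x then real (h v) else 0)"
      by (rule sum.inter_filter) simp
    also have "\<dots> = (\<Sum>v<n. real (h v) * of_bool (v \<in> reach D lab x))"
      by (intro sum.cong) auto
    finally show ?thesis .
  qed
  have "EL n t (\<lambda>xs. real (visit_weight E f g lab q (x # xs))) \<le>
     (\<Sum>v<n. real (f v) * ?t E lab v x + real (g v) * ?t (E\<inverse>) lab v x)" if "x < n" for x
  proof -
    have "EL n t (\<lambda>xs. real (visit_weight E f g lab q (x # xs))) =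
       real (sum f (reach E lab x)) + real (sum g (reach (E\<inverse>) lab x)) +
       EL n t (\<lambda>xs. real (visit_weight E f g (?l x) (q + 2) xs))"
      using \<open>n > 0\<close> by (simp add: EL_add EL_const)
    also have "\<dots> \<le> (\<Sum>v<n. real (f v) * of_bool (v \<in> reach E lab x)) + (\<Sum>v<n. real (g v) * of_bool (v \<in> reach (E\<inverse>) lab x))
      + (\<Sum>v<n. if ?l x v = 1 then 0 else real (f v) * visit_bound (card (anc E (?l x) [v])) + real (g v) * visit_bound (card (anc (E\<inverse>) (?l x) [v])))"
      unfolding sm[OF E that] sm[OF Ec that]
      by (intro add_left_mono Suc.IH labels_below_relabel Suc.prems)
    also have "\<dots> = (\<Sum>v<n. real (f v) * ?t E lab v x + real (g v) * ?t (E\<inverse>) lab v x)"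
      unfolding sum.distrib[symmetric] by (intro sum.cong) (auto simp: algebra_simps)
    finally show ?thesis .
  qed
  then have "EL n (Suc t) (\<lambda>xs. real (visit_weight E f g lab q xs)) \<le>
      (\<Sum>x<n. \<Sum>v<n. real (f v) * ?t E lab v x + real (g v) * ?t (E\<inverse>) lab v x) / n"
    unfolding EL.simps by (intro divide_right_mono sum_mono) auto
  also have "\<dots> = (\<Sum>v<n. real (f v) * (\<Sum>x<n. ?t E lab v x) + real (g v) * (\<Sum>x<n. ?t (E\<inverse>) lab v x)) / n"
    by (subst weighted_sum_swap) (rule refl)
  also have "\<dots> \<le> (\<Sum>v<n. n * (if lab v = 1 then 0 else real (f v) * visit_bound (card (anc E lab [v])) + real (g v) * visit_bound (card (anc (E\<inverse>) lab [v])))) / n"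
  proof (intro divide_right_mono sum_mono)
    fix v assume "v \<in> {..<n}"
    then have v: "v < n" by simp
    show "real (f v) * (\<Sum>x<n. ?t E lab v x) + real (g v) * (\<Sum>x<n. ?t (E\<inverse>) lab v x)
      \<le> n * (if lab v = 1 then 0 else real (f v) * visit_bound (card (anc E lab [v])) + real (g v) * visit_bound (card (anc (E\<inverse>) lab [v])))"
    proof (cases "lab v = 1")
      case True
      then have "v \<notin> reach D lab x" for x D using reach_label[of v D lab x] True by auto
      then have "?t D lab v x = 0" for x D using relabel_dead[of lab v E q "q+1" x] True by simp
      then show ?thesis using True by simp
    next
      case False
      have "(\<Sum>x<n. ?t E lab v x) \<le> n * visit_bound (card (anc E lab [v]))"
        using visit_step[of n E v lab q "q+1"] E v False fr by simp
      moreover have "(\<Sum>x<n. ?t (E\<inverse>) lab v x) \<le> n * visit_bound (card (anc (E\<inverse>) lab [v]))"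
        using visit_step[OF Ec v False fresh_sym[OF fr]] by (simp only: relabel_converse)
      ultimately have "real (f v) * (\<Sum>x<n. ?t E lab v x) + real (g v) * (\<Sum>x<n. ?t (E\<inverse>) lab v x)
         \<le> real (f v) * (n * visit_bound (card (anc E lab [v]))) + real (g v) * (n * visit_bound (card (anc (E\<inverse>) lab [v])))"
        by (intro add_mono mult_left_mono) auto
      then show ?thesis using False by (simp add: algebra_simps)
    qed
  qed simp
  also have "\<dots> = (\<Sum>v<n. if lab v = 1 then 0 else real (f v) * visit_bound (card (anc E lab [v])) + real (g v) * visit_bound (card (anc (E\<inverse>) lab [v])))"
    using \<open>n > 0\<close> by (simp flip: sum_distrib_left)
  finally show ?case .
qed

section \<open>Expected length of the shortcut path\<close>

lemma relpow_mono: "(E :: ('a \<times> 'a) set) \<subseteq> E' \<Longrightarrow> E ^^ k \<subseteq> E' ^^ k"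
  by (induction k) auto

lemma distance_le: "(u, v) \<in> E ^^ k \<Longrightarrow> distance E u v \<le> k"
  unfolding distance_def by (rule Least_le)

lemma distance_relpow: "(u, v) \<in> E\<^sup>* \<Longrightarrow> (u, v) \<in> E ^^ distance E u v"
  unfolding distance_def rtrancl_power by (erule exE) (rule LeastI)

lemma distance_triangle:
  assumes "(u, v) \<in> E\<^sup>*" "(v, w) \<in> E\<^sup>*"
  shows "distance E u w \<le> distance E u v + distance E v w"
  using relcompI[OF assms[THEN distance_relpow]] by (intro distance_le) (simp add: relpow_add)

lemma distance_mono:
  assumes "(u, v) \<in> E\<^sup>*" "E \<subseteq> E'"
  shows "distance E' u v \<le> distance E u v"
  using distance_relpow[OF assms(1)] relpow_mono[OF assms(2)] by (intro distance_le) auto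

lemma distance_arc: "(u, v) \<in> E \<Longrightarrow> distance E u v \<le> 1"
  by (rule distance_le) simp

lemma walk_relpow:
  assumes "walk E p" shows "(hd p, last p) \<in> E ^^ (length p - 1)"
proof -
  have "(hd p, last p) \<in> E ^^ (length p - 1)" if "successively (\<lambda>u v. (u, v) \<in> E) p" "p \<noteq> []"
    using that
  proof (induction p rule: induct_list012)
    case (3 x y zs)
    then have "(y, last (y # zs)) \<in> E ^^ length zs" "(x, y) \<in> E" by auto
    then have "(x, last (y # zs)) \<in> E ^^ Suc (length zs)" by (intro relpow_Suc_I2)
    then show ?case by simp
  qed auto
  then show ?thesis using assms by (simp add: walk_def)
qed

lemma walk_rtrancl: "walk E p \<Longrightarrow> (hd p, last p) \<in> E\<^sup>*"
  using walk_relpow relpow_imp_rtrancl by fast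

lemma walk_exists:
  assumes "(u, v) \<in> E\<^sup>*"
  obtains p where "walk E p" "hd p = u" "last p = v" "set p \<subseteq> {u} \<union> snd ` E"
proof -
  have "\<exists>p. walk E p \<and> hd p = u \<and> last p = v \<and> set p \<subseteq> {u} \<union> snd ` E"
    using assms
  proof (induction rule: rtrancl_induct)
    case base
    show ?case by (intro exI[of _ "[u]"]) (simp add: walk_def)
  next
    case (step y z)
    then obtain p where p: "walk E p" "hd p = u" "last p = y" "set p \<subseteq> {u} \<union> snd ` E" by auto
    show ?case
    proof (cases "z \<in> set p")
      \<comment> \<open>The path is kept simple: if the new vertex already occurs on it, the path is
        cut off there.\<close>
      case True
      then obtain a b where ab: "p = a @ z # b" by (meson split_list)
      have "p = (a @ [z]) @ b" using ab by simp
      then have "walk E (a @ [z])" using p(1) unfolding walk_def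
        by (metis distinct_append snoc_eq_iff_butlast successively_append_iff)
      moreover have "hd (a @ [z]) = u" using p(2) ab by (cases a) auto
      ultimately show ?thesis using p(4) ab by (intro exI[of _ "a @ [z]"]) auto
    next
      case False
      have "z \<in> snd ` E" using step(2) by force
      then have "set (p @ [z]) \<subseteq> {u} \<union> snd ` E" using p(4) by auto
      moreover have "walk E (p @ [z])" "hd (p @ [z]) = u" using p step(2) False
        by (auto simp: walk_def successively_append_iff)
      ultimately show ?thesis by (intro exI[of _ "p @ [z]"]) auto
    qed
  qed
  then show ?thesis using that by blast
qed

definition dst :: "(nat \<times> nat) set \<Rightarrow> (nat \<times> nat) set \<Rightarrow> nat list \<Rightarrow> real" where
  "dst E S p = real (distance (E \<union> S) (hd p) (last p))"

lemma dst_le_length: "walk E p \<Longrightarrow> dst E S p \<le> real (length p)"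
proof -
  assume w: "walk E p"
  have "distance (E \<union> S) (hd p) (last p) \<le> length p - 1"
    using walk_relpow[OF w] relpow_mono[of E "E \<union> S"] by (intro distance_le) auto
  then show ?thesis by (simp add: dst_def)
qed

lemma dst_mono: "walk E p \<Longrightarrow> S \<subseteq> S' \<Longrightarrow> dst E S' p \<le> dst E S p"
  unfolding dst_def using walk_rtrancl[of E p] rtrancl_mono[of E "E \<union> S"]
  by (intro of_nat_mono distance_mono) auto

text \<open>The arc between the two parts costs the additional 1.\<close>

lemma dst_append:
  assumes "walk E (p1 @ p2)" "p1 \<noteq> []" "p2 \<noteq> []"
  shows "dst E S (p1 @ p2) \<le> dst E S p1 + 1 + dst E S p2"
proof -
  let ?E = "E \<union> S"
  have w: "walk E p1" "walk E p2" "(last p1, hd p2) \<in> E"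
    using assms by (auto simp: walk_def successively_append_iff)
  have r: "(hd p1, last p1) \<in> ?E\<^sup>*" "(hd p2, last p2) \<in> ?E\<^sup>*"
    using w(1,2)[THEN walk_rtrancl] rtrancl_mono[of E ?E] by auto
  have a: "(last p1, hd p2) \<in> ?E" using w by simp
  have "distance ?E (hd p1) (last p2) \<le> distance ?E (hd p1) (last p1) + distance ?E (last p1) (last p2)"
    using r a by (intro distance_triangle) (auto intro: converse_rtrancl_into_rtrancl)
  also have "distance ?E (last p1) (last p2) \<le> distance ?E (last p1) (hd p2) + distance ?E (hd p2) (last p2)"
    using r a by (intro distance_triangle) auto
  also have "distance ?E (last p1) (hd p2) \<le> 1" using a by (rule distance_arc)
  finally show ?thesis using assms by (simp add: dst_def)
qed

text \<open>Reachability propagates along the path, so the pivot reaches its last vertex and is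
  reached by its first one; the star contains both arcs.\<close>

lemma dst_bridge:
  assumes p: "piece n E lab p" and x: "x \<in> anc E lab p" "x \<in> anc (E\<inverse>) lab p"
  shows "dst E (star E lab x \<union> S) p \<le> 2"
proof -
  let ?E = "E \<union> (star E lab x \<union> S)"
  obtain c where c: "c \<noteq> 1" "\<forall>v\<in>set p. lab v = c" "walk E p" using p by (auto simp: piece_def)
  obtain v w where v: "v \<in> set p" "v \<in> reach E lab x" and w: "w \<in> set p" "w \<in> reach (E\<inverse>) lab x"
    using x by (auto simp: anc_def reach_converse)
  have lx: "lab x = c" using v c reach_label by metis
  have up: "last p \<in> reach E lab u" if "u \<in> set p" for u
  proof -
    have "walk_suffix": "last p \<in> set (dropWhile (\<lambda>v. v \<notin> reach E lab u) p)"
      using c that reach_refl[of lab u E]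
      by (metis dropWhile_eq_Nil_conv last_appendR last_in_set takeWhile_dropWhile_id)
    then show ?thesis using walk_reach_dropWhile[OF c(3), of lab u] c(2) that by auto
  qed
  have down: "u \<in> reach E lab (hd p)" if "u \<in> set p" for u
  proof -
    have "hd p \<in> reach E lab (hd p)" using c by (auto simp: walk_def intro: reach_refl)
    then have "dropWhile (\<lambda>v. v \<notin> reach E lab (hd p)) p = p" using that by (cases p) auto
    then show ?thesis using walk_reach_dropWhile[OF c(3), of lab "hd p"] c(2,3) that by (auto simp: walk_def)
  qed
  have "last p \<in> reach E lab x" using reach_trans[OF v(2) up[OF v(1)]] .
  moreover have "x \<in> reach E lab (hd p)" using reach_trans[OF down[OF w(1)]] w(2) by (simp add: reach_converse)
  ultimately have "(hd p, x) \<in> ?E" "(x, last p) \<in> ?E" by (auto simp: star_def reach_converse)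
  then have "(hd p, last p) \<in> ?E ^^ 2" by (auto simp: numeral_2_eq_2)
  then show ?thesis unfolding dst_def using distance_le[of "hd p" "last p" 2 ?E] by (simp add: Un_assoc)
qed

section \<open>Square-root estimates behind the halving\<close>

lemma sum_sqrt_le: "finite X \<Longrightarrow> (\<Sum>x\<in>X. sqrt (real (s x))) \<le> sqrt (real (card X) * (\<Sum>x\<in>X. real (s x)))"
proof (rule real_le_rsqrt)
  have "(\<Sum>x\<in>X. 1 * sqrt (real (s x)))\<^sup>2 \<le> (\<Sum>x\<in>X. 1\<^sup>2) * (\<Sum>x\<in>X. (sqrt (real (s x)))\<^sup>2)"
    by (rule Cauchy_Schwarz_ineq_sum)
  then show "(\<Sum>x\<in>X. sqrt (real (s x)))\<^sup>2 \<le> real (card X) * (\<Sum>x\<in>X. real (s x))" by simp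
qed

text \<open>Cauchy-Schwarz for two terms, with the cross term bounded by the inequality of
  arithmetic and geometric mean for \<open>a * d\<close> and \<open>c * b\<close>.\<close>

lemma sqrt_mult_add_le:
  assumes "0 \<le> a" "0 \<le> b" "0 \<le> c" "0 \<le> d"
  shows "sqrt (a * b) + sqrt (c * d) \<le> sqrt ((a + c) * (b + d))"
proof (rule real_le_rsqrt)
  have "2 * (sqrt (a * d) * sqrt (c * b)) \<le> a * d + c * b"
    using assms arith_geo_mean_sqrt[of "a * d" "c * b"] by (simp add: real_sqrt_mult)
  moreover have "sqrt (a * d) * sqrt (c * b) = sqrt (a * b) * sqrt (c * d)"
    by (simp add: real_sqrt_mult)
  moreover have "(sqrt (a * b) + sqrt (c * d))\<^sup>2 = a * b + c * d + 2 * (sqrt (a * b) * sqrt (c * d))"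
    using assms by (simp add: power2_sum)
  ultimately show "(sqrt (a * b) + sqrt (c * d))\<^sup>2 \<le> (a + c) * (b + d)" by (simp add: algebra_simps)
qed

text \<open>\<open>b\<close> counts the bridges.  They leave no survivors, and this gain of \<open>b / 2\<close> on each side
  makes up for counting them in both \<open>a\<close> and \<open>d\<close>.\<close>

lemma half_survivors_bound:
  fixes a b :: nat
  assumes X: "finite X" "card X + b = a" and s: "2 * (\<Sum>x\<in>X. s x) \<le> a * a"
  shows "sqrt 2 * (\<Sum>x\<in>X. sqrt (real (s x))) \<le> sqrt (real a) * (real a - real b / 2)"
proof -
  have "2 * (\<Sum>x\<in>X. real (s x)) \<le> real a * real a"
    using s by (metis (mono_tags, lifting) of_nat_le_iff of_nat_mult of_nat_numeral of_nat_sum)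
  then have S: "(\<Sum>x\<in>X. real (s x)) \<le> real a * real a / 2" by simp
  have c: "real (card X) = real a - real b" using X(2) by auto
  have "sqrt 2 * (\<Sum>x\<in>X. sqrt (real (s x))) \<le> sqrt 2 * sqrt (real (card X) * (\<Sum>x\<in>X. real (s x)))"
    by (intro mult_left_mono sum_sqrt_le X) auto
  also have "\<dots> \<le> sqrt 2 * sqrt (real (card X) * (real a * real a / 2))"
    using S by (intro mult_left_mono real_sqrt_le_mono) auto
  also have "\<dots> = sqrt (real a) * sqrt ((real a - real b) * real a)"
    unfolding c[symmetric] by (simp add: real_sqrt_mult real_sqrt_divide)
  \<comment> \<open>The geometric mean of \<open>a - b\<close> and \<open>a\<close> is at most their
    arithmetic mean.\<close>
  also have "sqrt ((real a - real b) * real a) \<le> real a - real b / 2"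
  proof (rule real_le_lsqrt)
    show "0 \<le> real a - real b / 2" using X(2) by auto
    show "(real a - real b) * real a \<le> (real a - real b / 2)\<^sup>2"
      by (simp add: power2_eq_square algebra_simps)
  qed
  finally show ?thesis by (simp add: mult_left_mono)
qed

text \<open>The \<open>- 1\<close> absorbs the arc that joins two parts: twice
  \<open>3 * 2 ^ h - 1\<close> plus 1 is \<open>3 * 2 ^ Suc h - 1\<close>. The factor 3 keeps the
  constant part at least 2, the price of a bridge.\<close>

definition cost_bound :: "nat \<Rightarrow> real \<Rightarrow> real" where
  "cost_bound h z = 3 * 2 ^ h - 1 + z / sqrt 2 ^ h"

lemma cost_bound_mono: "z \<le> z' \<Longrightarrow> cost_bound h z \<le> cost_bound h z'"
  by (simp add: cost_bound_def divide_right_mono)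

text \<open>Induction on the number of draws, with \<open>h\<close> arbitrary because it falls only
  when the path is cut. Every vertex of the path is itself a bridge, so each draw ends the process
  for this path with probability at least \<open>1 / n\<close>; hence the residual term.\<close>

theorem EL_dst:
  assumes E: "is_digraph n E" and n: "n > 0"
  shows "labels_below lab q \<Longrightarrow> piece n E lab p \<Longrightarrow>
    EL n t (\<lambda>xs. dst E (arcs_of E lab q xs) p) \<le>
      cost_bound h (sqrt (card (anc E lab p) * card (anc (E\<inverse>) lab p))) + length p * (1 - 1 / n) ^ t"
proof (induction t arbitrary: lab q p h)
  case 0
  have "0 \<le> cost_bound h (sqrt (card (anc E lab p) * card (anc (E\<inverse>) lab p)))"
    unfolding cost_bound_def using one_le_power[of "2::real" h]
    by (intro add_nonneg_nonneg divide_nonneg_nonneg) (auto simp: le_diff_eq intro: order_trans[of 1 3])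
  moreover have "dst E {} p \<le> length p" using 0 by (intro dst_le_length) (simp add: piece_def)
  ultimately show ?case by simp
next
  case (Suc t)
  define A D where "A = anc E lab p" and "D = anc (E\<inverse>) lab p"
  define r where "r = (1 - 1 / real n) ^ t"
  have Ec: "is_digraph n (E\<inverse>)" using E by (simp add: is_digraph_converse)
  have w: "walk E p" "set p \<subseteq> {..<n}" "distinct p" using Suc.prems by (auto simp: piece_def walk_def)
  have pc: "piece n (E\<inverse>) lab (rev p)" using Suc.prems by (simp add: piece_converse)
  have fin: "finite A" "finite D" and sub: "A \<subseteq> {..<n}" "D \<subseteq> {..<n}"
    using anc_bounded[OF E w(2), of lab] anc_bounded[OF Ec w(2), of lab] finite_subset[OF _ finite_lessThan]
    by (auto simp: A_def D_def)
  have r0: "0 \<le> r" using n by (simp add: r_def)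
  have pAD: "set p \<subseteq> A \<inter> D"
    using self_subset_anc[OF Suc.prems(2)] self_subset_anc[OF pc] by (auto simp: A_def D_def anc_rev)
  define b where "b = card (A \<inter> D)"
  have lb: "length p \<le> b"
    using card_mono[OF _ pAD] fin distinct_card[OF w(3)] by (auto simp: b_def)
  have "p \<noteq> []" using w(1) by (simp add: walk_def)
  then have b1: "1 \<le> b" using lb by (cases p) auto
  have bA: "card (A - D) + b = card A" and bD: "card (D - A) + b = card D"
    using card_Int_Diff[OF fin(1), of D] card_Int_Diff[OF fin(2), of A]
    by (simp_all add: b_def Int_commute)
  let ?a = "real (card A)" and ?d = "real (card D)"
  show ?case
  proof (cases h)
    \<comment> \<open>No generation is left. All vertices of the path are both ancestors and
      descendants, so its length is at most \<open>sqrt (?a * ?d)\<close>.\<close>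
    case 0
    have "real (length p) \<le> sqrt (?a * ?d)"
    proof (rule real_le_rsqrt)
      have "real (length p) * real (length p) \<le> ?a * ?d"
        using lb bA bD by (intro mult_mono) auto
      then show "(real (length p))\<^sup>2 \<le> ?a * ?d" by (simp add: power2_eq_square)
    qed
    then have "EL n (Suc t) (\<lambda>xs. dst E (arcs_of E lab q xs) p) \<le> sqrt (?a * ?d)"
      using dst_le_length[OF w(1)] by (intro EL_le_const n) (rule order_trans)
    also have "\<dots> \<le> cost_bound h (sqrt (?a * ?d)) + length p * (1 - 1 / real n) ^ Suc t"
      using 0 n by (simp add: cost_bound_def)
    finally show ?thesis by (simp add: A_def D_def)
  next
    case (Suc h')
    define l' where "l' x = relabel E lab q (q + 1) x" for x
    define X where "X x = EL n t (\<lambda>xs. dst E (star E lab x \<union> arcs_of E (l' x) (q + 2) xs) p)" for x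
    define sA where "sA x = card (survivors E lab q (q + 1) p x)" for x
    define sD where "sD x = card (survivors (E\<inverse>) lab (q + 1) q (rev p) x)" for x
    define z where "z = sqrt (?a * ?d)"
    define C where "C = 3 * 2 ^ h - (1::real)"
    note fr = labels_below_fresh[OF Suc.prems(1)]
    have below: "labels_below (l' x) (q + 2)" for x
      using labels_below_relabel[OF Suc.prems(1)] by (simp add: l'_def)
    have IH: "EL n t (\<lambda>xs. dst E (star E lab x \<union> arcs_of E (l' x) (q + 2) xs) p') \<le>
        cost_bound g (sqrt (real (card (anc E (l' x) p')) * real (card (anc (E\<inverse>) (l' x) p')))) + length p' * r"
      if "piece n E (l' x) p'" for x g p'
    proof -
      have "EL n t (\<lambda>xs. dst E (star E lab x \<union> arcs_of E (l' x) (q + 2) xs) p')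
         \<le> EL n t (\<lambda>xs. dst E (arcs_of E (l' x) (q + 2) xs) p')"
        using that by (intro EL_mono dst_mono) (auto simp: piece_def)
      then show ?thesis using Suc.IH[OF below that, of g] by (simp add: r_def)
    qed
    have out: "X x \<le> C + z / sqrt 2 ^ h + length p * r" if "x \<notin> A" "x \<notin> D" for x
    proof -
      note u = piece_unrelated[OF Suc.prems(2) that[unfolded A_def D_def] fr, folded l'_def]
      have "card (anc E (l' x) p) \<le> card A" "card (anc (E\<inverse>) (l' x) p) \<le> card D"
        using u(2) fin by (auto simp: A_def D_def intro!: card_mono)
      then have "sqrt (real (card (anc E (l' x) p)) * real (card (anc (E\<inverse>) (l' x) p))) \<le> z"
        unfolding z_def by (intro real_sqrt_le_mono mult_mono) auto
      from cost_bound_mono[OF this, of h] IH[OF u(1), of h] show ?thesis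
        by (simp add: X_def C_def cost_bound_def)
    qed
    have bridge: "X x \<le> C" if "x \<in> A" "x \<in> D" for x
    proof -
      have "X x \<le> 2" unfolding X_def
        using that dst_bridge[OF Suc.prems(2)] by (intro EL_le_const n) (auto simp: A_def D_def)
      also have "2 \<le> C" using one_le_power[of "2::real" h] by (simp add: C_def)
      finally show ?thesis .
    qed
    \<comment> \<open>Both parts are charged with one generation less; the factor
      \<open>sqrt 2\<close> converts division by \<open>sqrt 2 ^ h'\<close> into division by
      \<open>sqrt 2 ^ h\<close>.\<close>
    have split: "X x \<le> C + sqrt 2 * sqrt (real s1 * real s2) / sqrt 2 ^ h + length p * r"
      if p: "p = p1 @ p2" and P: "p1 \<noteq> [] \<Longrightarrow> piece n E (l' x) p1" "p2 \<noteq> [] \<Longrightarrow> piece n E (l' x) p2"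
        and s: "card (anc E (l' x) p1) + card (anc E (l' x) p2) \<le> s1"
         "card (anc (E\<inverse>) (l' x) p1) + card (anc (E\<inverse>) (l' x) p2) \<le> s2" for x p1 p2 s1 s2
    proof -
      let ?z = "\<lambda>p. sqrt (real (card (anc E (l' x) p)) * real (card (anc (E\<inverse>) (l' x) p)))"
      have "?z p1 + ?z p2 \<le> sqrt ((real (card (anc E (l' x) p1)) + card (anc E (l' x) p2)) *
         (real (card (anc (E\<inverse>) (l' x) p1)) + card (anc (E\<inverse>) (l' x) p2)))"
        by (intro sqrt_mult_add_le) auto
      also have "\<dots> \<le> sqrt (real s1 * real s2)"
        using s by (intro real_sqrt_le_mono mult_mono) (auto simp flip: of_nat_add)
      finally have zz: "?z p1 + ?z p2 \<le> sqrt (real s1 * real s2)" .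
      define ell where "ell p' = cost_bound h' (?z p') + length p' * r" for p'
      have "X x \<le> ell p1 + 1 + ell p2"
      proof (cases "p1 = [] \<or> p2 = []")
        case True
        have "0 \<le> ell p'" for p'
          unfolding ell_def cost_bound_def using one_le_power[of "2::real" h'] r0
          by (intro add_nonneg_nonneg divide_nonneg_nonneg mult_nonneg_nonneg)
             (auto simp: le_diff_eq intro: order_trans[of 1 3])
        moreover have "X x \<le> ell p1 \<or> X x \<le> ell p2"
          using True p \<open>p \<noteq> []\<close> P IH[of x _ h'] unfolding X_def ell_def by auto
        ultimately show ?thesis by (smt (verit))
      next
        case False
        let ?S = "\<lambda>xs. star E lab x \<union> arcs_of E (l' x) (q + 2) xs"
        have "X x \<le> EL n t (\<lambda>xs. dst E (?S xs) p1 + 1 + dst E (?S xs) p2)"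
          unfolding X_def using w(1) False dst_append unfolding p by (intro EL_mono) auto
        also have "\<dots> = EL n t (\<lambda>xs. dst E (?S xs) p1) + 1 + EL n t (\<lambda>xs. dst E (?S xs) p2)"
          using n by (simp add: EL_add EL_const)
        also have "\<dots> \<le> ell p1 + 1 + ell p2"
          unfolding ell_def using IH P False by (intro add_mono) auto
        finally show ?thesis .
      qed
      also have "\<dots> = C + (?z p1 + ?z p2) / sqrt 2 ^ h' + length p * r"
        using Suc by (simp add: ell_def cost_bound_def C_def p add_divide_distrib algebra_simps)
      also have "\<dots> \<le> C + sqrt (real s1 * real s2) / sqrt 2 ^ h' + length p * r"
        using zz by (intro add_mono divide_right_mono) auto
      finally show ?thesis using Suc by simp
    qed
    let ?k = "sqrt 2 / sqrt 2 ^ h"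
    have above: "X x \<le> C + ?k * sqrt ?d * sqrt (sA x) + length p * r" if x: "x \<in> A - D" for x
    proof -
      obtain p1 p2 where "p = p1 @ p2" "p1 \<noteq> [] \<Longrightarrow> piece n E (l' x) p1" "p2 \<noteq> [] \<Longrightarrow> piece n E (l' x) p2"
        "card (anc E (l' x) p1) + card (anc E (l' x) p2) \<le> sA x"
        "card (anc (E\<inverse>) (l' x) p1) + card (anc (E\<inverse>) (l' x) p2) \<le> card D"
        using split_above[OF E Suc.prems(2) fr, of x thesis] x
        unfolding A_def D_def sA_def l'_def by blast
      from split[OF this] show ?thesis by (simp add: real_sqrt_mult mult_ac)
    qed
    have under: "X x \<le> C + ?k * sqrt ?a * sqrt (sD x) + length p * r" if x: "x \<in> D - A" for x
    proof -
      obtain p1 p2 where "p = p1 @ p2" "p1 \<noteq> [] \<Longrightarrow> piece n E (l' x) p1" "p2 \<noteq> [] \<Longrightarrow> piece n E (l' x) p2"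
        "card (anc E (l' x) p1) + card (anc E (l' x) p2) \<le> card A"
        "card (anc (E\<inverse>) (l' x) p1) + card (anc (E\<inverse>) (l' x) p2) \<le> sD x"
        using split_below[OF E Suc.prems(2) fr, of x thesis] x
        unfolding A_def D_def sD_def l'_def by blast
      from split[OF this] show ?thesis by (simp add: real_sqrt_mult mult_ac)
    qed
    have SA: "sqrt 2 * (\<Sum>x\<in>A - D. sqrt (sA x)) \<le> sqrt ?a * (?a - real b / 2)"
    proof (rule half_survivors_bound)
      have "(\<Sum>x\<in>A - D. sA x) \<le> (\<Sum>x\<in>A. sA x)" using fin by (intro sum_mono2) auto
      then show "2 * (\<Sum>x\<in>A - D. sA x) \<le> card A * card A"
        using sum_survivors[OF E Suc.prems(2) fr] by (simp add: A_def sA_def)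
    qed (use fin bA in auto)
    have SD: "sqrt 2 * (\<Sum>x\<in>D - A. sqrt (sD x)) \<le> sqrt ?d * (?d - real b / 2)"
    proof (rule half_survivors_bound)
      have "(\<Sum>x\<in>D - A. sD x) \<le> (\<Sum>x\<in>D. sD x)" using fin by (intro sum_mono2) auto
      then show "2 * (\<Sum>x\<in>D - A. sD x) \<le> card D * card D"
        using sum_survivors[OF Ec pc fresh_sym[OF fr]] by (simp add: D_def sD_def anc_rev)
    qed (use fin bD in auto)
    define m where "m = card ({..<n} - (A \<union> D))"
    have cn: "real n = real m + real (card (A - D)) + real (card (D - A)) + real b"
    proof -
      have "{..<n} = ({..<n} - (A \<union> D)) \<union> ((A - D) \<union> ((D - A) \<union> (A \<inter> D)))" using sub by auto
      also have "card \<dots> = m + (card (A - D) + (card (D - A) + b))"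
        unfolding m_def b_def using fin by (subst card_Un_disjoint; auto)+
      finally show ?thesis by simp
    qed
    have "(\<Sum>x<n. X x) = (\<Sum>x\<in>{..<n} - (A \<union> D). X x) + (\<Sum>x\<in>A - D. X x) + (\<Sum>x\<in>D - A. X x) + (\<Sum>x\<in>A \<inter> D. X x)"
    proof -
      have "{..<n} = ({..<n} - (A \<union> D)) \<union> ((A - D) \<union> ((D - A) \<union> (A \<inter> D)))" using sub by auto
      then have "(\<Sum>x<n. X x) = sum X (({..<n} - (A \<union> D)) \<union> ((A - D) \<union> ((D - A) \<union> (A \<inter> D))))" by simp
      also have "\<dots> = (\<Sum>x\<in>{..<n} - (A \<union> D). X x) + ((\<Sum>x\<in>A - D. X x) + ((\<Sum>x\<in>D - A. X x) + (\<Sum>x\<in>A \<inter> D. X x)))"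
        using fin by (subst sum.union_disjoint; auto)+
      finally show ?thesis by simp
    qed
    also have "\<dots> \<le> real m * (C + z / sqrt 2 ^ h + length p * r)
       + (real (card (A - D)) * (C + length p * r) + ?k * sqrt ?d * (\<Sum>x\<in>A - D. sqrt (sA x)))
       + (real (card (D - A)) * (C + length p * r) + ?k * sqrt ?a * (\<Sum>x\<in>D - A. sqrt (sD x)))
       + real b * C"
    proof (intro add_mono)
      show "(\<Sum>x\<in>{..<n} - (A \<union> D). X x) \<le> real m * (C + z / sqrt 2 ^ h + length p * r)"
        using out unfolding m_def by (intro sum_bounded_above) auto
      have "(\<Sum>x\<in>A - D. X x) \<le> (\<Sum>x\<in>A - D. (C + length p * r) + ?k * sqrt ?d * sqrt (sA x))"
        using above by (intro sum_mono) (auto simp: algebra_simps)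
      then show "(\<Sum>x\<in>A - D. X x) \<le> real (card (A - D)) * (C + length p * r) + ?k * sqrt ?d * (\<Sum>x\<in>A - D. sqrt (sA x))"
        by (simp only: sum.distrib sum_distrib_left sum_constant distrib_left)
      have "(\<Sum>x\<in>D - A. X x) \<le> (\<Sum>x\<in>D - A. (C + length p * r) + ?k * sqrt ?a * sqrt (sD x))"
        using under by (intro sum_mono) (auto simp: algebra_simps)
      then show "(\<Sum>x\<in>D - A. X x) \<le> real (card (D - A)) * (C + length p * r) + ?k * sqrt ?a * (\<Sum>x\<in>D - A. sqrt (sD x))"
        by (simp only: sum.distrib sum_distrib_left sum_constant distrib_left)
      show "(\<Sum>x\<in>A \<inter> D. X x) \<le> real b * C"
        using bridge unfolding b_def by (intro sum_bounded_above) auto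
    qed
    also have "\<dots> = real n * C + (real n - real b) * (length p * r) + real m * (z / sqrt 2 ^ h)
      + (sqrt ?d * (sqrt 2 * (\<Sum>x\<in>A - D. sqrt (sA x))) + sqrt ?a * (sqrt 2 * (\<Sum>x\<in>D - A. sqrt (sD x)))) / sqrt 2 ^ h"
      unfolding cn by (simp add: algebra_simps add_divide_distrib)
    \<comment> \<open>Since \<open>b \<ge> 1\<close>, at most \<open>n - 1\<close> pivots carry the
      residual term. The two halving estimates give \<open>z * (?a - b / 2)\<close> and
      \<open>z * (?d - b / 2)\<close>.\<close>
    also have "\<dots> \<le> real n * C + (real n - 1) * (length p * r) + real m * (z / sqrt 2 ^ h)
      + (sqrt ?d * (sqrt ?a * (?a - real b / 2)) + sqrt ?a * (sqrt ?d * (?d - real b / 2))) / sqrt 2 ^ h"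
      using b1 r0 SA SD by (intro add_mono divide_right_mono mult_right_mono mult_left_mono) auto
    also have "\<dots> = real n * C + (real n - 1) * (length p * r) + (real m + ?a + ?d - real b) * (z / sqrt 2 ^ h)"
      unfolding z_def by (simp add: real_sqrt_mult add_divide_distrib diff_divide_distrib algebra_simps)
    \<comment> \<open>By inclusion and exclusion the coefficient of \<open>z / sqrt 2 ^ h\<close> is
      exactly \<open>n\<close>, so averaging over all pivots reproduces
      \<open>cost_bound h z\<close>.\<close>
    also have "real m + ?a + ?d - real b = real n"
      using cn bA bD by linarith
    also have "real n * C + (real n - 1) * (length p * r) + real n * (z / sqrt 2 ^ h)
       = real n * (cost_bound h z + length p * (1 - 1 / n) ^ Suc t)"
      using n by (simp add: cost_bound_def C_def r_def field_simps)
    finally have "(\<Sum>x<n. X x) / real n \<le> cost_bound h z + length p * (1 - 1 / n) ^ Suc t"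
      using n by (simp add: divide_le_eq mult.commute)
    then show ?thesis by (simp add: X_def l'_def z_def A_def D_def)
  qed
qed

section \<open>Budgets and repetitions\<close>

definition outdeg :: "(nat \<times> nat) set \<Rightarrow> nat \<Rightarrow> nat" where
  "outdeg E v = card {w. (v, w) \<in> E}"

text \<open>The budgets \<open>b1\<close> (scanned arcs) and \<open>b2\<close> (recorded shortcuts) are only tested before a draw, so they
  can be exceeded by the cost of a single draw.\<close>

primrec trunc_arcs :: "(nat \<times> nat) set \<Rightarrow> nat \<Rightarrow> nat \<Rightarrow> (nat \<Rightarrow> nat) \<Rightarrow> nat \<Rightarrow> nat \<Rightarrow> nat \<Rightarrow> nat list \<Rightarrow> (nat \<times> nat) set" where
  "trunc_arcs E b1 b2 lab q w a [] = {}"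
| "trunc_arcs E b1 b2 lab q w a (x # xs) =
     (if w < b1 \<and> a < b2
      then star E lab x \<union> trunc_arcs E b1 b2 (relabel E lab q (q + 1) x) (q + 2)
        (w + sum (outdeg E) (reach E lab x) + sum (outdeg (E\<inverse>)) (reach (E\<inverse>) lab x))
        (a + card (reach E lab x) + card (reach (E\<inverse>) lab x)) xs
      else trunc_arcs E b1 b2 lab (q + 2) w a xs)"

lemma trunc_arcs_eq:
  assumes "w + visit_weight E (outdeg E) (outdeg (E\<inverse>)) lab q xs < b1"
    "a + visit_weight E (\<lambda>_. 1) (\<lambda>_. 1) lab q xs < b2"
  shows "trunc_arcs E b1 b2 lab q w a xs = arcs_of E lab q xs"
  using assms by (induction xs arbitrary: lab q w a) (simp_all add: add.assoc)

lemma sum_outdeg: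
  assumes E: "is_digraph n E" shows "(\<Sum>v<n. outdeg E v) = card E"
proof -
  have "Sigma {..<n} (\<lambda>v. {w. (v, w) \<in> E}) = E" using E by (auto simp: is_digraph_def)
  moreover have "\<forall>v\<in>{..<n}. finite {w. (v, w) \<in> E}"
    using E by (auto simp: is_digraph_def intro!: finite_subset[of _ "{..<n}"])
  ultimately show ?thesis unfolding outdeg_def using card_SigmaI[of "{..<n}" "\<lambda>v. {w. (v, w) \<in> E}"] by simp
qed

text \<open>The factor 3 comes from \<open>2 \<le> (4 / 3) ^ 3\<close>.\<close>

lemma visit_bound_le:
  assumes "y \<le> real n" "0 \<le> y" "n < 2 ^ L" shows "visit_bound y \<le> 3 * L"
proof -
  have "1 + y \<le> real (Suc n)" using assms by simp
  also have "\<dots> \<le> real (2 ^ L)" using assms(3) by (intro of_nat_mono) simp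
  also have "\<dots> = 2 ^ L" by simp
  finally have "ln (1 + y) \<le> ln (2 ^ L)" using assms by (subst ln_le_cancel_iff) auto
  also have "\<dots> = L * ln 2" by (simp add: ln_realpow)
  also have "ln (2::real) \<le> ln ((4 / 3) ^ 3)" by (subst ln_le_cancel_iff) (auto simp: power3_eq_cube)
  also have "\<dots> = 3 * ln (4 / 3)" by (subst ln_realpow) auto
  finally have "ln (1 + y) \<le> (3 * L) * ln (4 / 3)" by (simp add: mult_left_mono)
  then show ?thesis by (simp add: visit_bound_def divide_le_eq)
qed

lemma EL_visit_weight_le:
  assumes E: "is_digraph n E" and n: "n > 0" "n < 2 ^ L"
  shows "EL n t (\<lambda>xs. real (visit_weight E f g (\<lambda>_. 0) 2 xs)) \<le> 3 * L * (\<Sum>v<n. f v + g v)"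
proof -
  have c: "visit_bound (card (anc D (\<lambda>_. 0) [v])) \<le> 3 * L" if "is_digraph n D" "v < n" for D v
    using anc_bounded[OF that(1), of "[v]" "\<lambda>_. 0"] that(2) card_mono[of "{..<n}"] n
    by (intro visit_bound_le[of _ n]) fastforce+
  have Ec: "is_digraph n (E\<inverse>)" using E by (simp add: is_digraph_converse)
  have "EL n t (\<lambda>xs. real (visit_weight E f g (\<lambda>_. 0) 2 xs)) \<le>
     (\<Sum>v<n. real (f v) * visit_bound (card (anc E (\<lambda>_. 0) [v])) + real (g v) * visit_bound (card (anc (E\<inverse>) (\<lambda>_. 0) [v])))"
    using EL_visit_weight[OF E n(1), of "\<lambda>_. 0" 2 t f g] by (simp add: labels_below_def)
  also have "\<dots> \<le> (\<Sum>v<n. real (f v) * (3 * L) + real (g v) * (3 * L))"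
    using c[OF E] c[OF Ec] by (intro sum_mono add_mono mult_left_mono) auto
  also have "\<dots> = 3 * L * (\<Sum>v<n. f v + g v)"
    by (simp add: sum.distrib sum_distrib_left algebra_simps)
  finally show ?thesis .
qed

definition rep_arcs :: "(nat \<times> nat) set \<Rightarrow> nat \<Rightarrow> nat \<Rightarrow> nat list \<Rightarrow> (nat \<times> nat) set" where
  "rep_arcs E b1 b2 xs = trunc_arcs E b1 b2 (\<lambda>_. 0) 2 0 0 xs"

text \<open>One list is cut into blocks of \<open>t\<close> draws, one per repetition, because the
  program draws all its random numbers beforehand.\<close>

primrec all_arcs :: "(nat \<times> nat) set \<Rightarrow> nat \<Rightarrow> nat \<Rightarrow> nat \<Rightarrow> nat \<Rightarrow> nat list \<Rightarrow> (nat \<times> nat) set" where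
  "all_arcs E b1 b2 t 0 xs = {}"
| "all_arcs E b1 b2 t (Suc R) xs = rep_arcs E b1 b2 (take t xs) \<union> all_arcs E b1 b2 t R (drop t xs)"

text \<open>Makes the residual term of \<open>EL_dst\<close> at most 1: \<open>(1 - 1/n) ^ n\<close>
  is at most \<open>exp (-1) \<le> 1/2\<close>, and \<open>n < 2 ^ L\<close>.\<close>

lemma survival_prob:
  fixes n L :: nat
  assumes "n > 0" "n < 2 ^ L" shows "real n * (1 - 1 / n) ^ (n * L) \<le> 1"
proof -
  have "1 - 1 / real n \<le> exp (- (1 / real n))" using exp_ge_add_one_self[of "- (1 / real n)"] by simp
  then have "(1 - 1 / real n) ^ (n * L) \<le> exp (- (1 / real n)) ^ (n * L)"
    using assms by (intro power_mono) auto
  also have "\<dots> = exp (- real L)" using assms by (simp flip: exp_of_nat_mult)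
  also have "\<dots> \<le> 1 / 2 ^ L"
  proof -
    have "(2::real) ^ L \<le> exp 1 ^ L" using exp_ge_add_one_self[of 1] by (intro power_mono) auto
    then have "2 ^ L \<le> exp (real L)" by (simp flip: exp_of_nat_mult)
    then show ?thesis by (simp add: exp_minus field_simps)
  qed
  also have "\<dots> \<le> 1 / n"
  proof -
    have "real n < 2 ^ L" using assms(2) by (metis of_nat_less_numeral_power_cancel_iff)
    then show ?thesis using assms by (intro divide_left_mono) auto
  qed
  finally show ?thesis using assms by (simp add: field_simps)
qed

text \<open>With \<open>y = n powr (2/3)\<close> one has \<open>n = y * sqrt y\<close>, so both
  terms of \<open>cost_bound\<close> are of order \<open>y\<close> when \<open>2 ^ h\<close> is
  about \<open>y\<close>; rounding \<open>h\<close> down costs a constant. The \<open>- 1\<close>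
  leaves room for the residual term.\<close>

lemma cost_bound_two_thirds:
  assumes "n \<ge> 1" shows "\<exists>h. cost_bound h (real n) \<le> 5 * real n powr (2/3) - 1"
proof -
  define y where "y = real n powr (2/3)"
  have y: "y \<ge> 1" unfolding y_def using assms by (intro ge_one_powr_ge_zero) auto
  define h where "h = nat \<lfloor>log 2 y\<rfloor>"
  have "0 \<le> log 2 y" using y by simp
  then have "real h \<le> log 2 y" "log 2 y < real h + 1"
    unfolding h_def by linarith+
  then have 1: "2 ^ h \<le> y" and 2: "y < 2 * 2 ^ h"
    using y by (auto simp: le_log_iff log_less_iff powr_realpow powr_add)
  have "sqrt y = real n powr (1/3)"
    by (simp add: y_def powr_half_sqrt[symmetric] powr_powr)
  then have "real n = y * sqrt y"
    using assms by (simp add: y_def flip: powr_add)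
  also have "\<dots> \<le> y * sqrt (4 * 2 ^ h)" using y 2 by (intro mult_left_mono real_sqrt_le_mono) auto
  also have "\<dots> = 2 * y * sqrt 2 ^ h" by (simp add: real_sqrt_mult real_sqrt_power)
  finally have "real n / sqrt 2 ^ h \<le> 2 * y" by (simp add: divide_le_eq)
  then have "cost_bound h (real n) \<le> 5 * y - 1" using 1 unfolding cost_bound_def by linarith
  then show ?thesis unfolding y_def by blast
qed

lemma EL_of_bool_disj:
  "EL n t (\<lambda>xs. of_bool (P xs \<or> Q xs)) \<le> EL n t (\<lambda>xs. of_bool (P xs)) + EL n t (\<lambda>xs. of_bool (Q xs))"
  unfolding EL_add[symmetric] by (intro EL_mono) auto

text \<open>Markov's inequality three times. Scanned arcs have mean at most
  \<open>6 * L * card E\<close> and shortcuts at most \<open>6 * L * n\<close>, so budgets eight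
  times as large fail with probability at most 1/8 each; the distance has mean at most
  \<open>5 * n powr (2/3)\<close> and exceeds four times this with probability at most 1/4. Within
  the budgets the truncated and the full process agree.\<close>

lemma repetition_fails:
  assumes E: "is_digraph n E" and n: "n < 2 ^ L" and ne: "E \<noteq> {}" and uv: "u < n" "v < n" "(u, v) \<in> E\<^sup>*"
  shows "EL n (n * L) (\<lambda>xs. of_bool (real (distance (E \<union> rep_arcs E (48 * card E * L) (48 * n * L) xs) u v)
    \<ge> 20 * real n powr (2/3))) \<le> 1 / 2"
proof -
  let ?t = "n * L" and ?y = "real n powr (2/3)" and ?l = "\<lambda>_::nat. 0::nat"
  have n0: "n > 0" using uv by simp
  have L0: "L > 0" using n n0 by (cases L) auto
  have finE: "finite E" using E by (auto simp: is_digraph_def intro: finite_subset)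
  then have m0: "card E > 0" using ne by (simp add: card_gt_0_iff)
  have Ec: "is_digraph n (E\<inverse>)" using E by (simp add: is_digraph_converse)
  obtain p where p: "walk E p" "hd p = u" "last p = v" "set p \<subseteq> {u} \<union> snd ` E"
    using walk_exists[OF uv(3)] .
  have "snd ` E \<subseteq> {..<n}" using E by (auto simp: is_digraph_def)
  then have sp: "set p \<subseteq> {..<n}" using p(4) uv(1) by blast
  then have pc: "piece n E ?l p" using p(1) by (auto simp: piece_def)
  let ?W = "\<lambda>xs. real (visit_weight E (outdeg E) (outdeg (E\<inverse>)) ?l 2 xs)"
  let ?O = "\<lambda>xs. real (visit_weight E (\<lambda>_. 1) (\<lambda>_. 1) ?l 2 xs)"
  let ?d = "\<lambda>xs. dst E (arcs_of E ?l 2 xs) p"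
  define bW bO where "bW = 48 * card E * L" and "bO = 48 * n * L"
  have b0: "0 < real bW" "0 < real bO" using m0 L0 n0 by (auto simp: bW_def bO_def)
  have "EL n ?t ?W \<le> 3 * L * (\<Sum>v<n. outdeg E v + outdeg (E\<inverse>) v)"
    using EL_visit_weight_le[OF E n0 n, of ?t "outdeg E" "outdeg (E\<inverse>)"] by simp
  also have "\<dots> = 6 * L * card E"
    by (simp only: sum.distrib sum_outdeg[OF E] sum_outdeg[OF Ec]) (simp add: card_inverse)
  finally have w1: "EL n ?t ?W / real bW \<le> 1 / 8" using b0 by (simp add: divide_le_eq bW_def)
  have W: "EL n ?t (\<lambda>xs. of_bool (?W xs \<ge> real bW)) \<le> 1 / 8"
    by (rule order_trans[OF EL_markov w1]) (use n0 b0 in auto)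
  have "EL n ?t ?O \<le> 6 * L * n"
    using EL_visit_weight_le[OF E n0 n, of ?t "\<lambda>_. 1" "\<lambda>_. 1"] by simp
  then have o1: "EL n ?t ?O / real bO \<le> 1 / 8" using b0 by (simp add: divide_le_eq bO_def)
  have O: "EL n ?t (\<lambda>xs. of_bool (?O xs \<ge> real bO)) \<le> 1 / 8"
    by (rule order_trans[OF EL_markov o1]) (use n0 b0 in auto)
  obtain h where h: "cost_bound h (real n) \<le> 5 * ?y - 1"
    using cost_bound_two_thirds[of n] n0 by auto
  have "card (anc E ?l p) \<le> n" "card (anc (E\<inverse>) ?l p) \<le> n"
    using card_mono[OF _ anc_bounded[OF E sp, of ?l]] card_mono[OF _ anc_bounded[OF Ec sp, of ?l]] by auto
  then have "sqrt (real (card (anc E ?l p)) * real (card (anc (E\<inverse>) ?l p))) \<le> sqrt (real n * real n)"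
    by (intro real_sqrt_le_mono mult_mono) auto
  then have "sqrt (real (card (anc E ?l p)) * real (card (anc (E\<inverse>) ?l p))) \<le> real n" by simp
  from cost_bound_mono[OF this, of h] h
  have "cost_bound h (sqrt (real (card (anc E ?l p)) * real (card (anc (E\<inverse>) ?l p)))) \<le> 5 * ?y - 1"
    by (rule order_trans)
  moreover have "real (length p) * (1 - 1 / n) ^ ?t \<le> 1"
  proof -
    have "card (set p) \<le> n" using card_mono[OF _ sp] by simp
    then have "length p \<le> n" using p(1) distinct_card[of p] by (simp add: walk_def)
    then have "real (length p) * (1 - 1 / n) ^ ?t \<le> real n * (1 - 1 / n) ^ ?t"
      using n0 by (intro mult_right_mono) auto
    then show ?thesis using survival_prob[OF n0 n] by simp
  qed
  moreover have "labels_below ?l 2" by (simp add: labels_below_def)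
  ultimately have "EL n ?t ?d \<le> 5 * ?y"
    using EL_dst[OF E n0, of ?l 2 p ?t h] pc by simp
  moreover have y0: "?y > 0" using n0 by simp
  ultimately have d1: "EL n ?t ?d / (20 * ?y) \<le> 1 / 4" by (simp add: divide_le_eq)
  have D: "EL n ?t (\<lambda>xs. of_bool (?d xs \<ge> 20 * ?y)) \<le> 1 / 4"
    by (rule order_trans[OF EL_markov d1]) (use n0 y0 in \<open>auto simp: dst_def\<close>)
  have "EL n ?t (\<lambda>xs. of_bool (real (distance (E \<union> rep_arcs E bW bO xs) u v) \<ge> 20 * ?y))
    \<le> EL n ?t (\<lambda>xs. of_bool (?W xs \<ge> real bW \<or> ?O xs \<ge> real bO \<or> ?d xs \<ge> 20 * ?y))"
  proof (rule EL_mono)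
    fix xs :: "nat list"
    show "of_bool (real (distance (E \<union> rep_arcs E bW bO xs) u v) \<ge> 20 * ?y)
      \<le> (of_bool (?W xs \<ge> real bW \<or> ?O xs \<ge> real bO \<or> ?d xs \<ge> 20 * ?y) :: real)"
    proof (cases "?W xs \<ge> real bW \<or> ?O xs \<ge> real bO")
      case False
      then have "rep_arcs E bW bO xs = arcs_of E ?l 2 xs"
        unfolding rep_arcs_def by (intro trunc_arcs_eq) auto
      then show ?thesis using p by (auto simp: dst_def)
    qed auto
  qed
  also have "\<dots> \<le> 1 / 8 + (1 / 8 + 1 / 4)"
    by (intro order_trans[OF EL_of_bool_disj] add_mono W O D)
  finally show ?thesis by (simp add: bW_def bO_def)
qed

lemma EL_append: "EL n (s + t) f = EL n s (\<lambda>xs. EL n t (\<lambda>ys. f (xs @ ys)))"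
  by (induction s arbitrary: f) simp_all

lemma EL_cong:
  assumes "\<And>xs. length xs = t \<Longrightarrow> f xs = g xs" shows "EL n t f = EL n t g"
  using assms by (intro antisym EL_mono) auto

lemma EL_nonneg: "(\<And>xs. f xs \<ge> 0) \<Longrightarrow> EL n t f \<ge> 0"
  by (induction t arbitrary: f) (auto intro!: sum_nonneg divide_nonneg_nonneg)

text \<open>More shortcuts only help, so a pair stays far apart only if every repetition fails for
  it, and the blocks of draws are independent.\<close>

lemma repetitions_fail:
  assumes E: "is_digraph n E" and n: "n < 2 ^ L" and ne: "E \<noteq> {}" and uv: "u < n" "v < n" "(u, v) \<in> E\<^sup>*"
  shows "EL n (R * (n * L)) (\<lambda>xs. of_bool (real (distance
      (E \<union> all_arcs E (48 * card E * L) (48 * n * L) (n * L) R xs) u v) \<ge> 20 * real n powr (2/3))) \<le> (1 / 2) ^ R"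
proof (induction R)
  case 0
  show ?case by simp
next
  case (Suc R)
  define t y where "t = n * L" and "y = 20 * real n powr (2/3)"
  define r a where "r = rep_arcs E (48 * card E * L) (48 * n * L)" and "a = all_arcs E (48 * card E * L) (48 * n * L) t R"
  define B where "B S = (of_bool (real (distance (E \<union> S) u v) \<ge> y) :: real)" for S
  have *: "B (S \<union> S') \<le> B S * B S'" for S S'
  proof -
    have "(u, v) \<in> (E \<union> S)\<^sup>*" "(u, v) \<in> (E \<union> S')\<^sup>*"
      using uv(3) rtrancl_mono[of E "E \<union> S"] rtrancl_mono[of E "E \<union> S'"] by auto
    then have "distance (E \<union> (S \<union> S')) u v \<le> distance (E \<union> S) u v"
      "distance (E \<union> (S \<union> S')) u v \<le> distance (E \<union> S') u v"
      by (auto intro!: distance_mono)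
    then show ?thesis unfolding B_def by auto
  qed
  have "EL n (Suc R * t) (\<lambda>xs. B (all_arcs E (48 * card E * L) (48 * n * L) t (Suc R) xs))
    = EL n t (\<lambda>xs. EL n (R * t) (\<lambda>ys. B (r xs \<union> a ys)))"
    unfolding mult_Suc EL_append by (intro EL_cong) (simp add: r_def a_def)
  also have "\<dots> \<le> EL n t (\<lambda>xs. EL n (R * t) (\<lambda>ys. B (r xs) * B (a ys)))"
    by (intro EL_mono *)
  also have "\<dots> = EL n t (\<lambda>xs. EL n (R * t) (\<lambda>ys. B (a ys)) * B (r xs))"
    by (intro EL_cong) (subst EL_scale, rule mult.commute)
  also have "\<dots> = EL n (R * t) (\<lambda>ys. B (a ys)) * EL n t (\<lambda>xs. B (r xs))"
    by (rule EL_scale)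
  also have "\<dots> \<le> (1 / 2) ^ R * (1 / 2)"
    using Suc.IH repetition_fails[OF E n ne uv] unfolding B_def a_def r_def t_def y_def
    by (intro mult_mono EL_nonneg) auto
  finally show ?case by (simp add: B_def t_def y_def)
qed

lemma star_subset: "is_digraph n E \<Longrightarrow> x < n \<Longrightarrow> star E lab x \<subseteq> shortcuts n E"
  using reach_bounded[of n E x lab] reach_bounded[of n "E\<inverse>" x lab] reach_rtrancl[of _ E lab x] reach_rtrancl[of x E lab]
  by (auto simp: star_def shortcuts_def is_digraph_converse reach_converse)

lemma trunc_arcs_subset:
  "is_digraph n E \<Longrightarrow> set xs \<subseteq> {..<n} \<Longrightarrow> trunc_arcs E b1 b2 lab q w a xs \<subseteq> shortcuts n E"
proof (induction xs arbitrary: lab q w a)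
  case (Cons x xs)
  then show ?case using star_subset[of n E x lab] by simp
qed simp

lemma all_arcs_subset:
  "is_digraph n E \<Longrightarrow> set xs \<subseteq> {..<n} \<Longrightarrow> all_arcs E b1 b2 t R xs \<subseteq> shortcuts n E"
proof (induction R arbitrary: xs)
  case (Suc R)
  have "set (take t xs) \<subseteq> {..<n}" "set (drop t xs) \<subseteq> {..<n}"
    using Suc.prems(2) set_take_subset[of t xs] set_drop_subset[of t xs] by blast+
  then show ?case using trunc_arcs_subset[OF Suc.prems(1)] Suc.IH[OF Suc.prems(1)]
    by (simp add: rep_arcs_def)
qed simp

text \<open>Shortcuts leave reachability unchanged, so the maximum still runs over the pairs
  connected in \<open>E\<close>.\<close>

lemma digraph_diameter_le:
  assumes n: "n > 0" and S: "S \<subseteq> shortcuts n E"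
    and le: "\<And>u v. u < n \<Longrightarrow> v < n \<Longrightarrow> (u, v) \<in> E\<^sup>* \<Longrightarrow> real (distance (E \<union> S) u v) \<le> y"
  shows "real (digraph_diameter n (E \<union> S)) \<le> y"
proof -
  have eq: "(E \<union> S)\<^sup>* = E\<^sup>*"
  proof
    have "E \<union> S \<subseteq> E\<^sup>*" using S by (auto simp: shortcuts_def)
    then show "(E \<union> S)\<^sup>* \<subseteq> E\<^sup>*" by (metis rtrancl_idemp rtrancl_mono)
  qed (simp add: rtrancl_mono)
  define X where "X = {distance (E \<union> S) u v | u v. u < n \<and> v < n \<and> (u, v) \<in> (E \<union> S)\<^sup>*}"
  have "real x \<le> y" if "x \<in> X" for x using that le by (auto simp: X_def eq)
  moreover have "X \<subseteq> (\<lambda>(u, v). distance (E \<union> S) u v) ` ({..<n} \<times> {..<n})" by (auto simp: X_def)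
  then have "finite X" by (rule finite_subset) auto
  moreover have "X \<noteq> {}" using n by (auto simp: X_def)
  ultimately show ?thesis unfolding digraph_diameter_def X_def[symmetric] using Max_in by blast
qed

section \<open>From iterated sums to probabilities and the union bound\<close>

lemma prob_eq_expectation:
  "measure_pmf.prob M {x. P x} = measure_pmf.expectation M (\<lambda>x. of_bool (P x))"
proof -
  have "(\<lambda>x. of_bool (P x) :: real) = indicator {x. P x}" by (auto simp: indicator_def)
  then show ?thesis by simp
qed

lemma prob_replicate:
  assumes "n > 0"
  shows "measure_pmf.prob (replicate_pmf t (pmf_of_set {..<n})) {xs. P xs} = EL n t (\<lambda>xs. of_bool (P xs))"
  unfolding prob_eq_expectation
proof (induction t arbitrary: P)
  case 0
  show ?case by simp
next
  case (Suc t)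
  let ?U = "pmf_of_set {..<n}"
  have fin: "finite {..<n}" "{..<n} \<noteq> {}" using assms by auto
  have r: "replicate_pmf (Suc t) ?U = bind_pmf ?U (\<lambda>x. map_pmf ((#) x) (replicate_pmf t ?U))"
    by (simp add: map_pmf_def)
  have "finite (set_pmf (replicate_pmf t ?U))"
    using fin by (simp add: set_replicate_pmf finite_lists_length_eq lists_eq_set)
  then have "measure_pmf.expectation (replicate_pmf (Suc t) ?U) (\<lambda>xs. of_bool (P xs)) =
    (\<Sum>x<n. (1 / real n) * measure_pmf.expectation (replicate_pmf t ?U) (\<lambda>xs. of_bool (P (x # xs))))"
    unfolding r using fin by (subst pmf_expectation_bind[of "{..<n}"]) (auto intro!: sum.cong)
  then show ?case by (simp add: Suc.IH flip: sum_divide_distrib)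
qed

lemma EL_of_bool_Ex:
  assumes "finite I"
  shows "EL n t (\<lambda>xs. of_bool (\<exists>i\<in>I. P i xs)) \<le> (\<Sum>i\<in>I. EL n t (\<lambda>xs. of_bool (P i xs)))"
proof -
  have "of_bool (\<exists>i\<in>I. P i xs) \<le> (\<Sum>i\<in>I. of_bool (P i xs) :: real)" for xs
  proof (cases "\<exists>i\<in>I. P i xs")
    case True
    then obtain i where "i \<in> I" "P i xs" by auto
    then show ?thesis using member_le_sum[of i I "\<lambda>i. of_bool (P i xs) :: real"] assms by auto
  qed (auto intro: sum_nonneg)
  then show ?thesis unfolding EL_sum[symmetric] by (intro EL_mono)
qed

text \<open>At most \<open>n * n\<close> pairs fail with probability at most
  \<open>(1/2) ^ (k * L) \<le> (1/n) ^ k\<close> each; this is the origin of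
  \<open>k \<ge> c + 2\<close>.\<close>

theorem all_arcs_diameter:
  assumes E: "is_digraph n E" and n: "n < 2 ^ L" "n > 0" and ne: "E \<noteq> {}" and k: "real k \<ge> c + 2"
  shows "measure_pmf.prob (replicate_pmf (k * L * (n * L)) (pmf_of_set {..<n}))
    {xs. real (digraph_diameter n (E \<union> all_arcs E (48 * card E * L) (48 * n * L) (n * L) (k * L) xs))
      \<le> 20 * real n powr (2/3)} \<ge> 1 - 1 / real n powr c"
proof -
  define S where "S = all_arcs E (48 * card E * L) (48 * n * L) (n * L) (k * L)"
  define N y where "N = k * L * (n * L)" and "y = 20 * real n powr (2/3)"
  define I where "I = {(u, v). u < n \<and> v < n \<and> (u, v) \<in> E\<^sup>*}"
  define bad where "bad xs \<longleftrightarrow> (\<exists>e\<in>I. real (distance (E \<union> S xs) (fst e) (snd e)) \<ge> y)" for xs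
  have I: "I \<subseteq> {..<n} \<times> {..<n}" by (auto simp: I_def)
  then have finI: "finite I" by (rule finite_subset) auto
  have "EL n N (\<lambda>xs. of_bool (bad xs)) \<le>
    (\<Sum>e\<in>I. EL n N (\<lambda>xs. of_bool (real (distance (E \<union> S xs) (fst e) (snd e)) \<ge> y)))"
    unfolding bad_def by (rule EL_of_bool_Ex[OF finI])
  also have "\<dots> \<le> (\<Sum>e\<in>I. (1 / 2) ^ (k * L))"
    using repetitions_fail[OF E n(1) ne] by (intro sum_mono) (auto simp: I_def N_def S_def y_def)
  also have "\<dots> = real (card I) * (1 / 2) ^ (k * L)" by simp
  also have "\<dots> \<le> real (n * n) * (1 / n) ^ k"
  proof (intro mult_mono)
    show "real (card I) \<le> real (n * n)"
      using card_mono[OF _ I] by (intro of_nat_mono) (simp add: card_cartesian_product)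
    have "real n \<le> 2 ^ L" using n(1) by (metis less_imp_le of_nat_le_numeral_power_cancel_iff)
    then have "(1 / 2 :: real) ^ L \<le> 1 / n" using n(2) by (simp add: power_one_over field_simps)
    then have "((1 / 2 :: real) ^ L) ^ k \<le> (1 / n) ^ k" by (intro power_mono) auto
    then show "(1 / 2) ^ (k * L) \<le> (1 / real n) ^ k" by (simp add: mult.commute flip: power_mult)
  qed auto
  also have "\<dots> = real n powr (2 - real k)"
    using n(2) by (simp add: powr_diff powr_realpow power_one_over power2_eq_square)
  also have "\<dots> \<le> real n powr (- c)" using n(2) k by (intro powr_mono) auto
  also have "\<dots> = 1 / real n powr c" by (simp add: powr_minus_divide)
  finally have bad: "EL n N (\<lambda>xs. of_bool (bad xs)) \<le> 1 / real n powr c" .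
  have "1 - EL n N (\<lambda>xs. of_bool (bad xs)) = EL n N (\<lambda>xs. 1 + (-1) * of_bool (bad xs))"
    using n(2) by (simp only: EL_add EL_scale EL_const)
  also have "\<dots> \<le> EL n N (\<lambda>xs. of_bool (real (digraph_diameter n (E \<union> S xs)) \<le> y))"
  proof (rule EL_mono)
    fix xs assume xs: "set xs \<subseteq> {..<n}"
    have sc: "S xs \<subseteq> shortcuts n E" unfolding S_def by (rule all_arcs_subset[OF E xs])
    have "real (digraph_diameter n (E \<union> S xs)) \<le> y" if "\<not> bad xs"
      using that by (intro digraph_diameter_le[OF n(2) sc]) (force simp: bad_def I_def)
    then show "1 + (-1) * of_bool (bad xs) \<le> (of_bool (real (digraph_diameter n (E \<union> S xs)) \<le> y) :: real)"
      by (cases "bad xs") auto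
  qed
  finally have "1 - 1 / real n powr c \<le> EL n N (\<lambda>xs. of_bool (real (digraph_diameter n (E \<union> S xs)) \<le> y))"
    using bad by linarith
  then show ?thesis unfolding prob_replicate[OF n(2)] by (simp only: N_def S_def y_def)
qed

section \<open>Execution of programs\<close>

text \<open>Since \<open>Skip\<close> steps to itself, \<open>t\<close> is an upper bound on the
  time to halt and may be raised (\<open>pexec_mono\<close>).\<close>

definition pexec :: "nat \<Rightarrow> prog \<Rightarrow> state \<Rightarrow> nat \<Rightarrow> state pmf \<Rightarrow> bool" where
  "pexec B p s t \<mu> \<longleftrightarrow> run B t (p, s) = map_pmf (Pair Skip) \<mu>"

definition exec :: "nat \<Rightarrow> prog \<Rightarrow> state \<Rightarrow> nat \<Rightarrow> state \<Rightarrow> bool" where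
  "exec B p s t s' \<longleftrightarrow> pexec B p s t (return_pmf s')"

text \<open>\<open>run\<close> appends steps at the end, whereas rules for program constructs must
  peel off the first step.\<close>

lemma run_Suc_front: "run B (Suc t) c = bind_pmf (step B (fst c) (snd c)) (run B t)"
proof (induction t)
  case 0
  show ?case by (simp add: bind_return_pmf bind_return_pmf' split_beta)
next
  case (Suc t)
  have "run B (Suc (Suc t)) c = bind_pmf (bind_pmf (step B (fst c) (snd c)) (run B t)) (\<lambda>(p, s). step B p s)"
    using Suc.IH by simp
  then show ?case by (simp add: bind_assoc_pmf)
qed

lemma run_Skip: "run B t (Skip, s) = return_pmf (Skip, s)"
  by (induction t) (simp_all add: bind_return_pmf)

lemma run_add: "run B (t + u) c = bind_pmf (run B t c) (run B u)"
  by (induction u) (simp_all add: bind_return_pmf' bind_assoc_pmf)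

lemma pexec_mono:
  assumes "pexec B p s t \<mu>" "t \<le> t'" shows "pexec B p s t' \<mu>"
proof -
  have "run B t' (p, s) = bind_pmf (run B t (p, s)) (run B (t' - t))"
    using run_add[of B t "t' - t" "(p, s)"] assms(2) by simp
  also have "\<dots> = bind_pmf \<mu> (\<lambda>x. return_pmf (Skip, x))"
    using assms(1) by (simp add: pexec_def bind_map_pmf run_Skip)
  also have "\<dots> = map_pmf (Pair Skip) \<mu>" by (simp add: map_pmf_def)
  finally show ?thesis by (simp add: pexec_def)
qed

lemma pexec_Skip: "pexec B Skip s t (return_pmf s)"
  by (simp add: pexec_def run_Skip)

lemma pexec_Skip_unique: "pexec B Skip s t \<mu> \<Longrightarrow> \<mu> = return_pmf s"
proof -
  assume "pexec B Skip s t \<mu>"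
  then have "map_pmf snd (return_pmf (Skip, s)) = map_pmf snd (map_pmf (Pair Skip) \<mu>)"
    by (simp add: pexec_def run_Skip)
  then show ?thesis by (simp add: map_pmf_comp)
qed

lemma pexec_unfold:
  assumes "pexec B p s (Suc t) \<mu>"
  obtains \<nu> where "\<And>c. c \<in> set_pmf (step B p s) \<Longrightarrow> pexec B (fst c) (snd c) t (\<nu> c)"
    "\<mu> = bind_pmf (step B p s) \<nu>"
proof
  let ?\<nu> = "\<lambda>c. map_pmf snd (run B t c)"
  have eq: "bind_pmf (step B p s) (run B t) = map_pmf (Pair Skip) \<mu>"
    using assms unfolding pexec_def run_Suc_front by simp
  then have sk: "fst d = Skip" if "c \<in> set_pmf (step B p s)" "d \<in> set_pmf (run B t c)" for c d
  proof -
    have "d \<in> set_pmf (bind_pmf (step B p s) (run B t))" using that by auto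
    then show ?thesis unfolding eq by auto
  qed
  show "pexec B (fst c) (snd c) t (?\<nu> c)" if "c \<in> set_pmf (step B p s)" for c
  proof -
    have "map_pmf (Pair Skip) (?\<nu> c) = map_pmf (\<lambda>d. d) (run B t c)"
      unfolding map_pmf_comp using sk[OF that] by (intro map_pmf_cong) (auto simp: prod_eq_iff)
    then show ?thesis by (simp add: pexec_def)
  qed
  have "map_pmf snd (bind_pmf (step B p s) (run B t)) = map_pmf snd (map_pmf (Pair Skip) \<mu>)" using eq by simp
  then show "\<mu> = bind_pmf (step B p s) ?\<nu>" by (simp add: map_pmf_comp map_bind_pmf)
qed

lemma pexec_stepI:
  assumes "\<And>c. c \<in> set_pmf (step B p s) \<Longrightarrow> pexec B (fst c) (snd c) t (\<nu> c)"
  shows "pexec B p s (Suc t) (bind_pmf (step B p s) \<nu>)"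
proof -
  have "run B (Suc t) (p, s) = bind_pmf (step B p s) (\<lambda>c. map_pmf (Pair Skip) (\<nu> c))"
    unfolding run_Suc_front using assms by (intro bind_pmf_cong) (auto simp: pexec_def)
  then show ?thesis by (simp add: pexec_def map_bind_pmf)
qed

text \<open>The additional step turns \<open>Seq Skip q\<close> into \<open>q\<close>.\<close>

lemma pexec_Seq:
  assumes "pexec B p s t \<mu>" "\<And>s'. s' \<in> set_pmf \<mu> \<Longrightarrow> pexec B q s' t' (\<nu> s')"
  shows "pexec B (Seq p q) s (t + t' + 1) (bind_pmf \<mu> \<nu>)"
  using assms
proof (induction t arbitrary: p s \<mu>)
  case 0
  then have "return_pmf (p, s) = map_pmf (Pair Skip) \<mu>" by (simp add: pexec_def)
  then have "(p, s) \<in> set_pmf (map_pmf (Pair Skip) \<mu>)" by (metis set_return_pmf singletonI)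
  then have p: "p = Skip" by auto
  then have "\<mu> = return_pmf s" using 0(1) pexec_Skip_unique by blast
  then show ?case using 0(2)[of s] pexec_stepI[of B "Seq p q" s t' "\<lambda>c. \<nu> (snd c)"] p
    by (simp add: bind_return_pmf)
next
  case (Suc t)
  show ?case
  proof (cases "p = Skip")
    case True
    then have \<mu>: "\<mu> = return_pmf s" using Suc.prems(1) pexec_Skip_unique by blast
    then have "pexec B q s (Suc t + t') (\<nu> s)" using Suc.prems(2)[of s] pexec_mono by auto
    then show ?thesis using pexec_stepI[of B "Seq p q" s "Suc t + t'" "\<lambda>c. \<nu> (snd c)"] True \<mu>
      by (simp add: bind_return_pmf)
  next
    case False
    obtain \<kappa> where \<kappa>: "\<And>c. c \<in> set_pmf (step B p s) \<Longrightarrow> pexec B (fst c) (snd c) t (\<kappa> c)"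
      "\<mu> = bind_pmf (step B p s) \<kappa>" using pexec_unfold[OF Suc.prems(1)] by blast
    let ?f = "\<lambda>(p', s'). (Seq p' q, s')"
    have st: "step B (Seq p q) s = map_pmf ?f (step B p s)" using False by simp
    have "pexec B (fst (?f c)) (snd (?f c)) (t + t' + 1) (bind_pmf (\<kappa> c) \<nu>)"
      if "c \<in> set_pmf (step B p s)" for c
      using Suc.IH[OF \<kappa>(1)[OF that]] Suc.prems(2) \<kappa>(2) that by (auto simp: split_beta)
    then have "run B (t + t' + 1) (?f c) = map_pmf (Pair Skip) (bind_pmf (\<kappa> c) \<nu>)"
      if "c \<in> set_pmf (step B p s)" for c using that by (simp add: pexec_def split_beta)
    then have "bind_pmf (step B p s) (\<lambda>c. run B (t + t' + 1) (?f c)) =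
      bind_pmf (step B p s) (\<lambda>c. map_pmf (Pair Skip) (bind_pmf (\<kappa> c) \<nu>))"
      by (intro bind_pmf_cong) auto
    then have "run B (Suc (t + t' + 1)) (Seq p q, s) = map_pmf (Pair Skip) (bind_pmf \<mu> \<nu>)"
      unfolding run_Suc_front fst_conv snd_conv st bind_map_pmf \<kappa>(2) bind_assoc_pmf map_bind_pmf by simp
    then show ?thesis by (simp add: pexec_def)
  qed
qed

text \<open>One step unfolds the loop and one drops the finished body, hence
  \<open>+ 2\<close>.\<close>

lemma pexec_While_step:
  assumes "regs s r \<noteq> 0" "pexec B p s t \<mu>" "\<And>s'. s' \<in> set_pmf \<mu> \<Longrightarrow> pexec B (WhileNZ r p) s' t' (\<nu> s')"
  shows "pexec B (WhileNZ r p) s (t + t' + 2) (bind_pmf \<mu> \<nu>)"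
  using pexec_stepI[of B "WhileNZ r p" s "t + t' + 1" "\<lambda>_. bind_pmf \<mu> \<nu>"] pexec_Seq[OF assms(2,3)] assms(1)
  by (simp add: bind_return_pmf)

lemma exec_Skip: "exec B Skip s t s"
  by (simp add: exec_def pexec_Skip)

lemma exec_mono: "exec B p s t s' \<Longrightarrow> t \<le> t' \<Longrightarrow> exec B p s t' s'"
  by (auto simp: exec_def intro: pexec_mono)

lemma exec_Seq: "exec B p s t s1 \<Longrightarrow> exec B q s1 t' s2 \<Longrightarrow> exec B (Seq p q) s (t + t' + 1) s2"
  using pexec_Seq[of B p s t "return_pmf s1" q t' "\<lambda>_. return_pmf s2"]
  by (simp add: exec_def bind_return_pmf)

lemma exec_If: "exec B (if regs s r \<noteq> 0 then p else q) s t s' \<Longrightarrow> exec B (IfNZ r p q) s (t + 1) s'"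
  using pexec_stepI[of B "IfNZ r p q" s t "\<lambda>_. return_pmf s'"]
  by (simp add: exec_def bind_return_pmf split: if_splits)

lemma exec_While_stop: "regs s r = 0 \<Longrightarrow> exec B (WhileNZ r p) s (Suc t) s"
  using pexec_stepI[of B "WhileNZ r p" s t "\<lambda>_. return_pmf s"] pexec_Skip[of B s t]
  by (simp add: exec_def bind_return_pmf)

lemma exec_While_step:
  "regs s r \<noteq> 0 \<Longrightarrow> exec B p s t s1 \<Longrightarrow> exec B (WhileNZ r p) s1 t' s2 \<Longrightarrow> exec B (WhileNZ r p) s (t + t' + 2) s2"
  using pexec_While_step[of s r B p t "return_pmf s1" t' "\<lambda>_. return_pmf s2"]
  by (simp add: exec_def bind_return_pmf)

text \<open>The ghost value \<open>g\<close> carries data that the state does not show. The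
  potential \<open>\<tau>\<close> pays for the body and the loop control, so iterations of different
  lengths are amortized.\<close>

lemma exec_While:
  assumes body: "\<And>g s. I g s \<Longrightarrow> regs s r \<noteq> 0 \<Longrightarrow>
      \<exists>t s' g'. exec B p s t s' \<and> I g' s' \<and> \<tau> g' + t + 2 \<le> \<tau> g"
    and init: "I g s"
  shows "\<exists>s' g'. exec B (WhileNZ r p) s (\<tau> g + 1) s' \<and> I g' s' \<and> regs s' r = 0"
  using init
proof (induction "\<tau> g" arbitrary: g s rule: less_induct)
  case less
  show ?case
  proof (cases "regs s r = 0")
    case True
    then show ?thesis using less.prems exec_While_stop[of s r B p "\<tau> g"] by auto
  next
    case False
    obtain t s1 g1 where 1: "exec B p s t s1" "I g1 s1" "\<tau> g1 + t + 2 \<le> \<tau> g"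
      using body[OF less.prems False] by blast
    obtain s2 g2 where 2: "exec B (WhileNZ r p) s1 (\<tau> g1 + 1) s2" "I g2 s2" "regs s2 r = 0"
      using less.hyps[of g1 s1] 1 by auto
    have "exec B (WhileNZ r p) s (\<tau> g + 1) s2"
      using exec_mono[OF exec_While_step[OF False 1(1) 2(1)]] 1(3) by simp
    then show ?thesis using 2 by auto
  qed
qed

section \<open>Symbolic execution of loop-free programs\<close>

primrec loopfree :: "prog \<Rightarrow> bool" where
  "loopfree Skip \<longleftrightarrow> True"
| "loopfree (Const r x) \<longleftrightarrow> True"
| "loopfree (Op f r r1 r2) \<longleftrightarrow> True"
| "loopfree (Load r a) \<longleftrightarrow> True"
| "loopfree (Store a r) \<longleftrightarrow> True"
| "loopfree (Rand r r1) \<longleftrightarrow> False"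
| "loopfree (Seq p q) \<longleftrightarrow> loopfree p \<and> loopfree q"
| "loopfree (IfNZ r p q) \<longleftrightarrow> loopfree p \<and> loopfree q"
| "loopfree (WhileNZ r p) \<longleftrightarrow> False"

primrec duration :: "prog \<Rightarrow> nat" where
  "duration Skip = 0"
| "duration (Const r x) = 1"
| "duration (Op f r r1 r2) = 1"
| "duration (Load r a) = 1"
| "duration (Store a r) = 1"
| "duration (Rand r r1) = 1"
| "duration (Seq p q) = duration p + duration q + 1"
| "duration (IfNZ r p q) = max (duration p) (duration q) + 1"
| "duration (WhileNZ r p) = 1"

text \<open>Turns straight-line blocks into rewriting. The clauses for \<open>Rand\<close> and
  \<open>WhileNZ\<close> are default values, excluded by \<open>loopfree\<close>.\<close>

primrec ev :: "nat \<Rightarrow> prog \<Rightarrow> state \<Rightarrow> state" where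
  "ev B Skip s = s"
| "ev B (Const r x) s = set_reg r (x mod B) s"
| "ev B (Op f r r1 r2) s = set_reg r (eval_binop f (regs s r1) (regs s r2) mod B) s"
| "ev B (Load r a) s = set_reg r (mem s (regs s a)) s"
| "ev B (Store a r) s = s\<lparr>mem := (mem s)(regs s a := regs s r)\<rparr>"
| "ev B (Rand r r1) s = s"
| "ev B (Seq p q) s = ev B q (ev B p s)"
| "ev B (IfNZ r p q) s = (if regs s r \<noteq> 0 then ev B p s else ev B q s)"
| "ev B (WhileNZ r p) s = s"

lemma exec_step1: "step B p s = return_pmf (Skip, s') \<Longrightarrow> exec B p s 1 s'"
  by (simp add: exec_def pexec_def bind_return_pmf)

lemma exec_ev: "loopfree p \<Longrightarrow> exec B p s (duration p) (ev B p s)"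
proof (induction p arbitrary: s)
  case (Seq p q)
  then show ?case using exec_Seq[of B p s "duration p" "ev B p s" q] by simp
next
  case (IfNZ r p q)
  have "exec B (if regs s r \<noteq> 0 then p else q) s (max (duration p) (duration q)) (ev B (IfNZ r p q) s)"
    using IfNZ exec_mono[of B p s "duration p"] exec_mono[of B q s "duration q"] by simp
  then show ?case using exec_If by (metis duration.simps(8))
qed (auto simp: exec_Skip intro: exec_step1[unfolded One_nat_def])

fun seq :: "prog list \<Rightarrow> prog" where
  "seq [] = Skip"
| "seq [p] = p"
| "seq (p # q # ps) = Seq p (seq (q # ps))"

section \<open>Graph search\<close>

text \<open>
  Registers: 0, 1, 2 input \<open>n\<close>, \<open>m\<close>, \<open>k\<close>; 3, 4, 46 the constants 1, 2, 0; 5 bit length \<open>L\<close> of \<open>n\<close>; 6, 7, 8 draws per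
  repetition, remaining repetitions, number of all draws; 9 to 12 bases of the adjacency lists; 13 next draw;
  14, 18 end and start of the output; 15 start of the unused memory; 16, 17 budgets; 19 base of the labels;
  20 next fresh label; 21, 22 arcs scanned and shortcuts recorded in this repetition; 23 remaining draws;
  24, 25 pivot and its label.  A search uses 26, 27, 28 for the adjacency lists, 29 for the base of the marks
  and 30 for the base of the queue, whose ends are 31 and 32.

  Every search works in zero cells that were never written before, so marks need not be cleared.
\<close>

definition relax :: prog where
  "relax = seq [Op Add 21 21 3, Op Mul 36 4 34, Op Sub 36 36 28, Load 35 36,
     Op Add 36 19 35, Load 36 36, Op Equal 36 36 25,
     Op Add 38 29 35, Load 39 38, Op Equal 39 39 46, Op Mul 36 36 39,
     IfNZ 36 (seq [Store 38 3, Op Add 36 30 32, Store 36 35, Op Add 32 32 3]) Skip,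
     Op Add 36 27 34, Load 34 36]"

definition advance :: prog where
  "advance = seq [Op Add 36 30 31, Load 33 36, Op Add 31 31 3, Op Add 36 26 33, Load 34 36]"

definition search_init :: prog where
  "search_init = seq [Op Add 36 29 24, Store 36 3, Store 30 24, Const 31 0, Const 32 1, Const 37 1]"

definition search :: prog where
  "search = seq [search_init, WhileNZ 37 (seq [advance, WhileNZ 34 relax, Op Sub 37 32 31])]"

text \<open>Linked list of arc numbers, starting at \<open>e\<close>, with the links in the cells \<open>X + a\<close>.  Arcs are numbered from 1,
  since 0 ends the list: arc \<open>e\<close> has its tail in cell \<open>2 * e - 2\<close> and its head in cell \<open>2 * e - 1\<close>.\<close>

primrec chain :: "(nat \<Rightarrow> nat) \<Rightarrow> nat \<Rightarrow> nat \<Rightarrow> nat list \<Rightarrow> bool" where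
  "chain M X e [] \<longleftrightarrow> e = 0"
| "chain M X e (a # as) \<longleftrightarrow> e = a \<and> a \<noteq> 0 \<and> chain M X (M (X + a)) as"

text \<open>One search serves both directions: \<open>off\<close> is 1 for out-lists, whose targets
  are the heads in cells \<open>2 * e - 1\<close>, and 2 for in-lists, whose targets are the tails
  in cells \<open>2 * e - 2\<close>. Cells below \<open>F\<close> are frozen with contents
  \<open>M\<close>; marks and queue lie above.\<close>

locale search_ctx =
  fixes B n H X off LB MK Q F x :: nat and adj :: "nat \<Rightarrow> nat list" and M :: "nat \<Rightarrow> nat"
    and tgt :: "nat \<Rightarrow> nat" and lab :: "nat \<Rightarrow> nat" and E :: "(nat \<times> nat) set"
  assumes chain: "\<And>u. u < n \<Longrightarrow> chain M X (M (H + u)) (adj u)"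
    and H: "H + n \<le> F"
    and adj: "\<And>u e. u < n \<Longrightarrow> e \<in> set (adj u) \<Longrightarrow>
       X + e < F \<and> 2 * e < F + off \<and> 2 * e < B \<and> M (2 * e - off) = tgt e \<and> tgt e < n"
    and E: "E = {(u, v). u < n \<and> (\<exists>e\<in>set (adj u). v = tgt e)}"
    and lab: "\<And>v. v < n \<Longrightarrow> M (LB + v) = lab v" and LB: "LB + n \<le> F"
    and MK: "F \<le> MK" "MK + n < B" and Q: "F \<le> Q" "Q + n < B"
    and disj: "MK + n \<le> Q \<or> Q + n \<le> MK"
    and x: "x < n" "lab x \<noteq> 1"
begin

abbreviation "c \<equiv> lab x"
abbreviation "R \<equiv> reach E lab x"

lemma digraph: "is_digraph n E"
  using adj by (auto simp: E is_digraph_def)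

lemma R: "R \<subseteq> {..<n}" "finite R"
  using reach_bounded[OF digraph x(1), of lab] by (auto intro: finite_subset)

definition ready :: "state \<Rightarrow> bool" where
  "ready s \<longleftrightarrow> regs s 3 = 1 \<and> regs s 4 = 2 \<and> regs s 46 = 0 \<and> regs s 26 = H \<and> regs s 27 = X \<and>
     regs s 28 = off \<and> regs s 29 = MK \<and> regs s 30 = Q \<and> regs s 19 = LB \<and> regs s 25 = c \<and> regs s 24 = x \<and>
     (\<forall>a<F. mem s a = M a)"

text \<open>The list \<open>vs\<close> is the whole history of the queue, including expanded
  vertices, so its members are exactly the marked vertices.\<close>

definition found :: "state \<Rightarrow> nat list \<Rightarrow> state \<Rightarrow> bool" where
  "found s0 vs s \<longleftrightarrow> distinct vs \<and> set vs \<subseteq> R \<and> (\<forall>j<length vs. mem s (Q + j) = vs ! j) \<and>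
     (\<forall>v<n. mem s (MK + v) = of_bool (v \<in> set vs)) \<and>
     (\<forall>a. a \<notin> {MK..<MK + n} \<union> {Q..<Q + n} \<longrightarrow> mem s a = mem s0 a) \<and>
     (\<forall>r. r \<notin> {21, 31, 32, 33, 34, 35, 36, 37, 38, 39} \<longrightarrow> regs s r = regs s0 r) \<and>
     regs s 32 = length vs"

lemma found_ready: "ready s0 \<Longrightarrow> found s0 vs s \<Longrightarrow> ready s"
  using MK Q by (auto simp: ready_def found_def)

lemma found_length: "found s0 vs s \<Longrightarrow> length vs \<le> n"
  using R distinct_card[of vs] card_mono[of "{..<n}" "set vs"] by (auto simp: found_def)

lemma relax:
  assumes s0: "ready s0" and f: "found s0 vs s" and u: "u < n" "u \<in> R" and e: "e \<in> set (adj u)"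
    and r: "regs s 34 = e" and w: "Suc (regs s 21) < B"
  defines "s' \<equiv> ev B relax s"
  shows "\<exists>ext. found s0 (vs @ ext) s' \<and> (lab (tgt e) = c \<longrightarrow> tgt e \<in> set (vs @ ext)) \<and>
    regs s' 34 = M (X + e) \<and> regs s' 31 = regs s 31 \<and> regs s' 21 = Suc (regs s 21)"
proof -
  have rs: "ready s" using found_ready s0 f by blast
  note a = adj[OF u(1) e]
  have F: "F < B" "1 < B" using MK x w by linarith+
  have r32: "regs s 32 = length vs" using f by (simp add: found_def)
  let ?v = "tgt e"
  have regsS: "regs s 3 = 1" "regs s 4 = 2" "regs s 46 = 0" "regs s 27 = X" "regs s 28 = off"
    "regs s 29 = MK" "regs s 30 = Q" "regs s 19 = LB" "regs s 25 = c" "regs s 34 = e"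
    using rs r by (auto simp: ready_def)
  have mv: "mem s (2 * e - off) = ?v" "mem s (LB + ?v) = lab ?v" "mem s (X + e) = M (X + e)"
    using rs a lab LB by (auto simp: ready_def)
  have mk: "mem s (MK + ?v) = of_bool (?v \<in> set vs)" using f a by (auto simp: found_def)
  have m1: "(2 * e) mod B = 2 * e" "(2 * e - off) mod B = 2 * e - off" "(LB + ?v) mod B = LB + ?v"
    "(MK + ?v) mod B = MK + ?v" "(X + e) mod B = X + e" "Suc (regs s 21) mod B = Suc (regs s 21)"
    "of_bool b mod B = of_bool b" "B \<noteq> Suc 0" for b
    using a LB MK F w by (auto simp: of_bool_def)
  show ?thesis
  proof (cases "lab ?v = c \<and> ?v \<notin> set vs")
    case True
    have "?v \<in> R" using True a u e by (intro reach_step[OF u(2)]) (auto simp: E)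
    then have "set (vs @ [?v]) \<subseteq> R" using f by (auto simp: found_def)
    \<comment> \<open>Queue entries are distinct vertices, so the queue never outgrows its
      \<open>n\<close> cells.\<close>
    then have "card (set (vs @ [?v])) \<le> n" using R card_mono[of "{..<n}" "set (vs @ [?v])"] by auto
    then have len: "length vs < n" using True f by (auto simp: found_def distinct_card)
    then have m2: "(Q + length vs) mod B = Q + length vs" "Suc (length vs) mod B = Suc (length vs)"
      using Q by auto
    have ne: "MK + ?v \<noteq> Q + length vs" using disj a len by auto
    have mX: "X + e \<noteq> MK + ?v" "X + e \<noteq> Q + length vs" using a MK Q by auto
    have S: "mem s' = (mem s)(MK + ?v := 1, Q + length vs := ?v)"
      "regs s' 21 = Suc (regs s 21)" "regs s' 31 = regs s 31" "regs s' 32 = Suc (length vs)" "regs s' 34 = M (X + e)"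
      "\<And>r. r \<notin> {21, 31, 32, 33, 34, 35, 36, 37, 38, 39} \<Longrightarrow> regs s' r = regs s r"
      using True ne mX by (simp_all add: s'_def relax_def set_reg_def regsS mv mk m1 m2 r32)
    have "found s0 (vs @ [?v]) s'"
      unfolding found_def
    proof (intro conjI allI impI)
      show "distinct (vs @ [?v])" "set (vs @ [?v]) \<subseteq> R"
        using f True \<open>?v \<in> R\<close> by (auto simp: found_def)
      show "mem s' (Q + j) = (vs @ [?v]) ! j" if "j < length (vs @ [?v])" for j
        using f that disj a len by (auto simp: S(1) found_def nth_append)
      show "mem s' (MK + v) = of_bool (v \<in> set (vs @ [?v]))" if "v < n" for v
        using f that disj a len by (auto simp: S(1) found_def)
      show "mem s' b = mem s0 b" if "b \<notin> {MK..<MK + n} \<union> {Q..<Q + n}" for b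
        using f that a len by (auto simp: S(1) found_def)
      show "regs s' r = regs s0 r" if "r \<notin> {21, 31, 32, 33, 34, 35, 36, 37, 38, 39}" for r
        using f S(6)[OF that] that by (simp add: found_def)
      show "regs s' 32 = length (vs @ [?v])" by (simp add: S(4))
    qed
    then show ?thesis by (intro exI[of _ "[?v]"]) (simp add: S)
  next
    case False
    have S: "mem s' = mem s"
      "regs s' 21 = Suc (regs s 21)" "regs s' 31 = regs s 31" "regs s' 32 = regs s 32" "regs s' 34 = M (X + e)"
      "\<And>r. r \<notin> {21, 31, 32, 33, 34, 35, 36, 37, 38, 39} \<Longrightarrow> regs s' r = regs s r"
      using False by (cases "?v \<in> set vs"; simp add: s'_def relax_def set_reg_def regsS mv mk m1)+
    have "found s0 (vs @ []) s'" using f S(6) by (simp add: found_def S(1,4))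
    then show ?thesis using False by (intro exI[of _ "[]"]) (simp add: S)
  qed
qed

lemma scan:
  assumes s0: "ready s0" and u: "u < n" "u \<in> R"
  shows "found s0 vs s \<Longrightarrow> chain M X (regs s 34) es \<Longrightarrow> set es \<subseteq> set (adj u) \<Longrightarrow>
    regs s 21 + length es < B \<Longrightarrow>
    \<exists>s' ext. exec B (WhileNZ 34 relax) s (45 * length es + 1) s' \<and> found s0 (vs @ ext) s' \<and>
      (\<forall>e\<in>set es. lab (tgt e) = c \<longrightarrow> tgt e \<in> set (vs @ ext)) \<and>
      regs s' 31 = regs s 31 \<and> regs s' 21 = regs s 21 + length es"
proof (induction es arbitrary: s vs)
  case Nil
  then show ?case using exec_While_stop[of s 34 B relax 0] by (intro exI[of _ s] exI[of _ "[]"]) simp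
next
  case (Cons e es)
  let ?s = "ev B relax s"
  have e: "e \<in> set (adj u)" "regs s 34 = e" "e \<noteq> 0" using Cons.prems by auto
  obtain ext where 1: "found s0 (vs @ ext) ?s" "lab (tgt e) = c \<longrightarrow> tgt e \<in> set (vs @ ext)"
    "regs ?s 34 = M (X + e)" "regs ?s 31 = regs s 31" "regs ?s 21 = Suc (regs s 21)"
    using relax[OF s0 Cons.prems(1) u e(1,2)] Cons.prems(4) by auto
  obtain s' ext' where 2: "exec B (WhileNZ 34 relax) ?s (45 * length es + 1) s'" "found s0 ((vs @ ext) @ ext') s'"
    "\<forall>e\<in>set es. lab (tgt e) = c \<longrightarrow> tgt e \<in> set ((vs @ ext) @ ext')"
    "regs s' 31 = regs ?s 31" "regs s' 21 = regs ?s 21 + length es"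
    using Cons.IH[OF 1(1)] Cons.prems 1 by auto
  have "exec B relax s (duration relax) ?s" by (rule exec_ev) (simp add: relax_def)
  then have "exec B (WhileNZ 34 relax) s (duration relax + (45 * length es + 1) + 2) s'"
    using exec_While_step[OF _ _ 2(1)] e by simp
  then have "exec B (WhileNZ 34 relax) s (45 * length (e # es) + 1) s'"
    by (rule exec_mono) (simp add: relax_def)
  then show ?case using 1 2 by (intro exI[of _ s'] exI[of _ "ext @ ext'"]) auto
qed

definition closed_at :: "nat list \<Rightarrow> nat \<Rightarrow> bool" where
  "closed_at vs u \<longleftrightarrow> (\<forall>e\<in>set (adj u). lab (tgt e) = c \<longrightarrow> tgt e \<in> set vs)"

text \<open>The index \<open>i\<close> is the read end of the queue; the first \<open>i\<close>
  entries have been expanded completely.\<close>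

definition progress :: "state \<Rightarrow> nat list \<times> nat \<Rightarrow> state \<Rightarrow> bool" where
  "progress s0 = (\<lambda>(vs, i) s. found s0 vs s \<and> x \<in> set vs \<and> i \<le> length vs \<and> regs s 31 = i \<and>
     regs s 37 = length vs - i \<and> (\<forall>u\<in>set (take i vs). closed_at vs u) \<and>
     regs s 21 = regs s0 21 + (\<Sum>u\<in>set (take i vs). length (adj u)))"

text \<open>Prepaid time for the vertices of \<open>R\<close> not yet expanded: 50 for the handling
  of a vertex and 45 for each of its arcs.\<close>

definition potential :: "nat list \<times> nat \<Rightarrow> nat" where
  "potential = (\<lambda>(vs, i). \<Sum>u\<in>R - set (take i vs). 50 + 45 * length (adj u))"

lemma search_step:
  assumes s0: "ready s0" and w: "regs s0 21 + (\<Sum>u\<in>R. length (adj u)) < B"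
    and p: "progress s0 g s" and nz: "regs s 37 \<noteq> 0"
  shows "\<exists>t s' g'. exec B (seq [advance, WhileNZ 34 relax, Op Sub 37 32 31]) s t s' \<and>
    progress s0 g' s' \<and> potential g' + t + 2 \<le> potential g"
proof -
  obtain vs i where g: "g = (vs, i)" by (cases g)
  have f: "found s0 vs s" and i: "i < length vs" and r31: "regs s 31 = i" and xs: "x \<in> set vs"
    and cl: "\<forall>u\<in>set (take i vs). closed_at vs u"
    and w1: "regs s 21 = regs s0 21 + (\<Sum>u\<in>set (take i vs). length (adj u))"
    using p nz by (auto simp: progress_def g)
  define u where "u = vs ! i"
  have uR: "u \<in> R" using f i by (auto simp: u_def found_def)
  have u: "u < n" using uR R by auto
  have dv: "distinct vs" "set vs \<subseteq> R" using f by (auto simp: found_def)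
  have un: "u \<notin> set (take i vs)" using dv(1) i by (auto simp: u_def in_set_conv_nth distinct_conv_nth)
  have tk: "set (take (Suc i) vs) = insert u (set (take i vs))" using i by (simp add: take_Suc_conv_app_nth u_def)
  have tkR: "set (take i vs) \<subseteq> R" using dv(2) set_take_subset[of i vs] by blast
  let ?s1 = "ev B advance s"
  have rs: "ready s" using found_ready s0 f by blast
  have len: "length vs \<le> n" using found_length f by blast
  have mods: "(Q + i) mod B = Q + i" "Suc i mod B = Suc i" "(H + u) mod B = H + u"
    using Q MK H i len u by auto
  have mq: "mem s (Q + i) = u" using f i by (simp add: found_def u_def)
  have mH: "mem s (H + u) = M (H + u)" using rs u H by (simp add: ready_def)
  have S: "mem ?s1 = mem s" "regs ?s1 = (regs s)(36 := H + u, 33 := u, 31 := Suc i, 34 := M (H + u))"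
    using rs by (auto simp: advance_def set_reg_def ready_def mods mq mH r31 fun_eq_iff)
  have f1: "found s0 vs ?s1" using f by (auto simp: found_def S)
  have "(\<Sum>v\<in>insert u (set (take i vs)). length (adj v)) \<le> (\<Sum>v\<in>R. length (adj v))"
    using R(2) uR tkR by (intro sum_mono2) auto
  then have w2: "(\<Sum>v\<in>set (take i vs). length (adj v)) + length (adj u) \<le> (\<Sum>v\<in>R. length (adj v))"
    using un by simp
  have "regs ?s1 21 + length (adj u) < B" using w w1 w2 by (simp add: S)
  then obtain s2 ext where 2: "exec B (WhileNZ 34 relax) ?s1 (45 * length (adj u) + 1) s2" "found s0 (vs @ ext) s2"
      "\<forall>e\<in>set (adj u). lab (tgt e) = c \<longrightarrow> tgt e \<in> set (vs @ ext)"
      "regs s2 31 = regs ?s1 31" "regs s2 21 = regs ?s1 21 + length (adj u)"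
    using scan[OF s0 u uR f1, of "adj u"] chain[OF u] by (auto simp: S)
  define s3 where "s3 = ev B (Op Sub 37 32 31) s2"
  have l2: "length (vs @ ext) \<le> n" using found_length 2(2) by blast
  then have "(length (vs @ ext) - Suc i) mod B = length (vs @ ext) - Suc i" using Q by auto
  moreover have "regs s2 32 = length (vs @ ext)" using 2(2) by (simp add: found_def)
  ultimately have S3: "mem s3 = mem s2" "regs s3 = (regs s2)(37 := length (vs @ ext) - Suc i)"
    using 2(4) by (auto simp: set_reg_def S s3_def)
  have f3: "found s0 (vs @ ext) s3" using 2(2) by (auto simp: found_def S3)
  have "progress s0 (vs @ ext, Suc i) s3"
    unfolding progress_def prod.case
  proof (intro conjI)
    show "\<forall>v\<in>set (take (Suc i) (vs @ ext)). closed_at (vs @ ext) v"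
      using cl 2(3) i tk by (auto simp: closed_at_def)
    show "regs s3 21 = regs s0 21 + (\<Sum>u\<in>set (take (Suc i) (vs @ ext)). length (adj u))"
      using i tk un by (simp add: S3 2(5) S w1)
  qed (use f3 xs i 2(4) in \<open>auto simp: S3 S\<close>)
  moreover have "potential (vs @ ext, Suc i) + 50 + 45 * length (adj u) = potential g"
  proof -
    have "R - set (take i vs) = insert u (R - set (take (Suc i) (vs @ ext)))"
      using tk i uR un by auto
    moreover have "u \<notin> R - set (take (Suc i) (vs @ ext))" using tk i by auto
    ultimately show ?thesis using R(2) by (simp add: potential_def g)
  qed
  moreover have "exec B (seq [advance, WhileNZ 34 relax, Op Sub 37 32 31]) s
     (duration advance + ((45 * length (adj u) + 1) + 1 + 1) + 1) s3"
  proof -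
    have a: "exec B advance s (duration advance) ?s1" by (rule exec_ev) (simp add: advance_def)
    have b: "exec B (Op Sub 37 32 31) s2 1 s3" using exec_ev[of "Op Sub 37 32 31" B s2] by (simp add: s3_def)
    show ?thesis using exec_Seq[OF a exec_Seq[OF 2(1) b]] by simp
  qed
  ultimately show ?thesis
    by (intro exI[of _ "duration advance + ((45 * length (adj u) + 1) + 1 + 1) + 1"] exI[of _ s3]
        exI[of _ "(vs @ ext, Suc i)"]) (simp add: advance_def)
qed

lemma search:
  assumes s0: "ready s0" and w: "regs s0 21 + (\<Sum>u\<in>R. length (adj u)) < B"
    and mk: "\<forall>v<n. mem s0 (MK + v) = 0"
  shows "\<exists>s' vs. exec B search s0 (20 + (\<Sum>u\<in>R. 50 + 45 * length (adj u))) s' \<and> found s0 vs s' \<and> set vs = R \<and>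
    regs s' 21 = regs s0 21 + (\<Sum>u\<in>R. length (adj u))"
proof -
  let ?s = "ev B search_init s0"
  have mods: "(MK + x) mod B = MK + x" "1 mod B = 1" "0 mod B = 0" "B \<noteq> Suc 0" using MK x by auto
  have ne: "MK + x \<noteq> Q" using disj x by auto
  have S: "mem ?s = (mem s0)(MK + x := 1, Q := x)"
     "regs ?s = (regs s0)(36 := MK + x, 31 := 0, 32 := 1, 37 := 1)"
    using s0 by (auto simp: search_init_def set_reg_def ready_def mods fun_eq_iff)
  have xR: "x \<in> R" using x by (simp add: reach_refl)
  have "found s0 [x] ?s"
    unfolding found_def using ne mk x disj xR by (auto simp: S)
  then have "progress s0 ([x], 0) ?s" by (simp add: progress_def S)
  then obtain s' g where 1: "exec B (WhileNZ 37 (seq [advance, WhileNZ 34 relax, Op Sub 37 32 31])) ?s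
      (potential ([x], 0) + 1) s'" "progress s0 g s'" "regs s' 37 = 0"
    using exec_While[of "progress s0" 37 B "seq [advance, WhileNZ 34 relax, Op Sub 37 32 31]" potential,
        OF search_step[OF s0 w]] by blast
  obtain vs i where g: "g = (vs, i)" by (cases g)
  have f: "found s0 vs s'" "x \<in> set vs" "i = length vs" "\<forall>u\<in>set vs. closed_at vs u"
    "regs s' 21 = regs s0 21 + (\<Sum>u\<in>set vs. length (adj u))"
    using 1(2,3) by (auto simp: progress_def g)
  \<comment> \<open>The read end has met the write end, so every found vertex is expanded and the
    found set is closed under the arcs of the class.\<close>
  have "v \<in> set vs" if "v \<in> R" for v
  proof -
    have "(x, v) \<in> (class_rel E lab c)\<^sup>*" using that by (simp add: reach_def)
    then show ?thesis
    proof (induction rule: rtrancl_induct)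
      case (step y z)
      then show ?case using f(4) by (auto simp: class_rel_def E closed_at_def)
    qed (rule f(2))
  qed
  then have vs: "set vs = R" using f(1) by (auto simp: found_def)
  have "exec B search s0 (duration search_init + (potential ([x], 0) + 1) + 1) s'"
    unfolding search_def using exec_Seq[OF exec_ev 1(1)] by (simp add: search_init_def)
  then have "exec B search s0 (20 + (\<Sum>u\<in>R. 50 + 45 * length (adj u))) s'"
    by (rule exec_mono) (simp add: search_init_def potential_def)
  then show ?thesis using f vs by auto
qed

end

section \<open>The main loop\<close>

text \<open>The format of \<open>output_arcs\<close>. The count \<open>c\<close> may exceed the size
  of the set, as arcs can be recorded repeatedly.\<close>

definition arc_set :: "(nat \<Rightarrow> nat) \<Rightarrow> nat \<Rightarrow> nat \<Rightarrow> (nat \<times> nat) set" where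
  "arc_set M a c = (\<lambda>i. (M (a + 2 * i), M (a + 2 * i + 1))) ` {..<c}"

lemma arc_set_0: "arc_set M a 0 = {}"
  by (simp add: arc_set_def)

lemma arc_set_add: "arc_set M a (c + d) = arc_set M a c \<union> arc_set M (a + 2 * c) d"
proof -
  have "i \<in> {..<c} \<union> (\<lambda>i. c + i) ` {..<d}" if "i < c + d" for i
    using that by (cases "i < c") (auto simp: image_iff intro!: bexI[of _ "i - c"])
  then have "{..<c + d} = {..<c} \<union> (\<lambda>i. c + i) ` {..<d}" by auto
  then show ?thesis by (simp add: arc_set_def image_Un image_image algebra_simps)
qed

lemma arc_set_cong:
  assumes "\<And>b. a \<le> b \<Longrightarrow> b < a + 2 * c \<Longrightarrow> M b = M' b"
  shows "arc_set M a c = arc_set M' a c"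
  unfolding arc_set_def by (intro image_cong) (auto intro!: assms)

lemma card_arc_set: "card (arc_set M a c) \<le> c"
  unfolding arc_set_def using card_image_le[of "{..<c}"] by (metis card_lessThan finite_lessThan)

text \<open>Registers 44 and 45 hold the offsets of the pivot and the other end within an arc, so
  one body writes both orientations. The new label depends on the marks of the opposite search (base
  in register 42): 1 if the vertex was found there too, else the fresh label in register 43.\<close>

definition record_body :: prog where
  "record_body = seq [Op Sub 31 31 3, Op Add 36 30 31, Load 35 36, Op Add 36 14 44, Store 36 24,
     Op Add 36 14 45, Store 36 35, Op Add 14 14 4, Op Add 36 42 35, Load 36 36,
     IfNZ 36 (Const 37 1) (Op Add 37 43 46), Op Add 36 19 35, Store 36 37]"

definition record_arcs :: prog where
  "record_arcs = WhileNZ 31 record_body"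

definition orient :: "bool \<Rightarrow> nat \<Rightarrow> nat \<Rightarrow> nat \<times> nat" where
  "orient fw x v = (if fw then (x, v) else (v, x))"

definition recorded ::
    "nat \<Rightarrow> nat list \<Rightarrow> nat set \<Rightarrow> nat \<Rightarrow> bool \<Rightarrow> nat \<Rightarrow> nat \<Rightarrow> nat \<Rightarrow> state \<Rightarrow> state \<Rightarrow> bool" where
  "recorded n vs S OP fw x nl LB s s' \<longleftrightarrow> regs s' 14 = OP + 2 * length vs \<and>
    (\<forall>r. r \<notin> {14, 31, 35, 36, 37} \<longrightarrow> regs s' r = regs s r) \<and>
    (\<forall>v<n. mem s' (LB + v) = (if v \<in> set vs then if v \<in> S then 1 else nl else mem s (LB + v))) \<and>
    arc_set (mem s') OP (length vs) = orient fw x ` set vs \<and>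
    (\<forall>a. a \<notin> {LB..<LB + n} \<union> {OP..<OP + 2 * length vs} \<longrightarrow> mem s' a = mem s a)"

text \<open>Register 31 counts down and the queue is consumed from its end, hence the reverse
  induction.\<close>

lemma record_arcs:
  assumes "distinct vs" "set vs \<subseteq> {..<n}" "\<forall>j<length vs. mem s (Q + j) = vs ! j"
    "\<forall>v<n. mem s (OM + v) = of_bool (v \<in> S)"
    "regs s 3 = 1" "regs s 4 = 2" "regs s 46 = 0" "regs s 30 = Q" "regs s 14 = OP" "regs s 24 = x"
    "regs s 44 = of_bool (\<not> fw)" "regs s 45 = of_bool fw" "regs s 42 = OM" "regs s 43 = nl" "regs s 19 = LB"
    "regs s 31 = length vs" "OP + 2 * length vs \<le> LB" "LB + n \<le> Q" "LB + n \<le> OM"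
    "Q + n < B" "OM + n < B" "nl < B"
  shows "\<exists>s'. exec B record_arcs s (30 * length vs + 1) s' \<and> recorded n vs S OP fw x nl LB s s'"
  using assms
proof (induction vs arbitrary: s OP rule: rev_induct)
  case Nil
  then show ?case using exec_While_stop[of s 31 B record_body 0]
    by (intro exI[of _ s]) (simp add: record_arcs_def arc_set_0 recorded_def)
next
  case (snoc v vs)
  define s1 where "s1 = ev B record_body s"
  have v: "v < n" "v \<notin> set vs" and dv: "distinct vs" "set vs \<subseteq> {..<n}" using snoc.prems by auto
  have "card (set (vs @ [v])) \<le> card {..<n}" using snoc.prems(2) by (intro card_mono) auto
  then have len: "length vs < n" using snoc.prems(1) by (simp add: distinct_card)
  have b: "OP + 2 * length vs + 2 \<le> LB" "LB + n \<le> Q" "LB + n \<le> OM" "Q + n < B" "OM + n < B" "nl < B"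
    using snoc.prems by auto
  have q: "mem s (Q + length vs) = v"
    using snoc.prems(3) by (metis length_append_singleton lessI nth_append_length)
  have o: "mem s (OM + v) = of_bool (v \<in> S)" using snoc.prems v by auto
  have mods: "length vs mod B = length vs" "(Q + length vs) mod B = Q + length vs" "OP mod B = OP"
    "Suc OP mod B = Suc OP" "Suc (Suc OP) mod B = Suc (Suc OP)" "(OM + v) mod B = OM + v" "nl mod B = nl" "B \<noteq> Suc 0"
    "(LB + v) mod B = LB + v"
    using b len v by auto
  have ne: "OM + v \<noteq> OP" "OM + v \<noteq> Suc OP" using b by auto
  note rg = snoc.prems(5-16)
  have S1: "mem s1 = (mem s)(OP + of_bool (\<not> fw) := x, OP + of_bool fw := v, LB + v := (if v \<in> S then 1 else nl))"
    "regs s1 14 = OP + 2" "regs s1 31 = length vs"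
    "\<And>r. r \<notin> {14, 31, 35, 36, 37} \<Longrightarrow> regs s1 r = regs s r"
    using rg ne by (cases fw; cases "v \<in> S"; simp add: s1_def record_body_def set_reg_def mods q o)+
  have "\<exists>s'. exec B record_arcs s1 (30 * length vs + 1) s' \<and> recorded n vs S (OP + 2) fw x nl LB s1 s'"
  proof (rule snoc.IH)
    show "\<forall>j<length vs. mem s1 (Q + j) = vs ! j"
    proof (intro allI impI)
      fix j assume j: "j < length vs"
      have "mem s1 (Q + j) = mem s (Q + j)" using b v by (auto simp: S1(1))
      also have "\<dots> = vs ! j" using j snoc.prems(3) by (metis butlast_snoc length_append_singleton less_SucI nth_butlast length_butlast diff_Suc_1)
      finally show "mem s1 (Q + j) = vs ! j" .
    qed
    show "\<forall>v<n. mem s1 (OM + v) = of_bool (v \<in> S)" using b v snoc.prems(4) by (auto simp: S1(1))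
  qed (use rg dv b in \<open>simp_all add: S1\<close>)
  then obtain s' where s': "exec B record_arcs s1 (30 * length vs + 1) s'" "regs s' 14 = OP + 2 + 2 * length vs"
    "\<forall>r. r \<notin> {14, 31, 35, 36, 37} \<longrightarrow> regs s' r = regs s1 r"
    "\<forall>v<n. mem s' (LB + v) = (if v \<in> set vs then if v \<in> S then 1 else nl else mem s1 (LB + v))"
    "arc_set (mem s') (OP + 2) (length vs) = orient fw x ` set vs"
    "\<forall>a. a \<notin> {LB..<LB + n} \<union> {OP + 2..<OP + 2 + 2 * length vs} \<longrightarrow> mem s' a = mem s1 a"
    unfolding recorded_def by blast
  have "exec B record_body s (duration record_body) s1" unfolding s1_def by (rule exec_ev) (simp add: record_body_def)
  then have "exec B record_arcs s (duration record_body + (30 * length vs + 1) + 2) s'"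
    unfolding record_arcs_def by (rule exec_While_step[rotated]) (use s'(1) rg(12) in \<open>simp_all add: record_arcs_def\<close>)
  then have ex: "exec B record_arcs s (30 * length (vs @ [v]) + 1) s'"
    by (rule exec_mono) (simp add: record_body_def)
  have "arc_set (mem s') OP 1 = {orient fw x v}"
  proof -
    have "mem s' OP = mem s1 OP" "mem s' (Suc OP) = mem s1 (Suc OP)" using s'(6) b by auto
    then show ?thesis using b by (cases fw) (auto simp: arc_set_def S1(1) orient_def)
  qed
  then have arcs: "arc_set (mem s') OP (length (vs @ [v])) = orient fw x ` set (vs @ [v])"
    using arc_set_add[of "mem s'" OP 1 "length vs"] s'(5) by simp
  have lab: "mem s' (LB + u) = (if u \<in> set (vs @ [v]) then if u \<in> S then 1 else nl else mem s (LB + u))" if "u < n" for u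
    using s'(4) that b v by (auto simp: S1(1))
  have fr: "mem s' a = mem s a" if "a \<notin> {LB..<LB + n} \<union> {OP..<OP + 2 * length (vs @ [v])}" for a
    using s'(6) that v by (auto simp: S1(1))
  have rf: "regs s' r = regs s r" if "r \<notin> {14, 31, 35, 36, 37}" for r
    using s'(3) that S1(4) by simp
  show ?case using ex s'(2) rf lab arcs fr unfolding recorded_def by (intro exI[of _ s'] conjI allI impI) auto
qed

text \<open>Comparison with the zero register negates and products act as conjunctions: register 36
  ends up as 1 iff the drawn vertex is alive and neither budget is spent.\<close>

definition pick :: prog where
  "pick = seq [Load 24 13, Op Add 13 13 3, Op Add 36 19 24, Load 25 36, Op Equal 36 25 3, Op Equal 36 36 46,
     Op Less 37 21 16, Op Mul 36 36 37, Op Less 37 22 17, Op Mul 36 36 37]"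

text \<open>An executed draw claims \<open>4 * n\<close> untouched cells: \<open>n\<close> each for
  forward marks, backward marks, forward queue and backward queue.\<close>

definition set_forward :: prog where
  "set_forward = seq [Op Add 47 15 0, Op Add 48 47 0, Op Add 49 48 0, Op Add 26 9 46, Op Add 27 11 46, Const 28 1,
     Op Add 29 15 46, Op Add 30 48 46]"

definition set_backward :: prog where
  "set_backward = seq [Op Add 40 32 46, Op Add 26 10 46, Op Add 27 12 46, Const 28 2, Op Add 29 47 46, Op Add 30 49 46]"

definition set_record_forward :: prog where
  "set_record_forward = seq [Op Add 41 32 46, Op Add 30 48 46, Op Add 31 40 46, Op Add 42 47 46, Op Add 43 20 46,
     Const 44 0, Const 45 1]"

definition set_record_backward :: prog where
  "set_record_backward = seq [Op Add 30 49 46, Op Add 31 41 46, Op Add 42 15 46, Op Add 43 20 3, Const 44 1, Const 45 0]"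

definition conclude :: prog where
  "conclude = seq [Op Add 22 22 40, Op Add 22 22 41, Op Add 15 49 0]"

definition process :: prog where
  "process = seq [set_forward, search, set_backward, search, set_record_forward, record_arcs,
     set_record_backward, record_arcs, conclude]"

definition draw :: prog where
  "draw = seq [pick, IfNZ 36 process Skip, Op Add 20 20 4, Op Sub 23 23 3]"

text \<open>Memory layout: arcs (\<open>2 * m\<close> cells), heads of the out- and in-lists (from \<open>HF\<close> and \<open>HB\<close>), their links (\<open>XF\<close>, \<open>XB\<close>),
  all random draws (\<open>DR\<close>), output (\<open>OUT\<close>), and from \<open>FR0\<close> on the labels of a repetition followed by marks and
  queues for each of its draws.\<close>

locale machine =
  fixes n m k L B :: nat and E :: "(nat \<times> nat) set" and adjF adjB :: "nat \<Rightarrow> nat list"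
    and M0 :: "nat \<Rightarrow> nat" and xs :: "nat list"
  fixes T N DR OUT FR0 b1 b2 HF HB XF XB :: nat
  defines "T \<equiv> n * L" and "N \<equiv> k * L * (n * L)" and "HF \<equiv> 2 * m" and "HB \<equiv> 2 * m + n" and "XF \<equiv> 2 * m + 2 * n"
    and "XB \<equiv> 3 * m + 2 * n + 1" and "DR \<equiv> 4 * m + 2 * n + 2" and "OUT \<equiv> 4 * m + 2 * n + 2 + N"
    and "FR0 \<equiv> 4 * m + 2 * n + 2 + N + 100 * N"
    and "b1 \<equiv> 48 * m * L" and "b2 \<equiv> 48 * n * L"
  assumes E: "is_digraph n E" and n: "n > 0" and L: "L > 0" and m: "card E = m"
    and chainF: "\<And>u. u < n \<Longrightarrow> chain M0 XF (M0 (HF + u)) (adjF u)"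
    and chainB: "\<And>u. u < n \<Longrightarrow> chain M0 XB (M0 (HB + u)) (adjB u)"
    and adjF: "\<And>u e. u < n \<Longrightarrow> e \<in> set (adjF u) \<Longrightarrow> 0 < e \<and> e \<le> m"
    and adjB: "\<And>u e. u < n \<Longrightarrow> e \<in> set (adjB u) \<Longrightarrow> 0 < e \<and> e \<le> m"
    and EF: "E = {(u, v). u < n \<and> (\<exists>e\<in>set (adjF u). v = M0 (2 * e - 1))}"
    and EB: "E\<inverse> = {(u, v). u < n \<and> (\<exists>e\<in>set (adjB u). v = M0 (2 * e - 2))}"
    and degF: "\<And>u. u < n \<Longrightarrow> length (adjF u) = outdeg E u"
    and degB: "\<And>u. u < n \<Longrightarrow> length (adjB u) = outdeg (E\<inverse>) u"
    and xs: "length xs = N" "set xs \<subseteq> {..<n}" "\<And>i. i < N \<Longrightarrow> M0 (DR + i) = xs ! i"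
    and B: "FR0 + 6 * n * N + 48 * m * L + 48 * n * L + 4 * m + 4 * n + 2 * n * L + 10 < B"
begin

definition static :: "state \<Rightarrow> bool" where
  "static s \<longleftrightarrow> regs s 0 = n \<and> regs s 3 = 1 \<and> regs s 4 = 2 \<and> regs s 46 = 0 \<and> regs s 6 = T \<and>
     regs s 9 = HF \<and> regs s 10 = HB \<and> regs s 11 = XF \<and> regs s 12 = XB \<and> regs s 16 = b1 \<and> regs s 17 = b2 \<and>
     regs s 18 = OUT \<and> (\<forall>a<OUT. mem s a = M0 a)"

text \<open>The values \<open>lab\<close>, \<open>q\<close>, \<open>w\<close>, \<open>a\<close> are
  the current arguments of \<open>trunc_arcs\<close>. All arcs output so far, also by earlier
  repetitions, form \<open>S\<close>, and \<open>c\<close> counts them with multiplicity. Cells from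
  \<open>FR\<close> on are still zero, labels start at \<open>LB\<close>, and \<open>i\<close> draws
  are consumed.\<close>

definition state_ok :: "(nat \<Rightarrow> nat) \<Rightarrow> nat \<Rightarrow> nat \<Rightarrow> nat \<Rightarrow> (nat \<times> nat) set \<Rightarrow> nat \<Rightarrow> nat \<Rightarrow> nat \<Rightarrow> nat \<Rightarrow> state \<Rightarrow> bool" where
  "state_ok lab q w a S c FR LB i s \<longleftrightarrow> static s \<and> regs s 19 = LB \<and> regs s 20 = q \<and> regs s 21 = w \<and> regs s 22 = a \<and>
     regs s 15 = FR \<and> regs s 13 = DR + i \<and> regs s 14 = OUT + 2 * c \<and> (\<forall>v<n. mem s (LB + v) = lab v) \<and>
     (\<forall>b\<ge>FR. mem s b = 0) \<and> arc_set (mem s) OUT c = S \<and> FR0 \<le> LB \<and> LB + n \<le> FR"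

lemma search_forward:
  assumes st: "static s" and lab: "\<forall>v<n. mem s (LB + v) = lab v" and LB: "FR0 \<le> LB" "LB + n \<le> FR"
    and x: "x < n" "lab x \<noteq> 1" and FR: "FR + 4 * n < B"
  shows "search_ctx B n HF XF 1 LB FR (FR + 2 * n) FR x adjF (mem s) (\<lambda>e. M0 (2 * e - 1)) lab E"
proof
  have ms: "mem s a = M0 a" if "a < OUT" for a using st that by (simp add: static_def)
  have ch: "chain (mem s) XF e es" if "chain M0 XF e es" "\<forall>e\<in>set es. XF + e < OUT" for e es
    using that by (induction es arbitrary: e) (auto simp: ms)
  show "chain (mem s) XF (mem s (HF + u)) (adjF u)" if "u < n" for u
    using ch[OF chainF[OF that]] adjF[OF that] that ms[of "HF + u"] by (force simp: OUT_def HF_def XF_def)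
  show "XF + e < FR \<and> 2 * e < FR + 1 \<and> 2 * e < B \<and> mem s (2 * e - 1) = M0 (2 * e - 1) \<and> M0 (2 * e - 1) < n"
    if "u < n" "e \<in> set (adjF u)" for u e
  proof -
    have "(u, M0 (2 * e - 1)) \<in> E" using that unfolding EF by auto
    then have "M0 (2 * e - 1) < n" using E by (auto simp: is_digraph_def)
    then show ?thesis using adjF[OF that] LB FR ms[of "2 * e - 1"] by (auto simp: OUT_def XF_def FR0_def)
  qed
  show "HF + n \<le> FR" using LB by (simp add: HF_def FR0_def)
qed (use EF lab LB x FR in auto)

lemma search_backward:
  assumes st: "static s" and lab: "\<forall>v<n. mem s (LB + v) = lab v" and LB: "FR0 \<le> LB" "LB + n \<le> FR"
    and x: "x < n" "lab x \<noteq> 1" and FR: "FR + 4 * n < B"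
  shows "search_ctx B n HB XB 2 LB (FR + n) (FR + 3 * n) FR x adjB (mem s) (\<lambda>e. M0 (2 * e - 2)) lab (E\<inverse>)"
proof
  have ms: "mem s a = M0 a" if "a < OUT" for a using st that by (simp add: static_def)
  have ch: "chain (mem s) XB e es" if "chain M0 XB e es" "\<forall>e\<in>set es. XB + e < OUT" for e es
    using that by (induction es arbitrary: e) (auto simp: ms)
  show "chain (mem s) XB (mem s (HB + u)) (adjB u)" if "u < n" for u
    using ch[OF chainB[OF that]] adjB[OF that] that ms[of "HB + u"] by (force simp: OUT_def HB_def XB_def)
  show "XB + e < FR \<and> 2 * e < FR + 2 \<and> 2 * e < B \<and> mem s (2 * e - 2) = M0 (2 * e - 2) \<and> M0 (2 * e - 2) < n"
    if "u < n" "e \<in> set (adjB u)" for u e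
  proof -
    have "(u, M0 (2 * e - 2)) \<in> E\<inverse>" using that unfolding EB by auto
    then have "M0 (2 * e - 2) < n" using E by (auto simp: is_digraph_def)
    then show ?thesis using adjB[OF that] LB FR ms[of "2 * e - 2"] by (auto simp: OUT_def XB_def FR0_def)
  qed
  show "HB + n \<le> FR" using LB by (simp add: HB_def FR0_def)
qed (use EB lab LB x FR in auto)

end

lemma orient_image: "orient True x ` A = {x} \<times> A" "orient False x ` A = A \<times> {x}"
  by (auto simp: orient_def)

context machine
begin

lemma degree_sum:
  "(\<Sum>u\<in>reach E lab x. length (adjF u)) = sum (outdeg E) (reach E lab x)"
  "(\<Sum>u\<in>reach (E\<inverse>) lab x. length (adjB u)) = sum (outdeg (E\<inverse>)) (reach (E\<inverse>) lab x)"
  "sum (outdeg E) (reach E lab x) \<le> m" "sum (outdeg (E\<inverse>)) (reach (E\<inverse>) lab x) \<le> m"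
  "card (reach E lab x) \<le> n" "card (reach (E\<inverse>) lab x) \<le> n"
  if x: "x < n"
proof -
  have Ec: "is_digraph n (E\<inverse>)" using E by (simp add: is_digraph_converse)
  have sub: "reach E lab x \<subseteq> {..<n}" "reach (E\<inverse>) lab x \<subseteq> {..<n}"
    using reach_bounded[OF E x] reach_bounded[OF Ec x] by auto
  show "(\<Sum>u\<in>reach E lab x. length (adjF u)) = sum (outdeg E) (reach E lab x)"
    "(\<Sum>u\<in>reach (E\<inverse>) lab x. length (adjB u)) = sum (outdeg (E\<inverse>)) (reach (E\<inverse>) lab x)"
    using sub degF degB by (auto intro!: sum.cong)
  show "sum (outdeg E) (reach E lab x) \<le> m"
    using sum_mono2[OF _ sub(1), of "outdeg E"] sum_outdeg[OF E] m by simp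
  show "sum (outdeg (E\<inverse>)) (reach (E\<inverse>) lab x) \<le> m"
    using sum_mono2[OF _ sub(2), of "outdeg (E\<inverse>)"] sum_outdeg[OF Ec] m by (simp add: card_inverse)
  show "card (reach E lab x) \<le> n" "card (reach (E\<inverse>) lab x) \<le> n"
    using card_mono[OF _ sub(1)] card_mono[OF _ sub(2)] by simp_all
qed

text \<open>Both recording passes read marks and not labels, so they agree on vertices found by both
  searches and together perform \<open>relabel\<close> with the labels \<open>q\<close> and
  \<open>q + 1\<close>.\<close>

lemma process:
  assumes st: "state_ok lab q w a S c FR LB i s" and x: "regs s 24 = x" "x < n" "lab x \<noteq> 1" "regs s 25 = lab x"
    and FR: "FR + 4 * n < B" and OUT: "OUT + 2 * (c + 2 * n) \<le> FR0"
    and wa: "w + 2 * m < B" "a + 2 * n < B" "q + 2 < B"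
  defines "dw \<equiv> sum (outdeg E) (reach E lab x) + sum (outdeg (E\<inverse>)) (reach (E\<inverse>) lab x)"
    and "da \<equiv> card (reach E lab x) + card (reach (E\<inverse>) lab x)"
  shows "\<exists>s'. exec B process s (200 + 100 * (dw + da)) s' \<and>
    state_ok (relabel E lab q (q + 1) x) q (w + dw) (a + da) (S \<union> star E lab x) (c + da) (FR + 4 * n) LB i s' \<and>
    regs s' 7 = regs s 7 \<and> regs s' 23 = regs s 23"
proof -
  let ?F = "reach E lab x" and ?R = "reach (E\<inverse>) lab x"
  have stat: "static s" and lab: "\<forall>v<n. mem s (LB + v) = lab v" and zero: "\<forall>b\<ge>FR. mem s b = 0"
    and arcs: "arc_set (mem s) OUT c = S" and LB: "FR0 \<le> LB" "LB + n \<le> FR"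
    and rs: "regs s 19 = LB" "regs s 20 = q" "regs s 21 = w" "regs s 22 = a" "regs s 15 = FR" "regs s 13 = DR + i"
      "regs s 14 = OUT + 2 * c"
    using st by (auto simp: state_ok_def)
  have rstat: "regs s 0 = n" "regs s 3 = 1" "regs s 4 = 2" "regs s 46 = 0" "regs s 9 = HF" "regs s 10 = HB"
     "regs s 11 = XF" "regs s 12 = XB" using stat by (auto simp: static_def)
  have OF: "OUT \<le> FR0" "HF < FR0" "HB < FR0" "XF < FR0" "XB < FR0"
    by (auto simp: OUT_def FR0_def HF_def HB_def XF_def XB_def)
  note deg = degree_sum[OF x(2), of lab]
  define s1 where "s1 = ev B set_forward s"
  have B1: "B \<noteq> Suc 0" "2 mod B = 2" using FR n by auto
  have mods: "HF mod B = HF" "XF mod B = XF" "HB mod B = HB" "XB mod B = XB" "FR mod B = FR"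
    "(FR + n) mod B = FR + n" "(FR + n + n) mod B = FR + n + n" "(FR + n + n + n) mod B = FR + n + n + n"
    "q mod B = q" "Suc q mod B = Suc q" "(FR + 2 * n) mod B = FR + 2 * n" "(FR + 3 * n) mod B = FR + 3 * n"
    using OF LB FR wa by auto
  have S1: "mem s1 = mem s" "regs s1 47 = FR + n" "regs s1 48 = FR + 2 * n" "regs s1 49 = FR + 3 * n"
    "regs s1 26 = HF" "regs s1 27 = XF" "regs s1 28 = 1" "regs s1 29 = FR" "regs s1 30 = FR + 2 * n"
    "\<And>r. r \<notin> {47, 48, 49, 26, 27, 28, 29, 30} \<Longrightarrow> regs s1 r = regs s r"
    using rs rstat by (simp_all add: s1_def set_forward_def set_reg_def mods B1)
  have e1: "exec B set_forward s 20 s1"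
    unfolding s1_def by (rule exec_mono[OF exec_ev]) (simp_all add: set_forward_def)
  interpret f: search_ctx B n HF XF 1 LB FR "FR + 2 * n" FR x adjF "mem s" "\<lambda>e. M0 (2 * e - 1)" lab E
    using search_forward[OF stat lab LB x(2,3) FR] .
  have "f.ready s1" unfolding f.ready_def using x rs rstat by (simp add: S1)
  moreover have "regs s1 21 + (\<Sum>u\<in>?F. length (adjF u)) < B" using wa deg rs by (simp add: S1)
  moreover have "\<forall>v<n. mem s1 (FR + v) = 0" using zero by (simp add: S1)
  ultimately obtain s2 vs where e2: "exec B search s1 (20 + (\<Sum>u\<in>?F. 50 + 45 * length (adjF u))) s2"
    and f2: "f.found s1 vs s2" and vs: "set vs = ?F" and w2: "regs s2 21 = w + sum (outdeg E) ?F"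
    using f.search[of s1] rs deg by (auto simp: S1)
  have dvs: "distinct vs" and lvs: "length vs = card ?F" and q2: "\<forall>j<length vs. mem s2 (FR + 2 * n + j) = vs ! j"
    and m2: "\<forall>v<n. mem s2 (FR + v) = of_bool (v \<in> ?F)"
    and fr2: "\<And>a. a \<notin> {FR..<FR + n} \<union> {FR + 2 * n..<FR + 2 * n + n} \<Longrightarrow> mem s2 a = mem s a"
    and r2: "\<And>r. r \<notin> {21, 31, 32, 33, 34, 35, 36, 37, 38, 39} \<Longrightarrow> regs s2 r = regs s1 r" and l2: "regs s2 32 = card ?F"
    using f2 vs distinct_card[of vs] unfolding f.found_def by (auto simp: S1(1))
  define s3 where "s3 = ev B set_backward s2"
  have cF: "card ?F mod B = card ?F" "card ?R mod B = card ?R" using deg FR by auto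
  have S3: "mem s3 = mem s2" "regs s3 40 = card ?F" "regs s3 26 = HB" "regs s3 27 = XB" "regs s3 28 = 2"
     "regs s3 29 = FR + n" "regs s3 30 = FR + 3 * n"
    "\<And>r. r \<notin> {40, 26, 27, 28, 29, 30} \<Longrightarrow> regs s3 r = regs s2 r"
    using rs rstat mods by (simp_all add: s3_def set_backward_def set_reg_def B1 r2 S1 l2 cF)
  have e3: "exec B set_backward s2 20 s3"
    unfolding s3_def by (rule exec_mono[OF exec_ev]) (simp_all add: set_backward_def)
  have stat3: "static s3" using stat LB OF by (auto simp: static_def S3 r2 S1 fr2)
  have lab3: "\<forall>v<n. mem s3 (LB + v) = lab v" using lab LB by (auto simp: S3 fr2)
  interpret b: search_ctx B n HB XB 2 LB "FR + n" "FR + 3 * n" FR x adjB "mem s3" "\<lambda>e. M0 (2 * e - 2)" lab "E\<inverse>"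
    using search_backward[OF stat3 lab3 LB x(2,3) FR] .
  have "b.ready s3" unfolding b.ready_def using x rs rstat by (simp add: S1 S3 r2)
  moreover have "regs s3 21 + (\<Sum>u\<in>?R. length (adjB u)) < B" using wa deg w2 by (simp add: S3)
  moreover have "\<forall>v<n. mem s3 (FR + n + v) = 0" using zero by (simp add: S3 fr2)
  ultimately obtain s4 us where e4: "exec B search s3 (20 + (\<Sum>u\<in>?R. 50 + 45 * length (adjB u))) s4"
    and f4: "b.found s3 us s4" and us: "set us = ?R" and w4: "regs s4 21 = w + dw"
    using b.search[of s3] w2 deg by (auto simp: S3 dw_def)
  have dus: "distinct us" and lus: "length us = card ?R" and q4: "\<forall>j<length us. mem s4 (FR + 3 * n + j) = us ! j"
    and m4: "\<forall>v<n. mem s4 (FR + n + v) = of_bool (v \<in> ?R)"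
    and fr4: "\<And>a. a \<notin> {FR + n..<FR + n + n} \<union> {FR + 3 * n..<FR + 3 * n + n} \<Longrightarrow> mem s4 a = mem s2 a"
    and r4: "\<And>r. r \<notin> {21, 31, 32, 33, 34, 35, 36, 37, 38, 39} \<Longrightarrow> regs s4 r = regs s3 r" and l4: "regs s4 32 = card ?R"
    using f4 us distinct_card[of us] unfolding b.found_def by (auto simp: S3(1))
  define s5 where "s5 = ev B set_record_forward s4"
  have S5: "mem s5 = mem s4" "regs s5 41 = card ?R" "regs s5 30 = FR + 2 * n" "regs s5 31 = card ?F"
     "regs s5 42 = FR + n" "regs s5 43 = q" "regs s5 44 = 0" "regs s5 45 = 1"
    "\<And>r. r \<notin> {41, 30, 31, 42, 43, 44, 45} \<Longrightarrow> regs s5 r = regs s4 r"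
    using rs rstat mods by (simp_all add: s5_def set_record_forward_def set_reg_def B1 r2 r4 S1 S3 l4 cF)
  have e5: "exec B set_record_forward s4 20 s5"
    unfolding s5_def by (rule exec_mono[OF exec_ev]) (simp_all add: set_record_forward_def)
  have lens: "length vs \<le> n" "length us \<le> n" using lvs lus deg by auto
  have subn: "set vs \<subseteq> {..<n}" "set us \<subseteq> {..<n}" using f.R b.R vs us by auto
  have "\<exists>s'. exec B record_arcs s5 (30 * length vs + 1) s' \<and> recorded n vs ?R (OUT + 2 * c) True x q LB s5 s'"
  proof (rule record_arcs[OF dvs subn(1), where Q = "FR + 2 * n" and OM = "FR + n"])
    show "\<forall>j<length vs. mem s5 (FR + 2 * n + j) = vs ! j" using q2 lens by (auto simp: S5 fr4)
    show "\<forall>v<n. mem s5 (FR + n + v) = of_bool (v \<in> ?R)" using m4 by (simp add: S5)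
  qed (use rs rstat x OUT LB FR wa lens lvs in \<open>simp_all add: S5 S3 S1 r2 r4\<close>)
  then obtain s6 where e6: "exec B record_arcs s5 (30 * length vs + 1) s6" and op6: "regs s6 14 = OUT + 2 * c + 2 * length vs"
    and r6: "\<And>r. r \<notin> {14, 31, 35, 36, 37} \<Longrightarrow> regs s6 r = regs s5 r"
    and lab6: "\<forall>v<n. mem s6 (LB + v) = (if v \<in> ?F then if v \<in> ?R then 1 else q else mem s5 (LB + v))"
    and arc6: "arc_set (mem s6) (OUT + 2 * c) (card ?F) = {x} \<times> ?F"
    and fr6: "\<And>a. a \<notin> {LB..<LB + n} \<union> {OUT + 2 * c..<OUT + 2 * c + 2 * card ?F} \<Longrightarrow> mem s6 a = mem s4 a"
    unfolding recorded_def by (auto simp: vs lvs S5(1) orient_image)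
  define s7 where "s7 = ev B set_record_backward s6"
  have S7: "mem s7 = mem s6" "regs s7 30 = FR + 3 * n" "regs s7 31 = card ?R"
     "regs s7 42 = FR" "regs s7 43 = q + 1" "regs s7 44 = 1" "regs s7 45 = 0"
    "\<And>r. r \<notin> {30, 31, 42, 43, 44, 45} \<Longrightarrow> regs s7 r = regs s6 r"
    using rs rstat mods by (simp_all add: s7_def set_record_backward_def set_reg_def B1 r2 r4 r6 S1 S3 S5 cF)
  have e7: "exec B set_record_backward s6 20 s7"
    unfolding s7_def by (rule exec_mono[OF exec_ev]) (simp_all add: set_record_backward_def)
  have "\<exists>s'. exec B record_arcs s7 (30 * length us + 1) s' \<and>
    recorded n us ?F (OUT + 2 * c + 2 * length vs) False x (q + 1) LB s7 s'"
  proof (rule record_arcs[OF dus subn(2), where Q = "FR + 3 * n" and OM = FR])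
    have "mem s7 (FR + 3 * n + j) = mem s4 (FR + 3 * n + j)" for j
      using LB OUT lens lvs by (simp add: S7 fr6)
    then show "\<forall>j<length us. mem s7 (FR + 3 * n + j) = us ! j" using q4 by simp
    have "mem s7 (FR + v) = mem s2 (FR + v)" if "v < n" for v
      using LB OUT lens lvs that by (simp add: S7 fr6 fr4)
    then show "\<forall>v<n. mem s7 (FR + v) = of_bool (v \<in> ?F)" using m2 by simp
  qed (use rs rstat x OUT LB FR wa lens lvs lus op6 in \<open>simp_all add: S7 S5 S3 S1 r2 r4 r6\<close>)
  then obtain s8 where e8: "exec B record_arcs s7 (30 * length us + 1) s8"
    and op8: "regs s8 14 = OUT + 2 * c + 2 * length vs + 2 * length us"
    and r8: "\<And>r. r \<notin> {14, 31, 35, 36, 37} \<Longrightarrow> regs s8 r = regs s7 r"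
    and lab8: "\<forall>v<n. mem s8 (LB + v) = (if v \<in> ?R then if v \<in> ?F then 1 else q + 1 else mem s6 (LB + v))"
    and arc8: "arc_set (mem s8) (OUT + 2 * c + 2 * card ?F) (card ?R) = ?R \<times> {x}"
    and fr8: "\<And>a. a \<notin> {LB..<LB + n} \<union> {OUT + 2 * c + 2 * card ?F..<OUT + 2 * c + 2 * card ?F + 2 * card ?R} \<Longrightarrow> mem s8 a = mem s6 a"
    unfolding recorded_def by (auto simp: us lvs lus S7(1) orient_image)
  define s9 where "s9 = ev B conclude s8"
  have am: "(a + card ?F) mod B = a + card ?F" "(a + card ?F + card ?R) mod B = a + card ?F + card ?R"
     "(FR + 3 * n + n) mod B = FR + 4 * n" "(4 * n + FR) mod B = FR + 4 * n"
    using wa deg FR by (auto simp: algebra_simps)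
  have r8s: "regs s8 r = regs s r" if "r \<notin> {14, 21, 26, 27, 28, 29, 30, 31, 32, 33, 34, 35, 36, 37, 38, 39, 40, 41, 42, 43, 44, 45, 47, 48, 49}" for r
    using that by (simp add: S7 S5 S3 S1 r2 r4 r6 r8)
  have r8t: "regs s8 40 = card ?F" "regs s8 41 = card ?R" "regs s8 49 = FR + 3 * n" "regs s8 21 = w + dw"
    by (simp_all add: S7 S5 S3 S1 r2 r4 r6 r8 w4)
  have S9: "mem s9 = mem s8" "regs s9 22 = a + da" "regs s9 15 = FR + 4 * n"
     "\<And>r. r \<notin> {22, 15} \<Longrightarrow> regs s9 r = regs s8 r"
    using rs rstat by (simp_all add: s9_def conclude_def set_reg_def am r8s r8t da_def)
  have e9: "exec B conclude s8 20 s9"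
    unfolding s9_def by (rule exec_mono[OF exec_ev]) (simp_all add: conclude_def)
  have stat9: "static s9"
  proof -
    have "mem s9 b = M0 b" if "b < OUT" for b
      using that stat OF LB by (simp add: S9 fr8 fr6 fr4 fr2 static_def)
    then show ?thesis using stat by (simp add: static_def S9 r8s)
  qed
  have lab9: "mem s9 (LB + v) = relabel E lab q (q + 1) x v" if "v < n" for v
  proof -
    have "mem s5 (LB + v) = lab v" using that lab3 LB by (simp add: S5 S3 fr4)
    then show ?thesis using that lab6 lab8 by (auto simp: S9 relabel_def)
  qed
  have zero9: "mem s9 b = 0" if "b \<ge> FR + 4 * n" for b
    using that LB OUT deg zero by (simp add: S9 fr8 fr6 fr4 fr2)
  have arcs9: "arc_set (mem s9) OUT (c + da) = S \<union> star E lab x"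
  proof -
    have a: "arc_set (mem s9) OUT c = S"
      unfolding arcs[symmetric] using LB OUT OF deg by (intro arc_set_cong) (simp add: S9 fr8 fr6 fr4 fr2)
    have b: "arc_set (mem s9) (OUT + 2 * c) (card ?F) = {x} \<times> ?F"
      unfolding arc6[symmetric] using LB OUT OF deg by (intro arc_set_cong) (simp add: S9 fr8)
    have "arc_set (mem s9) OUT (c + da) = arc_set (mem s9) OUT c \<union> (arc_set (mem s9) (OUT + 2 * c) (card ?F) \<union>
        arc_set (mem s9) (OUT + 2 * c + 2 * card ?F) (card ?R))"
      by (simp only: da_def arc_set_add)
    then show ?thesis unfolding a b using arc8 by (simp add: S9(1) star_def)
  qed
  have ok: "state_ok (relabel E lab q (q + 1) x) q (w + dw) (a + da) (S \<union> star E lab x) (c + da) (FR + 4 * n) LB i s9"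
    unfolding state_ok_def
    using stat9 lab9 zero9 arcs9 LB rs r8t op8 lvs lus by (simp add: S9 r8s da_def)
  have sF: "(\<Sum>u\<in>?F. 50 + 45 * length (adjF u)) = 50 * card ?F + 45 * sum (outdeg E) ?F"
    "(\<Sum>u\<in>?R. 50 + 45 * length (adjB u)) = 50 * card ?R + 45 * sum (outdeg (E\<inverse>)) ?R"
    using deg(1,2) by (simp_all add: sum.distrib flip: sum_distrib_left)
  have "exec B process s (20 + ((20 + (\<Sum>u\<in>?F. 50 + 45 * length (adjF u))) + (20 + ((20 + (\<Sum>u\<in>?R. 50 + 45 * length (adjB u)))
     + (20 + ((30 * length vs + 1) + (20 + ((30 * length us + 1) + 20 + 1) + 1) + 1) + 1) + 1) + 1) + 1) + 1) s9"
    unfolding process_def seq.simps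
    by (intro exec_Seq[OF e1] exec_Seq[OF e2] exec_Seq[OF e3] exec_Seq[OF e4] exec_Seq[OF e5] exec_Seq[OF e6] exec_Seq[OF e7] exec_Seq[OF e8] e9)
  then have "exec B process s (200 + 100 * (dw + da)) s9"
    by (rule exec_mono) (simp add: sF dw_def da_def lvs lus)
  then show ?thesis using ok by (intro exI[of _ s9]) (simp add: S9 r8s)
qed

end

definition rep_init :: prog where
  "rep_init = seq [Op Add 19 15 46, Op Add 15 15 0, Const 20 2, Const 21 0, Const 22 0, Op Add 23 6 46]"

definition repetition :: prog where
  "repetition = seq [rep_init, WhileNZ 23 draw, Op Sub 7 7 3]"

definition main :: prog where
  "main = seq [WhileNZ 7 repetition, Op Sub 0 14 18, Op Div 0 0 4, Op Add 1 18 46]"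

context machine
begin

text \<open>A discarded pivot is skipped by the program but processed by \<open>trunc_arcs\<close>,
  with an empty star and unchanged labels, so the outcome is the same. A skipped draw still consumes
  two labels, in step with \<open>trunc_arcs\<close>. The budgets are exceeded by at most one draw,
  that is by \<open>2 * m\<close> arcs and \<open>2 * n\<close> shortcuts.\<close>

lemma draw:
  assumes st: "state_ok lab q w a S c FR LB i s" and i: "i < N"
    and FR: "FR + 4 * n < B" and c: "a < b2 \<Longrightarrow> c + 2 * n \<le> 50 * N"
    and wa: "w \<le> b1 + 2 * m" "a \<le> b2 + 2 * n" "q + 2 < B" and r: "regs s 23 = Suc r" "r < B"
  shows "\<exists>s' lab' dw da S' FR'. exec B draw s (252 + 100 * (dw + da)) s' \<and>
    state_ok lab' (q + 2) (w + dw) (a + da) (S \<union> S') (c + da) FR' LB (Suc i) s' \<and>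
    FR' \<le> FR + 4 * n \<and> w + dw \<le> b1 + 2 * m \<and> a + da \<le> b2 + 2 * n \<and>
    regs s' 7 = regs s 7 \<and> regs s' 23 = r \<and>
    (\<forall>ys. trunc_arcs E b1 b2 lab q w a (xs ! i # ys) = S' \<union> trunc_arcs E b1 b2 lab' (q + 2) (w + dw) (a + da) ys)"
proof -
  define x where "x = xs ! i"
  have "xs ! i \<in> set xs" using xs(1) i by simp
  then have x: "x < n" using xs(2) by (auto simp: x_def)
  have stat: "static s" and lab: "mem s (LB + x) = lab x" and LB: "FR0 \<le> LB" "LB + n \<le> FR"
    and rs: "regs s 19 = LB" "regs s 20 = q" "regs s 21 = w" "regs s 22 = a" "regs s 13 = DR + i"
    using st x by (auto simp: state_ok_def)
  have "DR + i < OUT" using i by (simp add: DR_def OUT_def)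
  then have mx: "mem s (DR + i) = x" using stat xs(3)[OF i] by (simp add: static_def x_def)
  have B1: "B \<noteq> Suc 0" "Suc (DR + i) mod B = Suc (DR + i)" "(LB + x) mod B = LB + x"
    "(q + 2) mod B = q + 2" "r mod B = r" "Suc (Suc q) mod B = Suc (Suc q)"
    using B x FR LB wa i r by (auto simp: DR_def FR0_def)
  let ?go = "lab x \<noteq> 1 \<and> w < b1 \<and> a < b2"
  define s1 where "s1 = ev B pick s"
  have S1: "mem s1 = mem s" "regs s1 24 = x" "regs s1 25 = lab x" "regs s1 13 = DR + Suc i" "regs s1 36 = of_bool ?go"
    "\<And>r. r \<notin> {24, 13, 36, 25, 37} \<Longrightarrow> regs s1 r = regs s r"
    using stat rs by (cases "lab x = 1"; cases "w < b1"; cases "a < b2";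
      simp add: s1_def pick_def set_reg_def static_def mx lab B1)+
  have e1: "exec B pick s 20 s1"
    unfolding s1_def by (rule exec_mono[OF exec_ev]) (simp_all add: pick_def)
  have ok1: "state_ok lab q w a S c FR LB (Suc i) s1"
    using st unfolding state_ok_def static_def by (simp add: S1)
  have tail: "\<exists>s'. exec B draw s (50 + t) s' \<and> state_ok lab' (q + 2) w' a' S' c' FR' LB (Suc i) s' \<and>
      regs s' 7 = regs s2 7 \<and> regs s' 23 = r"
    if e: "exec B (IfNZ 36 process Skip) s1 t s2" and ok: "state_ok lab' q w' a' S' c' FR' LB (Suc i) s2"
      and r2: "regs s2 23 = Suc r" for t s2 lab' w' a' S' c' FR'
  proof -
    define p where "p = seq [Op Add 20 20 4, Op Sub 23 23 3]"
    define s3 where "s3 = ev B p s2"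
    have "regs s2 20 = q" "regs s2 4 = 2" "regs s2 3 = 1" using ok by (auto simp: state_ok_def static_def)
    then have S3: "mem s3 = mem s2" "regs s3 20 = q + 2" "regs s3 23 = r"
      "\<And>r. r \<notin> {20, 23} \<Longrightarrow> regs s3 r = regs s2 r"
      using r2 B1 by (simp_all add: s3_def p_def set_reg_def)
    have "exec B p s2 10 s3"
      unfolding s3_def by (rule exec_mono[OF exec_ev]) (simp_all add: p_def)
    then have "exec B draw s (20 + (t + 10 + 1) + 1) s3"
      unfolding draw_def seq.simps p_def[simplified seq.simps, symmetric]
      by (intro exec_Seq[OF e1] exec_Seq[OF e])
    then have "exec B draw s (50 + t) s3" by (rule exec_mono) simp
    moreover have "state_ok lab' (q + 2) w' a' S' c' FR' LB (Suc i) s3"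
      using ok unfolding state_ok_def static_def by (simp add: S3)
    ultimately show ?thesis using S3 by (intro exI[of _ s3]) simp
  qed
  show ?thesis
  proof (cases ?go)
    case True
    let ?dw = "sum (outdeg E) (reach E lab x) + sum (outdeg (E\<inverse>)) (reach (E\<inverse>) lab x)"
    let ?da = "card (reach E lab x) + card (reach (E\<inverse>) lab x)"
    note deg = degree_sum[OF x, of lab]
    have cc: "OUT + 2 * (c + 2 * n) \<le> FR0" using c True by (auto simp: OUT_def FR0_def)
    have wB: "w + 2 * m < B" "a + 2 * n < B"
      using B wa(1,2) unfolding b1_def b2_def by linarith+
    obtain s2 where 2: "exec B process s1 (200 + 100 * (?dw + ?da)) s2"
      "state_ok (relabel E lab q (q + 1) x) q (w + ?dw) (a + ?da) (S \<union> star E lab x) (c + ?da) (FR + 4 * n) LB (Suc i) s2"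
      "regs s2 7 = regs s1 7" "regs s2 23 = regs s1 23"
      using process[OF ok1 S1(2) x _ S1(3) FR cc wB wa(3)] True by blast
    have "exec B (IfNZ 36 process Skip) s1 (200 + 100 * (?dw + ?da) + 1) s2"
      using True 2(1) by (intro exec_If) (simp add: S1)
    from tail[OF this 2(2)] r obtain s3 where 3: "exec B draw s (50 + (200 + 100 * (?dw + ?da) + 1)) s3"
      "state_ok (relabel E lab q (q + 1) x) (q + 2) (w + ?dw) (a + ?da) (S \<union> star E lab x) (c + ?da) (FR + 4 * n) LB (Suc i) s3"
      "regs s3 7 = regs s 7" "regs s3 23 = r" using 2(3,4) S1 by auto
    have "0 < ?da"
    proof -
      have "x \<in> reach E lab x" using True by (intro reach_refl) simp
      moreover have "finite (reach E lab x)" using finite_subset[OF reach_bounded[OF E x]] by simp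
      ultimately show ?thesis by (auto simp: card_gt_0_iff)
    qed
    show ?thesis
      unfolding x_def[symmetric]
      by (rule exI[of _ s3], rule exI[of _ "relabel E lab q (q + 1) x"], rule exI[of _ ?dw], rule exI[of _ ?da], rule exI[of _ "star E lab x"], rule exI[of _ "FR + 4 * n"]) (use 3 True deg in \<open>auto simp: add.assoc intro: exec_mono\<close>)
  next
    case False
    have e0: "exec B (IfNZ 36 process Skip) s1 (0 + 1) s1"
      by (intro exec_If) (use False in \<open>auto simp: S1(5) exec_Skip\<close>)
    then obtain s3 where 3: "exec B draw s (50 + (0 + 1)) s3"
      "state_ok lab (q + 2) w a S c FR LB (Suc i) s3" "regs s3 7 = regs s 7" "regs s3 23 = r"
      using tail[OF e0 ok1] r S1(6)[of 23] S1(6)[of 7] by auto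
    have tr: "trunc_arcs E b1 b2 lab q w a (x # ys) = trunc_arcs E b1 b2 lab (q + 2) w a ys" for ys
    proof (cases "lab x = 1")
      case True
      have "reach D lab x = {}" for D using True by (simp add: reach_def)
      then have "relabel E lab q (q + 1) x = lab" "star E lab x = {}" "reach D lab x = {}" for D
        by (auto simp: relabel_def star_def fun_eq_iff)
      then show ?thesis by simp
    qed (use False in auto)
    show ?thesis
      unfolding x_def[symmetric]
      by (rule exI[of _ s3], rule exI[of _ lab], rule exI[of _ 0], rule exI[of _ 0], rule exI[of _ "{}"], rule exI[of _ FR]) (use 3 tr wa in \<open>auto intro: exec_mono\<close>)
  qed
qed

text \<open>A draw costs a constant plus 100 per unit of budget it consumes, so the total is
  governed by the budgets and not by draws times graph size. The output space that the repetition
  may still need is \<open>b2 + 2 * n - a\<close>.\<close>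

lemma draws:
  assumes "state_ok lab q w a S c FR LB i s" "i + length ys \<le> N" "\<And>j. j < length ys \<Longrightarrow> xs ! (i + j) = ys ! j"
    "FR + 4 * n * length ys < B" "c + (b2 + 2 * n - a) \<le> 50 * N"
    "w \<le> b1 + 2 * m" "a \<le> b2 + 2 * n" "q + 2 * length ys < B" "regs s 23 = length ys"
  shows "\<exists>s' lab' q' w' a' c' FR'.
    exec B (WhileNZ 23 draw) s (260 * length ys + 100 * ((w' - w) + (a' - a)) + 1) s' \<and>
    state_ok lab' q' w' a' (S \<union> trunc_arcs E b1 b2 lab q w a ys) c' FR' LB (i + length ys) s' \<and>
    w \<le> w' \<and> w' \<le> b1 + 2 * m \<and> a \<le> a' \<and> a' \<le> b2 + 2 * n \<and> c' = c + (a' - a) \<and>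
    FR' \<le> FR + 4 * n * length ys \<and> regs s' 7 = regs s 7"
  using assms
proof (induction ys arbitrary: lab q w a S c FR i s)
  case Nil
  show ?case by (rule exI[of _ s], rule exI[of _ lab], rule exI[of _ q], rule exI[of _ w], rule exI[of _ a], rule exI[of _ c], rule exI[of _ FR]) (use Nil exec_While_stop[of s 23 B draw 0] in \<open>simp\<close>)
next
  case (Cons y ys)
  have y: "xs ! i = y" using Cons.prems(3)[of 0] by simp
  have i: "i < N" using Cons.prems(2) by simp
  have FR: "FR + 4 * n + 4 * n * length ys < B" using Cons.prems(4) by (simp add: algebra_simps)
  have c: "a < b2 \<Longrightarrow> c + 2 * n \<le> 50 * N" using Cons.prems(5) by simp
  have q: "q + 2 < B" "length ys < B" using Cons.prems(8) by auto
  obtain s1 lab1 dw da S1 FR1 where 1: "exec B draw s (252 + 100 * (dw + da)) s1"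
    "state_ok lab1 (q + 2) (w + dw) (a + da) (S \<union> S1) (c + da) FR1 LB (Suc i) s1"
    "FR1 \<le> FR + 4 * n" "w + dw \<le> b1 + 2 * m" "a + da \<le> b2 + 2 * n"
    "regs s1 7 = regs s 7" "regs s1 23 = length ys"
    "\<And>ys. trunc_arcs E b1 b2 lab q w a (xs ! i # ys) = S1 \<union> trunc_arcs E b1 b2 lab1 (q + 2) (w + dw) (a + da) ys"
    using draw[OF Cons.prems(1) i _ c Cons.prems(6,7) q(1) _ q(2)] FR Cons.prems(9) by auto
  have "\<exists>s' lab' q' w' a' c' FR'.
    exec B (WhileNZ 23 draw) s1 (260 * length ys + 100 * ((w' - (w + dw)) + (a' - (a + da))) + 1) s' \<and>
    state_ok lab' q' w' a' ((S \<union> S1) \<union> trunc_arcs E b1 b2 lab1 (q + 2) (w + dw) (a + da) ys) c' FR' LB (Suc i + length ys) s' \<and>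
    w + dw \<le> w' \<and> w' \<le> b1 + 2 * m \<and> a + da \<le> a' \<and> a' \<le> b2 + 2 * n \<and> c' = (c + da) + (a' - (a + da)) \<and>
    FR' \<le> FR1 + 4 * n * length ys \<and> regs s' 7 = regs s1 7"
  proof (rule Cons.IH[OF 1(2)])
    show "xs ! (Suc i + j) = ys ! j" if "j < length ys" for j
      using Cons.prems(3)[of "Suc j"] that by simp
    show "Suc i + length ys \<le> N" using Cons.prems(2) by simp
    show "FR1 + 4 * n * length ys < B" using 1(3) FR by linarith
    show "c + da + (b2 + 2 * n - (a + da)) \<le> 50 * N" using Cons.prems(5) 1(5) by linarith
    show "q + 2 + 2 * length ys < B" using Cons.prems(8) by simp
  qed (rule 1(4,5,7))+
  then obtain s' lab' q' w' a' c' FR' where 2: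
    "exec B (WhileNZ 23 draw) s1 (260 * length ys + 100 * ((w' - (w + dw)) + (a' - (a + da))) + 1) s'"
    "state_ok lab' q' w' a' ((S \<union> S1) \<union> trunc_arcs E b1 b2 lab1 (q + 2) (w + dw) (a + da) ys) c' FR' LB (Suc i + length ys) s'"
    "w + dw \<le> w'" "w' \<le> b1 + 2 * m" "a + da \<le> a'" "a' \<le> b2 + 2 * n" "c' = (c + da) + (a' - (a + da))"
    "FR' \<le> FR1 + 4 * n * length ys" "regs s' 7 = regs s1 7" by blast
  have "exec B (WhileNZ 23 draw) s
    ((252 + 100 * (dw + da)) + (260 * length ys + 100 * ((w' - (w + dw)) + (a' - (a + da))) + 1) + 2) s'"
    using exec_While_step[OF _ 1(1) 2(1)] Cons.prems(9) by simp
  then have ex: "exec B (WhileNZ 23 draw) s (260 * length (y # ys) + 100 * ((w' - w) + (a' - a)) + 1) s'"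
    using 2(3,5) by (elim exec_mono) simp
  have "(S \<union> S1) \<union> trunc_arcs E b1 b2 lab1 (q + 2) (w + dw) (a + da) ys = S \<union> trunc_arcs E b1 b2 lab q w a (y # ys)"
    using 1(8)[of ys] by (simp add: y Un_assoc del: trunc_arcs.simps)
  then have ok: "state_ok lab' q' w' a' (S \<union> trunc_arcs E b1 b2 lab q w a (y # ys)) c' FR' LB (i + length (y # ys)) s'"
    using 2(2) by (simp del: trunc_arcs.simps)
  have "w \<le> w'" "a \<le> a'" "c' = c + (a' - a)" using 2(3,5,7) by linarith+
  moreover have "FR' \<le> FR + 4 * n * length (y # ys)" using 2(8) 1(3) by simp
  moreover have "regs s' 7 = regs s 7" using 2(9) 1(6) by simp
  ultimately show ?case using ex ok 2(4,6) by blast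
qed

text \<open>Describes the state between two repetitions, when labels and counters of the previous
  one are forgotten.\<close>

definition between :: "(nat \<times> nat) set \<Rightarrow> nat \<Rightarrow> nat \<Rightarrow> nat \<Rightarrow> state \<Rightarrow> bool" where
  "between S c FR i s \<longleftrightarrow> static s \<and> regs s 15 = FR \<and> regs s 13 = DR + i \<and> regs s 14 = OUT + 2 * c \<and>
     (\<forall>b\<ge>FR. mem s b = 0) \<and> arc_set (mem s) OUT c = S \<and> FR0 \<le> FR"

lemma repetition:
  assumes bt: "between S c FR i s" and i: "i + T \<le> N" and ys: "length ys = T" "\<And>j. j < T \<Longrightarrow> xs ! (i + j) = ys ! j"
    and FR: "FR + n + 4 * n * T < B" and c: "c + (b2 + 2 * n) \<le> 50 * N" and r: "regs s 7 = Suc r" "r < B"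
  shows "\<exists>s' c' FR'. exec B repetition s (260 * T + 100 * (b1 + 2 * m + b2 + 2 * n) + 30) s' \<and>
    between (S \<union> rep_arcs E b1 b2 ys) c' FR' (i + T) s' \<and> c' \<le> c + (b2 + 2 * n) \<and>
    FR' \<le> FR + n + 4 * n * T \<and> regs s' 7 = r"
proof -
  define s1 where "s1 = ev B rep_init s"
  have stat: "static s" and rs: "regs s 15 = FR" "regs s 13 = DR + i" "regs s 14 = OUT + 2 * c"
    and zero: "\<forall>b\<ge>FR. mem s b = 0" and arcs: "arc_set (mem s) OUT c = S" and F0: "FR0 \<le> FR"
    using bt by (auto simp: between_def)
  have "2 * n * L = 2 * T" by (simp add: T_def)
  then have TB: "2 + 2 * T < B" using B by linarith
  then have mods: "FR mod B = FR" "(FR + n) mod B = FR + n" "2 mod B = 2" "B \<noteq> Suc 0" "T mod B = T"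
    using FR by auto
  have S1: "mem s1 = mem s" "regs s1 19 = FR" "regs s1 15 = FR + n" "regs s1 20 = 2" "regs s1 21 = 0" "regs s1 22 = 0"
    "regs s1 23 = T" "\<And>r. r \<notin> {19, 15, 20, 21, 22, 23} \<Longrightarrow> regs s1 r = regs s r"
    using stat rs by (simp_all add: s1_def rep_init_def set_reg_def static_def mods)
  have e1: "exec B rep_init s 15 s1"
    unfolding s1_def by (rule exec_mono[OF exec_ev]) (simp_all add: rep_init_def)
  \<comment> \<open>The labels of a repetition are \<open>n\<close> fresh zero cells, so all
    vertices start in class 0.\<close>
  have "state_ok (\<lambda>_. 0) 2 0 0 S c (FR + n) FR i s1"
    using stat rs zero arcs F0 unfolding state_ok_def static_def by (simp add: S1)
  then obtain s2 lab' q' w' a' c' FR' where 2: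
    "exec B (WhileNZ 23 draw) s1 (260 * length ys + 100 * ((w' - 0) + (a' - 0)) + 1) s2"
    "state_ok lab' q' w' a' (S \<union> trunc_arcs E b1 b2 (\<lambda>_. 0) 2 0 0 ys) c' FR' FR (i + length ys) s2"
    "w' \<le> b1 + 2 * m" "a' \<le> b2 + 2 * n" "c' = c + (a' - 0)" "FR' \<le> FR + n + 4 * n * length ys" "regs s2 7 = regs s1 7"
    using draws[of "\<lambda>_. 0" 2 0 0 S c "FR + n" FR i s1 ys] i ys FR c TB by (auto simp: S1)
  define s3 where "s3 = ev B (Op Sub 7 7 3) s2"
  have "regs s2 3 = 1" using 2(2) by (simp add: state_ok_def static_def)
  then have S3: "mem s3 = mem s2" "regs s3 7 = r" "\<And>r. r \<noteq> 7 \<Longrightarrow> regs s3 r = regs s2 r"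
    using 2(7) r by (simp_all add: s3_def set_reg_def S1)
  have e3: "exec B (Op Sub 7 7 3) s2 1 s3" using exec_ev[of "Op Sub 7 7 3" B s2] by (simp add: s3_def)
  have "exec B repetition s (15 + ((260 * length ys + 100 * ((w' - 0) + (a' - 0)) + 1) + 1 + 1) + 1) s3"
    unfolding repetition_def seq.simps by (intro exec_Seq[OF e1] exec_Seq[OF 2(1)] e3)
  then have "exec B repetition s (260 * T + 100 * (b1 + 2 * m + b2 + 2 * n) + 30) s3"
    using 2(3,4) ys(1) by (elim exec_mono) simp
  note ex = this
  have bw: "between (S \<union> rep_arcs E b1 b2 ys) c' FR' (i + T) s3"
    using 2(2) F0 unfolding between_def state_ok_def static_def rep_arcs_def by (simp add: S3 ys(1))
  show ?thesis by (rule exI[of _ s3], rule exI[of _ c'], rule exI[of _ FR']) (use ex bw 2(4-6) S3 ys(1) in \<open>simp\<close>)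
qed

definition rep_time :: nat where
  "rep_time = 260 * T + 100 * (b1 + 2 * m + b2 + 2 * n) + 32"

lemma repetitions:
  assumes "between S c FR i s" "i + r * T \<le> N" "length ys = r * T" "\<And>j. j < r * T \<Longrightarrow> xs ! (i + j) = ys ! j"
    "FR + r * (n + 4 * n * T) < B" "c + r * (b2 + 2 * n) \<le> 50 * N" "regs s 7 = r"
  shows "\<exists>s' c' FR'. exec B (WhileNZ 7 repetition) s (r * rep_time + 1) s' \<and>
    between (S \<union> all_arcs E b1 b2 T r ys) c' FR' (i + r * T) s' \<and> c' \<le> c + r * (b2 + 2 * n)"
  using assms
proof (induction r arbitrary: S c FR i s ys)
  case 0
  show ?case by (rule exI[of _ s], rule exI[of _ c], rule exI[of _ FR]) (use 0 exec_While_stop[of s 7 B repetition 0] in \<open>simp\<close>)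
next
  case (Suc r)
  have T1: "1 \<le> n + 4 * n * T" using n by simp
  then have "r \<le> r * (n + 4 * n * T)" by simp
  then have rB: "r < B" using Suc.prems(5) by (simp only: mult_Suc)
  have "T \<le> length ys" using Suc.prems(3) by simp
  then have l: "length (take T ys) = T" by simp
  have tk: "xs ! (i + j) = take T ys ! j" if "j < T" for j using that Suc.prems(4)[of j] by simp
  obtain s1 c1 FR1 where 1: "exec B repetition s (260 * T + 100 * (b1 + 2 * m + b2 + 2 * n) + 30) s1"
    "between (S \<union> rep_arcs E b1 b2 (take T ys)) c1 FR1 (i + T) s1" "c1 \<le> c + (b2 + 2 * n)"
    "FR1 \<le> FR + n + 4 * n * T" "regs s1 7 = r"
    using repetition[OF Suc.prems(1) _ l tk _ _ Suc.prems(7) rB] Suc.prems(2,5,6) by (auto simp: add.assoc)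
  have "\<exists>s' c' FR'. exec B (WhileNZ 7 repetition) s1 (r * rep_time + 1) s' \<and>
    between ((S \<union> rep_arcs E b1 b2 (take T ys)) \<union> all_arcs E b1 b2 T r (drop T ys)) c' FR' (i + T + r * T) s' \<and>
    c' \<le> c1 + r * (b2 + 2 * n)"
  proof (rule Suc.IH[OF 1(2)])
    show "xs ! (i + T + j) = drop T ys ! j" if "j < r * T" for j
      using that Suc.prems(3) Suc.prems(4)[of "T + j"] by (simp add: add.assoc)
  qed (use Suc.prems 1 in auto)
  then obtain s2 c2 FR2 where 2: "exec B (WhileNZ 7 repetition) s1 (r * rep_time + 1) s2"
    "between ((S \<union> rep_arcs E b1 b2 (take T ys)) \<union> all_arcs E b1 b2 T r (drop T ys)) c2 FR2 (i + T + r * T) s2"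
    "c2 \<le> c1 + r * (b2 + 2 * n)" by blast
  have "exec B (WhileNZ 7 repetition) s ((260 * T + 100 * (b1 + 2 * m + b2 + 2 * n) + 30) + (r * rep_time + 1) + 2) s2"
    using exec_While_step[OF _ 1(1) 2(1)] Suc.prems(7) by simp
  then have "exec B (WhileNZ 7 repetition) s (Suc r * rep_time + 1) s2"
    by (rule exec_mono) (simp add: rep_time_def)
  moreover have "between (S \<union> all_arcs E b1 b2 T (Suc r) ys) c2 FR2 (i + Suc r * T) s2"
    using 2(2) by (simp add: Un_assoc add.assoc)
  moreover have "c2 \<le> c + Suc r * (b2 + 2 * n)" using 1(3) 2(3) by simp
  ultimately show ?case by blast
qed

lemma main:
  assumes st: "static s" "regs s 7 = k * L" "regs s 13 = DR" "regs s 14 = OUT" "regs s 15 = FR0" "\<forall>b\<ge>OUT. mem s b = 0"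
  shows "\<exists>s'. exec B main s (k * L * rep_time + 20) s' \<and>
    output_arcs (Skip, s') = all_arcs E b1 b2 T (k * L) xs \<and> card (output_arcs (Skip, s')) \<le> 50 * N"
proof -
  have OF: "OUT \<le> FR0" by (simp add: OUT_def FR0_def)
  have "between {} 0 FR0 0 s" using st OF by (simp add: between_def arc_set_0)
  \<comment> \<open>Every repetition takes \<open>n\<close> cells for labels and
    \<open>4 * n\<close> per draw, in all at most \<open>5 * n * N\<close>.\<close>
  moreover have "FR0 + k * L * (n + 4 * n * T) < B"
  proof -
    have "k * L * n \<le> k * L * n * (L * n)" using n L by simp
    also have "\<dots> = n * N" by (simp add: N_def algebra_simps)
    finally have "k * L * (n + 4 * n * T) \<le> 5 * n * N" by (simp add: N_def T_def algebra_simps)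
    then show ?thesis using B by simp
  qed
  \<comment> \<open>Budget and overshoot together:
    \<open>48 * n * L + 2 * n \<le> 50 * (n * L)\<close> arcs per repetition, which is why
    \<open>100 * N\<close> cells are reserved for the output.\<close>
  moreover have cN: "k * L * (b2 + 2 * n) \<le> 50 * N"
  proof -
    have "2 * n \<le> 2 * n * L" using L by simp
    then have "b2 + 2 * n \<le> 50 * (n * L)" unfolding b2_def by linarith
    then have "k * L * (b2 + 2 * n) \<le> k * L * (50 * (n * L))" by (rule mult_le_mono2)
    then show ?thesis by (simp add: N_def algebra_simps)
  qed
  moreover have "N = k * L * T" by (simp add: N_def T_def)
  ultimately obtain s1 c FR where 1: "exec B (WhileNZ 7 repetition) s (k * L * rep_time + 1) s1"
    "between ({} \<union> all_arcs E b1 b2 T (k * L) xs) c FR (0 + k * L * T) s1" "c \<le> 0 + k * L * (b2 + 2 * n)"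
    using repetitions[of "{}" 0 FR0 0 s "k * L" xs] xs(1) st(2) by auto
  define p where "p = seq [Op Sub 0 14 18, Op Div 0 0 4, Op Add 1 18 46]"
  define s2 where "s2 = ev B p s1"
  have cB: "c \<le> 50 * N" using 1(3) cN by simp
  then have mods: "(2 * c) mod B = 2 * c" "c mod B = c" "OUT mod B = OUT" using B OF by (auto simp: FR0_def)
  have r1: "regs s1 14 = OUT + 2 * c" "regs s1 18 = OUT" "regs s1 4 = 2" "regs s1 46 = 0"
    "arc_set (mem s1) OUT c = all_arcs E b1 b2 T (k * L) xs"
    using 1(2) by (auto simp: between_def static_def)
  have S2: "mem s2 = mem s1" "regs s2 0 = c" "regs s2 1 = OUT"
    using r1 mods by (simp_all add: s2_def p_def set_reg_def)
  have "exec B p s1 10 s2" unfolding s2_def by (rule exec_mono[OF exec_ev]) (simp_all add: p_def)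
  then have "exec B main s ((k * L * rep_time + 1) + 10 + 1) s2"
    unfolding main_def seq.simps p_def[simplified seq.simps, symmetric] by (intro exec_Seq[OF 1(1)])
  then have ex: "exec B main s (k * L * rep_time + 20) s2" by (rule exec_mono) simp
  have out: "output_arcs (Skip, s2) = arc_set (mem s1) OUT c"
    by (auto simp: output_arcs_def Let_def S2[unfolded One_nat_def] arc_set_def)
  then show ?thesis using ex r1 card_arc_set[of "mem s1" OUT c] cB by (intro exI[of _ s2]) simp
qed

end

section \<open>Initialization\<close>

fun bits :: "nat \<Rightarrow> nat" where
  "bits y = (if y = 0 then 0 else Suc (bits (y div 2)))"

declare bits.simps [simp del]

lemma bits_0 [simp]: "bits 0 = 0"
  by (simp add: bits.simps)

lemma bits_pos: "0 < y \<Longrightarrow> bits y = Suc (bits (y div 2))"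
  by (simp add: bits.simps)

lemma less_2_bits: "y < 2 ^ bits y"
proof (induction y rule: bits.induct)
  case (1 y)
  then show ?case by (cases "y = 0") (auto simp: bits_pos)
qed

lemma bits_le: "0 < y \<Longrightarrow> 2 ^ bits y \<le> 2 * y"
proof (induction y rule: bits.induct)
  case (1 y)
  show ?case
  proof (cases "y div 2 = 0")
    case True
    then show ?thesis using 1(2) by (simp add: bits_pos)
  next
    case False
    then have "2 ^ bits (y div 2) \<le> 2 * (y div 2)" using 1 by auto
    then show ?thesis using 1(2) by (simp add: bits_pos)
  qed
qed

lemma bits_le_self: "bits y \<le> y"
proof (induction y rule: bits.induct)
  case (1 y)
  then show ?case by (cases "y = 0") (auto simp: bits_pos)
qed

definition count_bits :: prog where
  "count_bits = WhileNZ 36 (seq [Op Add 5 5 3, Op Div 36 36 4])"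

lemma count_bits:
  assumes "regs s 36 = y" "regs s 5 + bits y < B" "regs s 3 = 1" "regs s 4 = 2" "y < B"
  shows "\<exists>s'. exec B count_bits s (8 * bits y + 1) s' \<and> mem s' = mem s \<and> regs s' 5 = regs s 5 + bits y \<and>
    (\<forall>r. r \<notin> {5, 36} \<longrightarrow> regs s' r = regs s r)"
  using assms
proof (induction y arbitrary: s rule: bits.induct)
  case (1 y)
  show ?case
  proof (cases "y = 0")
    case True
    then show ?thesis using 1(2) exec_While_stop[of s 36 B _ 0]
      by (intro exI[of _ s]) (auto simp: count_bits_def)
  next
    case False
    define p where "p = seq [Op Add 5 5 3, Op Div 36 36 4]"
    define s1 where "s1 = ev B p s"
    have S1: "mem s1 = mem s" "regs s1 5 = Suc (regs s 5)" "regs s1 36 = y div 2"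
      "\<And>r. r \<notin> {5, 36} \<Longrightarrow> regs s1 r = regs s r"
      using 1(2-) False by (simp_all add: s1_def p_def set_reg_def bits_pos)
    have "\<exists>s'. exec B count_bits s1 (8 * bits (y div 2) + 1) s' \<and> mem s' = mem s1 \<and>
      regs s' 5 = regs s1 5 + bits (y div 2) \<and> (\<forall>r. r \<notin> {5, 36} \<longrightarrow> regs s' r = regs s1 r)"
      using 1(2-) False by (intro 1(1)) (auto simp: S1 bits_pos)
    then obtain s2 where 2: "exec B count_bits s1 (8 * bits (y div 2) + 1) s2" "mem s2 = mem s1"
      "regs s2 5 = regs s1 5 + bits (y div 2)" "\<And>r. r \<notin> {5, 36} \<Longrightarrow> regs s2 r = regs s1 r" by blast
    have "exec B p s 3 s1" unfolding s1_def by (rule exec_mono[OF exec_ev]) (simp_all add: p_def)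
    then have "exec B count_bits s (3 + (8 * bits (y div 2) + 1) + 2) s2"
      unfolding count_bits_def p_def using 2(1) False 1(2)
      by (intro exec_While_step) (simp_all add: count_bits_def)
    then have "exec B count_bits s (8 * bits y + 1) s2" by (rule exec_mono) (use False in \<open>simp add: bits_pos\<close>)
    then show ?thesis using 2 S1 False by (intro exI[of _ s2]) (simp add: bits_pos)
  qed
qed

definition build_body :: prog where
  "build_body = seq [Op Mul 36 4 34, Op Sub 36 36 28, Load 33 36, Op Add 36 26 33, Load 37 36, Op Add 38 27 34,
     Store 38 37, Store 36 34, Op Sub 34 34 3]"

definition build :: prog where
  "build = WhileNZ 34 build_body"

lemma chain_cong: "chain M X e es \<Longrightarrow> (\<And>a. a \<in> set es \<Longrightarrow> M' (X + a) = M (X + a)) \<Longrightarrow> chain M' X e es"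
  by (induction es arbitrary: e) auto

definition built :: "nat \<Rightarrow> nat \<Rightarrow> nat \<Rightarrow> nat \<Rightarrow> (nat \<Rightarrow> nat) \<Rightarrow> state \<Rightarrow> state \<Rightarrow> bool" where
  "built n m H X src s s' \<longleftrightarrow> (\<forall>r. r \<notin> {33, 34, 36, 37, 38} \<longrightarrow> regs s' r = regs s r) \<and>
    (\<forall>a. a \<notin> {H..<H + n} \<union> {X..X + m} \<longrightarrow> mem s' a = mem s a) \<and>
    (\<forall>u<n. chain (mem s') X (mem s' (H + u)) (filter (\<lambda>e. src e = u) [Suc 0..<Suc m]))"

text \<open>Arc numbers are processed downwards and each is prepended to its list; with
  \<open>e\<close> arcs left the lists hold exactly the numbers above \<open>e\<close>, in ascending
  order.\<close>

lemma build:
  assumes "regs s 34 = e" "e \<le> m" "regs s 3 = 1" "regs s 4 = 2" "regs s 26 = H" "regs s 27 = X" "regs s 28 = off"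
    "off = 1 \<or> off = 2" "\<And>e. 0 < e \<Longrightarrow> e \<le> m \<Longrightarrow> mem s (2 * e - off) = src e \<and> src e < n"
    "2 * m \<le> H" "2 * m \<le> X" "H + n \<le> X \<or> X + m < H" "H + n < B" "X + m < B" "2 * m < B"
    "\<And>u. u < n \<Longrightarrow> chain (mem s) X (mem s (H + u)) (filter (\<lambda>e. src e = u) [Suc e..<Suc m])"
  shows "\<exists>s'. exec B build s (20 * e + 1) s' \<and> built n m H X src s s'"
  using assms
proof (induction e arbitrary: s)
  case 0
  then show ?case using exec_While_stop[of s 34 B build_body 0] by (intro exI[of _ s]) (simp add: build_def built_def)
next
  case (Suc e)
  define s1 where "s1 = ev B build_body s"
  let ?u = "src (Suc e)"
  have u: "mem s (2 * Suc e - off) = ?u" "?u < n" using Suc.prems(9)[of "Suc e"] Suc.prems(2) by auto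
  have eB: "2 * Suc e \<le> 2 * m" using Suc.prems(2) by simp
  have mods: "(2 * Suc e) mod B = 2 * Suc e" "(2 * Suc e - off) mod B = 2 * Suc e - off" "(H + ?u) mod B = H + ?u"
    "(X + Suc e) mod B = X + Suc e" "e mod B = e"
    using Suc.prems(13,14,15) u(2) eB by auto
  have ne: "H + ?u \<noteq> X + Suc e" using Suc.prems(2,12) u(2) by auto
  note rg = Suc.prems(1,3-7)
  have S1: "mem s1 = (mem s)(X + Suc e := mem s (H + ?u), H + ?u := Suc e)" "regs s1 34 = e"
    "\<And>r. r \<notin> {33, 34, 36, 37, 38} \<Longrightarrow> regs s1 r = regs s r"
    using rg mods u(1) by (simp_all add: s1_def build_body_def set_reg_def del: mult_Suc_right)
  have "\<exists>s'. exec B build s1 (20 * e + 1) s' \<and> built n m H X src s1 s'"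
  proof (rule Suc.IH)
    show "mem s1 (2 * e' - off) = src e' \<and> src e' < n" if "0 < e'" "e' \<le> m" for e'
      using Suc.prems(8-11) that by (auto simp: S1(1))
    show "chain (mem s1) X (mem s1 (H + v)) (filter (\<lambda>e. src e = v) [Suc e..<Suc m])" if v: "v < n" for v
    proof -
      let ?l = "filter (\<lambda>e. src e = v) [Suc (Suc e)..<Suc m]"
      have old: "chain (mem s) X (mem s (H + v)) ?l" using Suc.prems(16)[OF v] .
      \<comment> \<open>The link cell written for arc \<open>Suc e\<close> belongs to no list of
        larger arc numbers, and the heads lie apart from the links.\<close>
      have new: "chain (mem s1) X (mem s (H + v)) ?l"
        using Suc.prems(12) u(2) by (intro chain_cong[OF old]) (auto simp: S1(1))
      have up: "[Suc e..<Suc m] = Suc e # [Suc (Suc e)..<Suc m]" using Suc.prems(2) by (intro upt_conv_Cons) simp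
      show ?thesis
      proof (cases "src (Suc e) = v")
        case True
        have "mem s1 (H + v) = Suc e" "mem s1 (X + Suc e) = mem s (H + v)" using True ne by (auto simp: S1(1))
        then show ?thesis unfolding up using True new by simp
      next
        case False
        have "H + v \<noteq> X + Suc e" using Suc.prems(2,12) v by auto
        then have "mem s1 (H + v) = mem s (H + v)" using False by (auto simp: S1(1))
        then show ?thesis unfolding up using False new by simp
      qed
    qed
  qed (use Suc.prems S1 in simp_all)
  then obtain s2 where 2: "exec B build s1 (20 * e + 1) s2" "\<forall>r. r \<notin> {33, 34, 36, 37, 38} \<longrightarrow> regs s2 r = regs s1 r"
    "\<forall>a. a \<notin> {H..<H + n} \<union> {X..X + m} \<longrightarrow> mem s2 a = mem s1 a"
    "\<forall>u<n. chain (mem s2) X (mem s2 (H + u)) (filter (\<lambda>e. src e = u) [Suc 0..<Suc m])"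
    unfolding built_def by blast
  have "exec B build_body s 17 s1" unfolding s1_def by (rule exec_mono[OF exec_ev]) (simp_all add: build_body_def)
  then have "exec B build s (17 + (20 * e + 1) + 2) s2"
    unfolding build_def using 2(1) Suc.prems(1) by (intro exec_While_step) (simp_all add: build_def)
  then have ex: "exec B build s (20 * Suc e + 1) s2" by (rule exec_mono) simp
  have "mem s2 a = mem s a" if "a \<notin> {H..<H + n} \<union> {X..X + m}" for a
  proof -
    have "a \<noteq> X + Suc e" "a \<noteq> H + ?u" using that u(2) Suc.prems(2) by auto
    then show ?thesis using 2(3) that by (simp add: S1(1))
  qed
  then show ?case using ex 2(2,4) S1(3) unfolding built_def by (intro exI[of _ s2]) simp
qed

text \<open>All random numbers are drawn in advance, which leaves a deterministic program.\<close>

definition store_draw :: prog where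
  "store_draw = seq [Store 36 35, Op Add 36 36 3, Op Sub 31 31 3]"

definition draw_all :: prog where
  "draw_all = WhileNZ 31 (Seq (Rand 35 0) store_draw)"

text \<open>The state after storing a given list of draws; it separates the randomness, which is
  just a list, from its use.\<close>

primrec fill :: "nat \<Rightarrow> state \<Rightarrow> nat list \<Rightarrow> state" where
  "fill B s [] = s"
| "fill B s (x # xs) = fill B (ev B store_draw (set_reg 35 x s)) xs"

lemma store_draw:
  fixes x :: nat
  assumes "regs s 3 = 1" "regs s 31 = Suc j" "regs s 36 = a" "Suc j < B" "a + 1 < B"
  defines "s' \<equiv> ev B store_draw (set_reg 35 x s)"
  shows "mem s' = (mem s)(a := x)" "regs s' 31 = j" "regs s' 36 = Suc a" "\<And>r. r \<notin> {31, 35, 36} \<Longrightarrow> regs s' r = regs s r"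
  using assms by (simp_all add: store_draw_def set_reg_def)

lemma fill:
  assumes "regs s 3 = 1" "regs s 31 = length xs" "regs s 36 = a" "length xs < B" "a + length xs < B"
  shows "(\<forall>i<length xs. mem (fill B s xs) (a + i) = xs ! i) \<and>
    (\<forall>b. b \<notin> {a..<a + length xs} \<longrightarrow> mem (fill B s xs) b = mem s b) \<and>
    (\<forall>r. r \<notin> {31, 35, 36} \<longrightarrow> regs (fill B s xs) r = regs s r)"
  using assms
proof (induction xs arbitrary: s a)
  case (Cons x xs)
  define s1 where "s1 = ev B store_draw (set_reg 35 x s)"
  have "regs s 31 = Suc (length xs)" "Suc (length xs) < B" "a + 1 < B" using Cons.prems by auto
  note S1 = store_draw[OF Cons.prems(1) this(1) Cons.prems(3) this(2,3), where x = x, folded s1_def]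
  have IH: "(\<forall>i<length xs. mem (fill B s1 xs) (Suc a + i) = xs ! i) \<and>
    (\<forall>b. b \<notin> {Suc a..<Suc a + length xs} \<longrightarrow> mem (fill B s1 xs) b = mem s1 b) \<and>
    (\<forall>r. r \<notin> {31, 35, 36} \<longrightarrow> regs (fill B s1 xs) r = regs s1 r)"
    using Cons.prems S1 by (intro Cons.IH) auto
  have "mem (fill B s1 xs) (a + i) = (x # xs) ! i" if "i < length (x # xs)" for i
    using that IH by (cases i) (auto simp: S1(1))
  then show ?case using IH S1 by (simp flip: s1_def)
qed simp

lemma draw_all:
  assumes "regs s 31 = j" "regs s 0 = n" "0 < n" "regs s 3 = 1" "j < B" "regs s 36 + j < B"
  shows "pexec B draw_all s (12 * j + 1) (map_pmf (fill B s) (replicate_pmf j (pmf_of_set {..<n})))"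
  using assms
proof (induction j arbitrary: s)
  case 0
  have "exec B draw_all s 1 s" using 0 exec_While_stop[of s 31 B _ 0] by (simp add: draw_all_def)
  then show ?case by (simp add: exec_def)
next
  case (Suc j)
  let ?U = "pmf_of_set {..<n}"
  let ?f = "\<lambda>x. ev B store_draw (set_reg 35 x s)"
  have "step B (Rand 35 0) s = map_pmf (Pair Skip) (map_pmf (\<lambda>x. set_reg 35 x s) ?U)"
    using Suc.prems(2,3) by (simp add: map_pmf_comp)
  then have r: "pexec B (Rand 35 0) s 1 (map_pmf (\<lambda>x. set_reg 35 x s) ?U)"
    by (simp add: pexec_def bind_return_pmf)
  have "pexec B store_draw s' 5 (return_pmf (ev B store_draw s'))" for s'
    using exec_mono[OF exec_ev[of store_draw B s'], of 5] by (simp add: exec_def store_draw_def)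
  then have "pexec B (Seq (Rand 35 0) store_draw) s (1 + 5 + 1)
      (bind_pmf (map_pmf (\<lambda>x. set_reg 35 x s) ?U) (\<lambda>s'. return_pmf (ev B store_draw s')))"
    by (intro pexec_Seq[OF r])
  then have body: "pexec B (Seq (Rand 35 0) store_draw) s 7 (map_pmf ?f ?U)"
    by (simp add: map_pmf_def bind_assoc_pmf bind_return_pmf)
  have "pexec B draw_all (?f x) (12 * j + 1) (map_pmf (fill B (?f x)) (replicate_pmf j ?U))" for x
  proof (rule Suc.IH)
    have *: "regs s 31 = Suc j" "Suc j < B" "regs s 36 + 1 < B" using Suc.prems by auto
    note S1 = store_draw[OF Suc.prems(4) *(1) refl *(2,3), where x = x]
    show "regs (?f x) 31 = j" "regs (?f x) 0 = n" "regs (?f x) 3 = 1" "regs (?f x) 36 + j < B"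
      using S1 Suc.prems by auto
  qed (use Suc.prems in auto)
  then have "pexec B draw_all s (7 + (12 * j + 1) + 2)
      (bind_pmf (map_pmf ?f ?U) (\<lambda>s'. map_pmf (fill B s') (replicate_pmf j ?U)))"
    unfolding draw_all_def using Suc.prems(1) by (intro pexec_While_step body) (auto simp: draw_all_def)
  then have "pexec B draw_all s (12 * Suc j + 1) (bind_pmf (map_pmf ?f ?U) (\<lambda>s'. map_pmf (fill B s') (replicate_pmf j ?U)))"
    by (rule pexec_mono) simp
  moreover have "bind_pmf (map_pmf ?f ?U) (\<lambda>s'. map_pmf (fill B s') (replicate_pmf j ?U)) =
      map_pmf (fill B s) (replicate_pmf (Suc j) ?U)"
    by (simp add: map_pmf_def bind_assoc_pmf bind_return_pmf)
  ultimately show ?case by simp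
qed

text \<open>Identifies the final state picked by \<open>SOME\<close> in \<open>run_algorithm\<close>
  with the one whose output is known.\<close>

lemma exec_unique: "exec B p s t s1 \<Longrightarrow> exec B p s t s2 \<Longrightarrow> s1 = s2"
proof -
  assume "exec B p s t s1" "exec B p s t s2"
  then have "map_pmf (Pair Skip) (return_pmf s1) = map_pmf (Pair Skip) (return_pmf s2)"
    by (simp add: exec_def pexec_def)
  then show ?thesis by simp
qed

definition prepare :: prog where
  "prepare = seq [Const 3 1, Const 4 2, Const 5 0, Op Add 36 0 46]"

definition layout :: prog where
  "layout = seq [Op Mul 6 0 5, Op Mul 7 2 5, Op Mul 8 7 6, Op Mul 9 4 1, Op Add 10 9 0, Op Add 11 10 0,
     Op Add 12 11 1, Op Add 12 12 3, Op Add 13 12 1, Op Add 13 13 3, Op Add 18 13 8, Const 36 100, Op Mul 36 36 8,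
     Op Add 15 18 36, Op Add 14 18 46, Const 36 48, Op Mul 36 36 1, Op Mul 16 36 5, Const 36 48, Op Mul 36 36 0,
     Op Mul 17 36 5, Op Add 26 9 46, Op Add 27 11 46, Const 28 2, Op Add 34 1 46]"

definition set_reverse :: prog where
  "set_reverse = seq [Op Add 26 10 46, Op Add 27 12 46, Const 28 1, Op Add 34 1 46]"

definition set_draw :: prog where
  "set_draw = seq [Op Add 31 8 46, Op Add 36 13 46]"

definition initialize :: prog where
  "initialize = seq [prepare, count_bits, layout, build, set_reverse, build, set_draw]"

definition algorithm :: prog where
  "algorithm = seq [initialize, draw_all, main]"

text \<open>The out-list of \<open>u\<close> for \<open>fst\<close> and its in-list for
  \<open>snd\<close>. Arc numbers start at 1, hence the shift \<open>e - 1\<close>.\<close>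

definition arcs_at :: "(nat \<times> nat \<Rightarrow> nat) \<Rightarrow> (nat \<times> nat) list \<Rightarrow> nat \<Rightarrow> nat list" where
  "arcs_at f es u = filter (\<lambda>e. f (es ! (e - 1)) = u) [Suc 0..<Suc (length es)]"

lemma in_set_es: "a \<in> set es \<longleftrightarrow> (\<exists>e. 0 < e \<and> e \<le> length es \<and> es ! (e - 1) = a)"
proof -
  have "\<exists>e. 0 < e \<and> e \<le> length es \<and> es ! (e - 1) = a" if "i < length es" "es ! i = a" for i
    using that by (intro exI[of _ "Suc i"]) simp
  moreover have "\<exists>i<length es. es ! i = a" if "0 < e" "e \<le> length es" "es ! (e - 1) = a" for e
    using that by (intro exI[of _ "e - 1"]) simp
  ultimately show ?thesis unfolding in_set_conv_nth by blast
qed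

lemma set_arcs_at: "e \<in> set (arcs_at f es u) \<longleftrightarrow> 0 < e \<and> e \<le> length es \<and> f (es ! (e - 1)) = u"
  by (auto simp: arcs_at_def)

lemma length_arcs_at:
  assumes "distinct es" shows "length (arcs_at f es u) = card {a \<in> set es. f a = u}"
proof -
  have inj: "inj_on (\<lambda>e. es ! (e - 1)) (set (arcs_at f es u))"
  proof (rule inj_onI)
    fix e e' assume "e \<in> set (arcs_at f es u)" "e' \<in> set (arcs_at f es u)" "es ! (e - 1) = es ! (e' - 1)"
    moreover from this have "e - 1 < length es" "e' - 1 < length es" "0 < e" "0 < e'"
      unfolding set_arcs_at by arith+
    ultimately have "e - 1 = e' - 1" using nth_eq_iff_index_eq[OF assms] by blast
    then show "e = e'" using \<open>0 < e\<close> \<open>0 < e'\<close> by arith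
  qed
  have "(\<lambda>e. es ! (e - 1)) ` set (arcs_at f es u) = {a \<in> set es. f a = u}"
    by (intro set_eqI) (auto simp: image_iff Bex_def set_arcs_at in_set_es[of _ es])
  moreover have "distinct (arcs_at f es u)" by (simp add: arcs_at_def del: upt_Suc)
  ultimately show ?thesis using card_image[OF inj] by (simp add: distinct_card)
qed

lemma length_arcs_at_fst_snd:
  assumes "distinct es"
  shows "length (arcs_at fst es u) = outdeg (set es) u" "length (arcs_at snd es u) = outdeg ((set es)\<inverse>) u"
proof -
  have "{a \<in> set es. fst a = u} = Pair u ` {w. (u, w) \<in> set es}"
    "{a \<in> set es. snd a = u} = (\<lambda>w. (w, u)) ` {w. (u, w) \<in> (set es)\<inverse>}" by (auto simp: image_iff)
  then show "length (arcs_at fst es u) = outdeg (set es) u" "length (arcs_at snd es u) = outdeg ((set es)\<inverse>) u"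
    unfolding length_arcs_at[OF assms] outdeg_def by (simp_all add: card_image inj_on_def)
qed

lemma initialize:
  fixes n m k L B :: nat and es :: "(nat \<times> nat) list"
  defines "N \<equiv> k * L * (n * L)" and "m \<equiv> length es" and "L \<equiv> bits n"
  assumes es: "set es \<subseteq> {..<n} \<times> {..<n}" and n: "n \<ge> 2"
    and B: "4 * m + 2 * n + 2 + N + 100 * N + 6 * n * N + 48 * m * L + 48 * n * L + 4 * m + 4 * n + 2 * n * L + 10 < B"
    and B2: "k * L < B" "100 < B"
  shows "\<exists>s. exec B initialize (input_state k n es) (200 + 8 * L + 40 * m) s \<and>
    regs s 0 = n \<and> regs s 3 = 1 \<and> regs s 4 = 2 \<and> regs s 46 = 0 \<and> regs s 6 = n * L \<and> regs s 7 = k * L \<and>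
    regs s 9 = 2 * m \<and> regs s 10 = 2 * m + n \<and> regs s 11 = 2 * m + 2 * n \<and> regs s 12 = 3 * m + 2 * n + 1 \<and>
    regs s 13 = 4 * m + 2 * n + 2 \<and> regs s 18 = 4 * m + 2 * n + 2 + N \<and> regs s 14 = 4 * m + 2 * n + 2 + N \<and>
    regs s 15 = 4 * m + 2 * n + 2 + N + 100 * N \<and> regs s 16 = 48 * m * L \<and> regs s 17 = 48 * n * L \<and>
    regs s 31 = N \<and> regs s 36 = 4 * m + 2 * n + 2 \<and>
    (\<forall>e. 0 < e \<longrightarrow> e \<le> m \<longrightarrow> mem s (2 * e - 2) = fst (es ! (e - 1)) \<and> mem s (2 * e - 1) = snd (es ! (e - 1))) \<and>
    (\<forall>u<n. chain (mem s) (2 * m + 2 * n) (mem s (2 * m + u)) (arcs_at fst es u)) \<and>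
    (\<forall>u<n. chain (mem s) (3 * m + 2 * n + 1) (mem s (2 * m + n + u)) (arcs_at snd es u)) \<and>
    (\<forall>a\<ge>4 * m + 2 * n + 2. mem s a = 0)"
proof -
  define s0 where "s0 = input_state k n es"
  have r0: "regs s0 0 = n" "regs s0 1 = m" "regs s0 2 = k" "\<And>r. r > 2 \<Longrightarrow> regs s0 r = 0"
    by (auto simp: s0_def input_state_def m_def)
  have m0: "mem s0 (2 * e - 2) = fst (es ! (e - 1))" "mem s0 (2 * e - 1) = snd (es ! (e - 1))"
    "fst (es ! (e - 1)) < n" "snd (es ! (e - 1)) < n" if "0 < e" "e \<le> m" for e
  proof -
    have i: "e - 1 < length es" "2 * e - 2 = 2 * (e - 1)" "2 * e - 1 = Suc (2 * (e - 1))" using that by (auto simp: m_def)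
    show "mem s0 (2 * e - 2) = fst (es ! (e - 1))" "mem s0 (2 * e - 1) = snd (es ! (e - 1))"
      unfolding i(2,3) using i(1) by (auto simp: s0_def input_state_def)
    show "fst (es ! (e - 1)) < n" "snd (es ! (e - 1)) < n"
      using es nth_mem[OF i(1)] by auto
  qed
  have z0: "mem s0 a = 0" if "a \<ge> 2 * m" for a using that by (simp add: s0_def input_state_def m_def)
  have L: "L \<le> n" by (simp add: L_def bits_le_self)
  have nB: "n < B" "m < B" "B \<noteq> Suc 0" "1 < B" using B by linarith+
  define s1 where "s1 = ev B prepare s0"
  have e1: "exec B prepare s0 10 s1" unfolding s1_def by (rule exec_mono[OF exec_ev]) (simp_all add: prepare_def)
  have S1: "mem s1 = mem s0" "regs s1 3 = 1" "regs s1 4 = 2" "regs s1 5 = 0" "regs s1 36 = n"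
    "\<And>r. r \<notin> {3, 4, 5, 36} \<Longrightarrow> regs s1 r = regs s0 r"
    using r0 nB B2 by (simp_all add: s1_def prepare_def set_reg_def)
  have "bits n < B" using L nB by (simp add: L_def)
  then obtain s2 where e2: "exec B count_bits s1 (8 * L + 1) s2" and S2: "mem s2 = mem s0" "regs s2 5 = L"
    "\<And>r. r \<notin> {5, 36} \<Longrightarrow> regs s2 r = regs s1 r"
    using count_bits[of s1 n B] S1 nB by (auto simp: L_def)
  define s3 where "s3 = ev B layout s2"
  have e3: "exec B layout s2 60 s3" unfolding s3_def by (rule exec_mono[OF exec_ev]) (simp_all add: layout_def)
  define HF HB XF XB DR OUT FR0 where "HF = 2 * m" and "HB = 2 * m + n" and "XF = 2 * m + 2 * n"
    and "XB = 3 * m + 2 * n + 1" and "DR = 4 * m + 2 * n + 2" and "OUT = 4 * m + 2 * n + 2 + N"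
    and "FR0 = 4 * m + 2 * n + 2 + N + 100 * N"
  \<comment> \<open>Naming every intermediate value keeps the symbolic execution of
    \<open>layout\<close> free of nested \<open>mod\<close>, once each value is known to be below
    \<open>B\<close>.\<close>
  define c1 b1 c2 b2 h where "c1 = 48 * m" and "b1 = 48 * m * L" and "c2 = 48 * n" and "b2 = 48 * n * L" and "h = 100 * N"
  define T R XB' DR' where "T = n * L" and "R = k * L" and "XB' = XF + m" and "DR' = XB + m"
  have mods: "(n * L) mod B = T" "(k * L) mod B = R" "(R * T) mod B = N" "(2 * m) mod B = HF" "(HF + n) mod B = HB"
    "(HB + n) mod B = XF" "(XF + m) mod B = XB'" "Suc XB' mod B = XB" "(XB + m) mod B = DR'" "Suc DR' mod B = DR"
    "(DR + N) mod B = OUT" "100 mod B = 100" "(100 * N) mod B = h" "(OUT + h) mod B = FR0" "OUT mod B = OUT"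
    "48 mod B = 48" "(48 * m) mod B = c1" "(c1 * L) mod B = b1" "(48 * n) mod B = c2" "(c2 * L) mod B = b2"
    "HF mod B = HF" "XF mod B = XF" "2 mod B = 2" "m mod B = m" "HB mod B = HB" "XB mod B = XB"
  proof -
    have nm: "1 \<le> L" using n by (simp add: L_def bits_pos)
    then have "48 * m * 1 \<le> 48 * m * L" "48 * n * 1 \<le> 48 * n * L" by (intro mult_le_mono2; simp)+
    moreover have "48 * n * L = 48 * (n * L)" by simp
    ultimately have "n * L < B" "48 * m < B" "48 * n < B" "48 * m * L < B" "48 * n * L < B" using B by linarith+
    then show "(n * L) mod B = T" "(48 * m) mod B = c1" "(c1 * L) mod B = b1" "(48 * n) mod B = c2" "(c2 * L) mod B = b2"
      by (simp_all add: T_def c1_def b1_def c2_def b2_def)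
    have "N < B" "100 * N < B" using B by linarith+
    then show "(R * T) mod B = N" "(100 * N) mod B = h" unfolding R_def T_def h_def N_def by simp_all
    show "(k * L) mod B = R" using B2 by (simp add: R_def)
  qed (use B B2 nB in \<open>simp_all add: HF_def HB_def XF_def XB_def DR_def OUT_def FR0_def XB'_def DR'_def h_def\<close>)
  have R2: "regs s2 0 = n" "regs s2 1 = m" "regs s2 2 = k" "regs s2 3 = 1" "regs s2 4 = 2" "regs s2 46 = 0"
    using S2(3) S1 r0 by simp_all
  have S3: "mem s3 = mem s0" "regs s3 6 = T" "regs s3 7 = R" "regs s3 8 = N" "regs s3 9 = HF"
    "regs s3 10 = HB" "regs s3 11 = XF" "regs s3 12 = XB" "regs s3 13 = DR" "regs s3 18 = OUT" "regs s3 14 = OUT" "regs s3 15 = FR0"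
    "regs s3 16 = b1" "regs s3 17 = b2" "regs s3 26 = HF" "regs s3 27 = XF" "regs s3 28 = 2"
    "regs s3 34 = m" "regs s3 0 = n" "regs s3 1 = m" "regs s3 3 = 1" "regs s3 4 = 2" "regs s3 46 = 0"
    using R2 S2(1,2) by (simp_all add: s3_def layout_def set_reg_def mods)
  note bases = HF_def HB_def XF_def XB_def DR_def
  \<comment> \<open>Out-lists are indexed by tails, which lie in cells \<open>2 * e - 2\<close>,
    hence \<open>off = 2\<close>; the search along them reads heads with \<open>off = 1\<close>. For
    the in-lists it is the other way round.\<close>
  have "\<exists>s'. exec B build s3 (20 * m + 1) s' \<and> built n m HF XF (\<lambda>e. fst (es ! (e - 1))) s3 s'"
    using B z0 by (intro build[where off = 2]) (simp_all add: S3 m0[unfolded One_nat_def] bases)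
  then obtain s4 where e4: "exec B build s3 (20 * m + 1) s4" and r4: "\<And>r. r \<notin> {33, 34, 36, 37, 38} \<Longrightarrow> regs s4 r = regs s3 r"
    and m4: "\<And>a. a \<notin> {HF..<HF + n} \<union> {XF..XF + m} \<Longrightarrow> mem s4 a = mem s0 a"
    and c4: "\<forall>u<n. chain (mem s4) XF (mem s4 (HF + u)) (arcs_at fst es u)"
    unfolding arcs_at_def built_def m_def[symmetric] by (auto simp: S3(1))
  have m4': "mem s4 a = mem s0 a" if "a < 2 * m" for a using that by (intro m4) (simp add: bases)
  have lt: "2 * e - 1 < 2 * m" "2 * e - 2 < 2 * m" if "0 < e" "e \<le> m" for e using that by linarith+
  define s5 where "s5 = ev B set_reverse s4"
  have e5: "exec B set_reverse s4 10 s5" unfolding s5_def by (rule exec_mono[OF exec_ev]) (simp_all add: set_reverse_def)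
  have S5: "mem s5 = mem s4" "regs s5 26 = HB" "regs s5 27 = XB" "regs s5 28 = 1" "regs s5 34 = m"
    "\<And>r. r \<notin> {26, 27, 28, 34} \<Longrightarrow> regs s5 r = regs s4 r"
    using mods nB by (simp_all add: s5_def set_reverse_def set_reg_def r4 S3[unfolded One_nat_def])
  have "\<exists>s'. exec B build s5 (20 * m + 1) s' \<and> built n m HB XB (\<lambda>e. snd (es ! (e - 1))) s5 s'"
  proof (rule build[where off = 1])
    show "mem s5 (2 * e - 1) = snd (es ! (e - 1)) \<and> snd (es ! (e - 1)) < n" if "0 < e" "e \<le> m" for e
      using m4'[OF lt(1)[OF that]] m0[OF that] by (simp add: S5)
    show "chain (mem s5) XB (mem s5 (HB + u)) (filter (\<lambda>e. snd (es ! (e - 1)) = u) [Suc m..<Suc m])"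
      if "u < n" for u using that m4[of "HB + u"] z0[of "HB + u"] by (simp add: S5 bases)
  qed (use B in \<open>simp_all add: S5 S3 r4, simp_all add: bases\<close>)
  then obtain s6 where e6: "exec B build s5 (20 * m + 1) s6" and r6: "\<And>r. r \<notin> {33, 34, 36, 37, 38} \<Longrightarrow> regs s6 r = regs s5 r"
    and m6: "\<And>a. a \<notin> {HB..<HB + n} \<union> {XB..XB + m} \<Longrightarrow> mem s6 a = mem s4 a"
    and c6: "\<forall>u<n. chain (mem s6) XB (mem s6 (HB + u)) (arcs_at snd es u)"
    unfolding arcs_at_def built_def m_def[symmetric] by (auto simp: S5(1))
  have m6': "mem s6 a = mem s0 a" if "a < 2 * m" for a
    unfolding m4'[OF that, symmetric] using that by (intro m6) (simp add: bases)
  define s7 where "s7 = ev B set_draw s6"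
  have e7: "exec B set_draw s6 10 s7" unfolding s7_def by (rule exec_mono[OF exec_ev]) (simp_all add: set_draw_def)
  have "N mod B = N" "DR mod B = DR" using B by (simp_all add: DR_def)
  then have S7: "mem s7 = mem s6" "regs s7 31 = N" "regs s7 36 = DR"
    "\<And>r. r \<notin> {31, 36} \<Longrightarrow> regs s7 r = regs s6 r"
    by (simp_all add: s7_def set_draw_def set_reg_def r6 S5 r4 S3)
  have "exec B initialize s0 (10 + ((8 * L + 1) + (60 + ((20 * m + 1) + (10 + ((20 * m + 1) + 10 + 1) + 1) + 1) + 1) + 1) + 1) s7"
    unfolding initialize_def seq.simps by (intro exec_Seq[OF e1] exec_Seq[OF e2] exec_Seq[OF e3] exec_Seq[OF e4] exec_Seq[OF e5] exec_Seq[OF e6] e7)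
  then have ex: "exec B initialize s0 (200 + 8 * L + 40 * m) s7" by (rule exec_mono) simp
  have c7: "chain (mem s7) XF (mem s7 (HF + u)) (arcs_at fst es u)" if u: "u < n" for u
  proof -
    have "HF + u \<notin> {HB..<HB + n} \<union> {XB..XB + m}" using u by (simp add: bases)
    then have 1: "mem s7 (HF + u) = mem s4 (HF + u)" unfolding S7(1) by (rule m6)
    have 2: "mem s7 (XF + e) = mem s4 (XF + e)" if "e \<in> set (arcs_at fst es u)" for e
    proof -
      have "e \<le> m" using that unfolding set_arcs_at m_def by blast
      then have "XF + e \<notin> {HB..<HB + n} \<union> {XB..XB + m}" by (simp add: bases)
      then show ?thesis unfolding S7(1) by (rule m6)
    qed
    have "chain (mem s4) XF (mem s4 (HF + u)) (arcs_at fst es u)" using c4 u by blast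
    then show ?thesis unfolding 1 using 2 by (rule chain_cong)
  qed
  have a7: "mem s7 (2 * e - 2) = fst (es ! (e - 1)) \<and> mem s7 (2 * e - 1) = snd (es ! (e - 1))" if "0 < e" "e \<le> m" for e
    using m6'[OF lt(1)[OF that]] m6'[OF lt(2)[OF that]] m0[OF that] by (simp add: S7)
  have z7: "mem s7 a = 0" if "a \<ge> DR" for a
  proof -
    have "a \<notin> {HB..<HB + n} \<union> {XB..XB + m}" "a \<notin> {HF..<HF + n} \<union> {XF..XF + m}" "2 * m \<le> a"
      using that by (auto simp: bases)
    then show ?thesis unfolding S7(1) using m6 m4 z0 by metis
  qed
  have R7: "regs s7 r = regs s3 r" if "r \<notin> {26, 27, 28, 31, 33, 34, 36, 37, 38}" for r
    using that by (simp add: S7 r6 S5 r4)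
  have R: "regs s7 0 = n" "regs s7 3 = 1" "regs s7 4 = 2" "regs s7 46 = 0" "regs s7 6 = T" "regs s7 7 = R"
    "regs s7 9 = HF" "regs s7 10 = HB" "regs s7 11 = XF" "regs s7 12 = XB" "regs s7 13 = DR" "regs s7 18 = OUT"
    "regs s7 14 = OUT" "regs s7 15 = FR0" "regs s7 16 = b1" "regs s7 17 = b2" "regs s7 31 = N" "regs s7 36 = DR"
    by (simp_all add: R7 S3 S7)
  have c7': "chain (mem s7) XB (mem s7 (HB + u)) (arcs_at snd es u)" if "u < n" for u
    using c6 that by (simp add: S7)
  show ?thesis
    using ex R a7 c7 c7' z7
    unfolding s0_def bases OUT_def FR0_def b1_def b2_def T_def R_def by (intro exI[of _ s7]) blast
qed

section \<open>Correctness and running time\<close>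

definition total_time :: "nat \<Rightarrow> nat \<Rightarrow> nat \<Rightarrow> nat \<Rightarrow> nat" where
  "total_time n m k L = 200 + 8 * L + 40 * m + (12 * (k * L * (n * L)) + 1) +
     (k * L * (260 * (n * L) + 100 * (48 * m * L + 2 * m + 48 * n * L + 2 * n) + 32) + 20) + 2"

text \<open>Given the draws the program is deterministic, so the distribution of its final state is
  the image of the draws under a function \<open>h\<close>.\<close>

lemma run_algorithm:
  fixes n m k L B N :: nat and es :: "(nat \<times> nat) list"
  defines "N \<equiv> k * L * (n * L)" and "m \<equiv> length es" and "L \<equiv> bits n"
  assumes es: "distinct es" "set es \<subseteq> {..<n} \<times> {..<n}" and n: "n \<ge> 2"
    and B: "4 * m + 2 * n + 2 + N + 100 * N + 6 * n * N + 48 * m * L + 48 * n * L + 4 * m + 4 * n + 2 * n * L + 10 < B"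
    and B2: "k * L < B" "100 < B"
  obtains h where
    "run B (total_time n m k L) (algorithm, input_state k n es) =
       map_pmf (\<lambda>xs. (Skip, h xs)) (replicate_pmf N (pmf_of_set {..<n}))"
    "\<And>xs. xs \<in> set_pmf (replicate_pmf N (pmf_of_set {..<n})) \<Longrightarrow>
       output_arcs (Skip, h xs) = all_arcs (set es) (48 * m * L) (48 * n * L) (n * L) (k * L) xs \<and>
       card (output_arcs (Skip, h xs)) \<le> 50 * N"
proof -
  let ?DR = "4 * m + 2 * n + 2"
  let ?rt = "260 * (n * L) + 100 * (48 * m * L + 2 * m + 48 * n * L + 2 * n) + 32"
  let ?t = "k * L * ?rt + 20"
  let ?M = "replicate_pmf N (pmf_of_set {..<n})"
  obtain s where ex: "exec B initialize (input_state k n es) (200 + 8 * L + 40 * m) s"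
    and r: "regs s 0 = n" "regs s 3 = 1" "regs s 4 = 2" "regs s 46 = 0" "regs s 6 = n * L" "regs s 7 = k * L"
    "regs s 9 = 2 * m" "regs s 10 = 2 * m + n" "regs s 11 = 2 * m + 2 * n" "regs s 12 = 3 * m + 2 * n + 1"
    "regs s 13 = ?DR" "regs s 18 = ?DR + N" "regs s 14 = ?DR + N" "regs s 15 = ?DR + N + 100 * N"
    "regs s 16 = 48 * m * L" "regs s 17 = 48 * n * L" "regs s 31 = N" "regs s 36 = ?DR"
    and arc: "\<And>e. 0 < e \<Longrightarrow> e \<le> m \<Longrightarrow> mem s (2 * e - 2) = fst (es ! (e - 1)) \<and> mem s (2 * e - 1) = snd (es ! (e - 1))"
    and chF: "\<And>u. u < n \<Longrightarrow> chain (mem s) (2 * m + 2 * n) (mem s (2 * m + u)) (arcs_at fst es u)"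
    and chB: "\<And>u. u < n \<Longrightarrow> chain (mem s) (3 * m + 2 * n + 1) (mem s (2 * m + n + u)) (arcs_at snd es u)"
    and z: "\<And>a. a \<ge> ?DR \<Longrightarrow> mem s a = 0"
    using initialize[OF es(2) n B[unfolded N_def m_def L_def] B2[unfolded L_def]]
    unfolding N_def[symmetric] m_def[symmetric] L_def[symmetric] by blast
  have main_ex: "\<exists>s'. exec B main (fill B s xs) ?t s' \<and>
      output_arcs (Skip, s') = all_arcs (set es) (48 * m * L) (48 * n * L) (n * L) (k * L) xs \<and>
      card (output_arcs (Skip, s')) \<le> 50 * N"
    if xs: "xs \<in> set_pmf ?M" for xs
  proof -
    have lx: "length xs = N" "set xs \<subseteq> {..<n}"
      using xs n by (auto simp: set_replicate_pmf set_pmf_of_set lists_eq_set lessThan_empty_iff)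
    define s1 where "s1 = fill B s xs"
    have "(\<forall>i<length xs. mem s1 (?DR + i) = xs ! i) \<and>
      (\<forall>b. b \<notin> {?DR..<?DR + length xs} \<longrightarrow> mem s1 b = mem s b) \<and>
      (\<forall>r. r \<notin> {31, 35, 36} \<longrightarrow> regs s1 r = regs s r)"
      unfolding s1_def by (rule fill) (use B r lx in simp_all)
    then have f: "\<And>i. i < N \<Longrightarrow> mem s1 (?DR + i) = xs ! i" "\<And>b. b < ?DR \<or> ?DR + N \<le> b \<Longrightarrow> mem s1 b = mem s b"
      "\<And>r. r \<notin> {31, 35, 36} \<Longrightarrow> regs s1 r = regs s r"
      using lx by auto
    have arc1: "mem s1 (2 * e - 2) = fst (es ! (e - 1))" "mem s1 (2 * e - 1) = snd (es ! (e - 1))" if "0 < e" "e \<le> m" for e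
    proof -
      have "2 * e - 2 < ?DR" "2 * e - 1 < ?DR" using that by linarith+
      then have "mem s1 (2 * e - 2) = mem s (2 * e - 2)" "mem s1 (2 * e - 1) = mem s (2 * e - 1)"
        using f(2) by blast+
      then show "mem s1 (2 * e - 2) = fst (es ! (e - 1))" "mem s1 (2 * e - 1) = snd (es ! (e - 1))"
        using arc[OF that] by simp_all
    qed
    have L0: "L > 0" using n by (simp add: L_def bits_pos)
    interpret M: machine n m k L B "set es" "arcs_at fst es" "arcs_at snd es" "mem s1" xs
      "n * L" "k * L * (n * L)" ?DR "?DR + k * L * (n * L)" "?DR + k * L * (n * L) + 100 * (k * L * (n * L))"
      "48 * m * L" "48 * n * L" "2 * m" "2 * m + n" "2 * m + 2 * n" "3 * m + 2 * n + 1"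
    proof unfold_locales
      show "is_digraph n (set es)" using es(2) by (simp add: is_digraph_def)
      show "0 < n" "0 < L" using n L0 by simp_all
      show "card (set es) = m" using es(1) by (simp add: distinct_card m_def)
      show "chain (mem s1) (2 * m + 2 * n) (mem s1 (2 * m + u)) (arcs_at fst es u)" if "u < n" for u
      proof -
        have "mem s1 (2 * m + u) = mem s (2 * m + u)" using that by (intro f(2)) simp
        then show ?thesis using chain_cong[OF chF[OF that], of "mem s1"] f(2) by (auto simp: set_arcs_at m_def)
      qed
      show "chain (mem s1) (3 * m + 2 * n + 1) (mem s1 (2 * m + n + u)) (arcs_at snd es u)" if "u < n" for u
      proof -
        have "mem s1 (2 * m + n + u) = mem s (2 * m + n + u)" using that by (intro f(2)) simp
        then show ?thesis using chain_cong[OF chB[OF that], of "mem s1"] f(2) by (auto simp: set_arcs_at m_def)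
      qed
      show "0 < e \<and> e \<le> m" if "e \<in> set (arcs_at fst es u)" for u e using that by (simp add: set_arcs_at m_def)
      show "0 < e \<and> e \<le> m" if "e \<in> set (arcs_at snd es u)" for u e using that by (simp add: set_arcs_at m_def)
      have E: "(u, v) \<in> set es \<longleftrightarrow> (\<exists>e. 0 < e \<and> e \<le> m \<and> mem s1 (2 * e - 2) = u \<and> mem s1 (2 * e - 1) = v)" for u v
        unfolding in_set_es m_def[symmetric] using arc1 by (metis fst_conv snd_conv prod.collapse)
      have sub: "(u, v) \<in> set es \<Longrightarrow> u < n \<and> v < n" for u v using es(2) by auto
      have F: "e \<in> set (arcs_at fst es u) \<longleftrightarrow> 0 < e \<and> e \<le> m \<and> mem s1 (2 * e - 2) = u" for e u
        using arc1(1) by (auto simp: set_arcs_at m_def)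
      have G: "e \<in> set (arcs_at snd es u) \<longleftrightarrow> 0 < e \<and> e \<le> m \<and> mem s1 (2 * e - 1) = u" for e u
        using arc1(2) by (auto simp: set_arcs_at m_def)
      show "set es = {(u, v). u < n \<and> (\<exists>e\<in>set (arcs_at fst es u). v = mem s1 (2 * e - 1))}"
      proof (intro set_eqI, clarify)
        fix u v
        show "(u, v) \<in> set es \<longleftrightarrow> (u, v) \<in> {(u, v). u < n \<and> (\<exists>e\<in>set (arcs_at fst es u). v = mem s1 (2 * e - 1))}"
          unfolding Bex_def F mem_Collect_eq prod.case using E[of u v] sub[of u v] by blast
      qed
      show "(set es)\<inverse> = {(u, v). u < n \<and> (\<exists>e\<in>set (arcs_at snd es u). v = mem s1 (2 * e - 2))}"
      proof (intro set_eqI, clarify)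
        fix u v
        show "(u, v) \<in> (set es)\<inverse> \<longleftrightarrow> (u, v) \<in> {(u, v). u < n \<and> (\<exists>e\<in>set (arcs_at snd es u). v = mem s1 (2 * e - 2))}"
          unfolding Bex_def G mem_Collect_eq prod.case converse_iff using E[of v u] sub[of v u] by blast
      qed
      show "length (arcs_at fst es u) = outdeg (set es) u" for u by (rule length_arcs_at_fst_snd(1)[OF es(1)])
      show "length (arcs_at snd es u) = outdeg ((set es)\<inverse>) u" for u by (rule length_arcs_at_fst_snd(2)[OF es(1)])
      show "length xs = k * L * (n * L)" using lx by (simp add: N_def)
      show "set xs \<subseteq> {..<n}" by (rule lx)
      show "mem s1 (?DR + i) = xs ! i" if "i < k * L * (n * L)" for i using f(1) that by (simp add: N_def)
      show "?DR + k * L * (n * L) + 100 * (k * L * (n * L)) + 6 * n * (k * L * (n * L)) + 48 * m * L + 48 * n * L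
         + 4 * m + 4 * n + 2 * n * L + 10 < B" using B by (simp only: N_def)
    qed simp_all
    have "M.static s1" unfolding M.static_def by (simp add: f(3) r N_def)
    moreover have "\<forall>b\<ge>?DR + k * L * (n * L). mem s1 b = 0"
      using f(2) z by (auto simp: N_def)
    ultimately show ?thesis
      using M.main[of s1] by (simp add: f(3) r N_def M.rep_time_def s1_def[symmetric])
  qed
  define g where "g s' = (SOME s''. exec B main s' ?t s'')" for s'
  have g: "exec B main (fill B s xs) ?t (g (fill B s xs)) \<and>
      output_arcs (Skip, g (fill B s xs)) = all_arcs (set es) (48 * m * L) (48 * n * L) (n * L) (k * L) xs \<and>
      card (output_arcs (Skip, g (fill B s xs))) \<le> 50 * N" if xs: "xs \<in> set_pmf ?M" for xs
  proof -
    obtain s' where s': "exec B main (fill B s xs) ?t s'"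
      "output_arcs (Skip, s') = all_arcs (set es) (48 * m * L) (48 * n * L) (n * L) (k * L) xs"
      "card (output_arcs (Skip, s')) \<le> 50 * N" using main_ex[OF xs] by blast
    have "exec B main (fill B s xs) ?t (g (fill B s xs))" unfolding g_def using s'(1) by (rule someI)
    then have "g (fill B s xs) = s'" using s'(1) exec_unique by blast
    then show ?thesis using s' by simp
  qed
  have rand: "pexec B draw_all s (12 * N + 1) (map_pmf (fill B s) ?M)"
    using B n r by (intro draw_all) auto
  have dm: "pexec B (Seq draw_all main) s (12 * N + 1 + ?t + 1) (bind_pmf (map_pmf (fill B s) ?M) (\<lambda>s'. return_pmf (g s')))"
    using g by (intro pexec_Seq[OF rand]) (auto simp: exec_def)
  have "pexec B (Seq initialize (Seq draw_all main)) (input_state k n es) (200 + 8 * L + 40 * m + (12 * N + 1 + ?t + 1) + 1)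
     (bind_pmf (return_pmf s) (\<lambda>_. bind_pmf (map_pmf (fill B s) ?M) (\<lambda>s'. return_pmf (g s'))))"
    by (rule pexec_Seq[OF ex[unfolded exec_def]]) (use dm in simp)
  then have "pexec B algorithm (input_state k n es) (total_time n m k L) (map_pmf (\<lambda>xs. g (fill B s xs)) ?M)"
    by (simp add: algorithm_def total_time_def N_def bind_return_pmf map_pmf_def bind_assoc_pmf add.assoc)
  then have runs: "run B (total_time n m k L) (algorithm, input_state k n es) = map_pmf (\<lambda>xs. (Skip, g (fill B s xs))) ?M"
    by (simp add: pexec_def map_pmf_comp)
  show ?thesis by (rule that[of "\<lambda>xs. g (fill B s xs)"], fact runs, use g in blast)
qed

text \<open>The largest quantity \<open>n * N\<close> has degree 5 in \<open>S\<close>. The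
  coefficients add up to less than 300, and \<open>S \<ge> 5\<close> gives
  \<open>S ^ 4 \<ge> 625\<close>; hence the exponent 9.\<close>

lemma word_bound_sufficient:
  fixes n m k L N S :: nat
  defines "S \<equiv> n + m + k + 2" and "N \<equiv> k * L * (n * L)"
  assumes L: "L \<le> n" and n: "n \<ge> 2" "m \<ge> 1"
  shows "4 * m + 2 * n + 2 + N + 100 * N + 6 * n * N + 48 * m * L + 48 * n * L + 4 * m + 4 * n + 2 * n * L + 10 < S ^ 9"
    "k * L < S ^ 9" "100 < S ^ 9"
proof -
  have S5: "5 \<le> S" using n by (simp add: S_def)
  have le: "n \<le> S" "m \<le> S" "k \<le> S" "L \<le> S" using L by (auto simp: S_def)
  have up: "S ^ i \<le> S ^ 5" if "i \<le> 5" for i using S5 that by (intro power_increasing) auto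
  have "m \<le> S ^ 5" "n \<le> S ^ 5" "1 \<le> S ^ 5" using le up[of 1] up[of 0] by auto
  moreover have "m * L \<le> S ^ 5" "n * L \<le> S ^ 5" "k * L \<le> S ^ 5"
    using mult_le_mono[OF le(2,4)] mult_le_mono[OF le(1,4)] mult_le_mono[OF le(3,4)] up[of 2] by (auto simp: power2_eq_square)
  moreover have nN: "n * N \<le> S ^ 5"
  proof -
    have "n * (k * L * (n * L)) \<le> S * (S * S * (S * S))" using le by (intro mult_le_mono)
    also have "\<dots> = S ^ 5" by (simp add: eval_nat_numeral)
    finally show ?thesis by (simp add: N_def)
  qed
  moreover have "N \<le> n * N" using n by simp
  ultimately have "4 * m + 2 * n + 2 + N + 100 * N + 6 * (n * N) + 48 * (m * L) + 48 * (n * L) + 4 * m + 4 * n + 2 * (n * L) + 10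
    < 300 * S ^ 5" "k * L < 300 * S ^ 5" "100 < 300 * S ^ 5" by linarith+
  moreover have "300 * S ^ 5 \<le> S ^ 9"
  proof -
    have "5 ^ 4 * S ^ 5 \<le> S ^ 4 * S ^ 5" using S5 by (intro mult_le_mono power_mono) auto
    then show ?thesis by (simp flip: power_add)
  qed
  ultimately show "4 * m + 2 * n + 2 + N + 100 * N + 6 * n * N + 48 * m * L + 48 * n * L + 4 * m + 4 * n + 2 * n * L + 10 < S ^ 9"
    "k * L < S ^ 9" "100 < S ^ 9" by (simp_all only: mult.assoc)
qed

text \<open>By \<open>n \<le> 2 * m\<close> every term is charged to \<open>m * (L * L)\<close>; the
  constants are generously rounded.\<close>

lemma total_time_le:
  assumes L: "1 \<le> L" and n: "n \<le> 2 * m" and m: "1 \<le> m"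
  shows "total_time n m k L \<le> (16000 * k + 1000) * (m * (L * L))"
proof -
  define Y where "Y = m * (L * L)"
  have LL: "1 \<le> L * L" "L \<le> L * L" using L by auto
  have 1: "1 \<le> Y" "L \<le> Y" "m \<le> Y"
    using mult_le_mono[OF m LL(1)] mult_le_mono[OF m LL(2)] mult_le_mono[OF le_refl[of m] LL(1)] by (auto simp: Y_def)
  have nLL: "n * (L * L) \<le> 2 * Y" using n by (auto simp: Y_def)
  have mL: "m * L \<le> Y" "n * L \<le> 2 * Y" "L * 32 \<le> 32 * Y"
    using mult_le_mono[OF le_refl[of m] LL(2)] mult_le_mono[OF n LL(2)] 1 by (auto simp: Y_def)
  have "L * (260 * (n * L) + 100 * (48 * m * L + 2 * m + 48 * n * L + 2 * n) + 32) =
    260 * (n * (L * L)) + 4800 * Y + 200 * (m * L) + 4800 * (n * (L * L)) + 200 * (n * L) + L * 32"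
    by (simp add: Y_def algebra_simps)
  also have "\<dots> \<le> 15600 * Y" using nLL mL by linarith
  finally have 2: "k * (L * (260 * (n * L) + 100 * (48 * m * L + 2 * m + 48 * n * L + 2 * n) + 32)) \<le> k * (15600 * Y)"
    by (rule mult_le_mono2)
  have 3: "k * (n * (L * L)) \<le> k * (2 * Y)" using nLL by (rule mult_le_mono2)
  define Z where "Z = 260 * (n * L) + 100 * (48 * m * L + 2 * m + 48 * n * L + 2 * n) + 32"
  have "total_time n m k L = 223 + 8 * L + 40 * m + 12 * (k * (n * (L * L))) + k * (L * Z)"
    unfolding total_time_def Z_def[symmetric] by simp
  moreover have "k * (L * Z) \<le> 15600 * (k * Y)" using 2 by (simp add: Z_def)
  moreover have "k * (n * (L * L)) \<le> 2 * (k * Y)" using 3 by simp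
  moreover have "(16000 * k + 1000) * Y = 16000 * (k * Y) + 1000 * Y" by (simp add: algebra_simps)
  ultimately show ?thesis unfolding Y_def[symmetric] using 1 by linarith
qed

lemma algorithm_guarantees:
  fixes c :: real and n m k :: nat
  assumes k: "real k \<ge> c + 2"
    and es: "distinct es" "set es = E" and m: "card E = m" and E: "is_digraph n E" and n: "n \<ge> 2" and mn: "real m \<ge> real n / 2"
  shows "\<exists>t. real t \<le> 4 * (16000 * real k + 1000) * real m * (log 2 (real n))\<^sup>2 \<and>
    (\<forall>cf \<in> set_pmf (run_on algorithm 9 k n es t).
       halted cf \<and> output_arcs cf \<subseteq> shortcuts n E \<and>
       real (card (output_arcs cf)) \<le> 200 * real k * real n * (log 2 (real n))\<^sup>2) \<and>
    measure_pmf.prob (run_on algorithm 9 k n es t)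
      {cf. real (digraph_diameter n (E \<union> output_arcs cf))
             \<le> 20 * real n powr (2/3) * log 2 (real n) powr (4/3)} \<ge> 1 - 1 / real n powr c"
proof -
  define L where "L = bits n"
  define N where "N = k * L * (n * L)"
  define lg where "lg = log 2 (real n)"
  have len: "length es = m" using es m distinct_card by fastforce
  have nm: "n \<le> 2 * m" "1 \<le> m" using mn n by linarith+
  have L1: "1 \<le> L" "L \<le> n" using n bits_le_self[of n] unfolding L_def by (simp_all add: bits_pos)
  have lg1: "1 \<le> lg" using n by (simp add: lg_def le_log_iff)
  \<comment> \<open>From \<open>2 ^ L \<le> 2 * n\<close> and \<open>lg \<ge> 1\<close>. Its square
    is the source of the factor 4 in the time bound and of 200 = 4 * 50 in the size bound.\<close>
  have Llg: "real L \<le> 2 * lg"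
  proof -
    have "(2::nat) ^ L \<le> 2 * n" unfolding L_def using n by (intro bits_le) simp
    then have "(2::real) ^ L \<le> 2 * real n" by (metis of_nat_le_iff of_nat_mult of_nat_numeral of_nat_power)
    then have "real L \<le> log 2 (2 * real n)" using n by (simp add: le_log_iff powr_realpow)
    also have "\<dots> = 1 + lg" using n by (simp add: lg_def log_mult)
    finally show ?thesis using lg1 by simp
  qed
  have LL: "real (L * L) \<le> 4 * lg\<^sup>2"
  proof -
    have "real L * real L \<le> (2 * lg) * (2 * lg)" using Llg by (intro mult_mono) auto
    then show ?thesis by (simp add: power2_eq_square)
  qed
  note wb = word_bound_sufficient[OF L1(2) n nm(2), of k, folded N_def]
  have sub: "set es \<subseteq> {..<n} \<times> {..<n}" using E es by (simp add: is_digraph_def)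
  obtain h where h: "run ((n + m + k + 2) ^ 9) (total_time n m k L) (algorithm, input_state k n es) =
     map_pmf (\<lambda>xs. (Skip, h xs)) (replicate_pmf N (pmf_of_set {..<n}))"
    "\<And>xs. xs \<in> set_pmf (replicate_pmf N (pmf_of_set {..<n})) \<Longrightarrow>
     output_arcs (Skip, h xs) = all_arcs E (48 * m * L) (48 * n * L) (n * L) (k * L) xs \<and>
     card (output_arcs (Skip, h xs)) \<le> 50 * N"
    using run_algorithm[OF es(1) sub n, where k = k and B = "(n + m + k + 2) ^ 9"] wb
    unfolding len L_def[symmetric] N_def[symmetric] es(2) by blast
  let ?M = "replicate_pmf N (pmf_of_set {..<n})"
  have run: "run_on algorithm 9 k n es (total_time n m k L) = map_pmf (\<lambda>xs. (Skip, h xs)) ?M"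
    using h(1) by (simp add: run_on_def word_bound_def len)
  let ?D = "{cf. real (digraph_diameter n (E \<union> output_arcs cf)) \<le> 20 * real n powr (2/3) * lg powr (4/3)}"
  show ?thesis
    unfolding lg_def[symmetric]
  proof (intro exI[of _ "total_time n m k L"] conjI ballI)
    have "real (total_time n m k L) \<le> real ((16000 * k + 1000) * (m * (L * L)))"
      using total_time_le[OF L1(1) nm] of_nat_mono by blast
    also have "\<dots> = (16000 * real k + 1000) * real m * real (L * L)" by simp
    also have "\<dots> \<le> (16000 * real k + 1000) * real m * (4 * lg\<^sup>2)" using LL by (intro mult_left_mono) auto
    finally show "real (total_time n m k L) \<le> 4 * (16000 * real k + 1000) * real m * lg\<^sup>2" by (simp add: algebra_simps)
  next
    fix cf assume "cf \<in> set_pmf (run_on algorithm 9 k n es (total_time n m k L))"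
    then obtain xs where xs: "xs \<in> set_pmf ?M" "cf = (Skip, h xs)" unfolding run by auto
    then show "halted cf" by (simp add: halted_def)
    have "set xs \<subseteq> {..<n}" using xs(1) n by (auto simp: set_replicate_pmf set_pmf_of_set lists_eq_set lessThan_empty_iff)
    then show "output_arcs cf \<subseteq> shortcuts n E" using h(2)[OF xs(1)] all_arcs_subset[OF E] xs(2) by simp
    have "real (card (output_arcs cf)) \<le> real (50 * N)" using h(2)[OF xs(1)] xs(2) of_nat_mono by blast
    also have "\<dots> = 50 * real k * real n * real (L * L)" by (simp add: N_def)
    also have "\<dots> \<le> 50 * real k * real n * (4 * lg\<^sup>2)" using LL by (intro mult_left_mono) auto
    finally show "real (card (output_arcs cf)) \<le> 200 * real k * real n * lg\<^sup>2" by (simp add: mult_ac)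
  next
    let ?G = "{xs. real (digraph_diameter n (E \<union> all_arcs E (48 * card E * L) (48 * n * L) (n * L) (k * L) xs))
        \<le> 20 * real n powr (2/3)}"
    have "E \<noteq> {}" using m nm by auto
    then have "1 - 1 / real n powr c \<le> measure_pmf.prob ?M ?G"
      using all_arcs_diameter[OF E _ _ _ k, of L] less_2_bits[of n] n by (simp add: L_def N_def)
    \<comment> \<open>The output is known only for lists that can be drawn, so the event is
      restricted to the support.\<close>
    also have "\<dots> = measure_pmf.prob ?M (?G \<inter> set_pmf ?M)" by (simp add: measure_Int_set_pmf)
    also have "\<dots> \<le> measure_pmf.prob ?M ((\<lambda>xs. (Skip, h xs)) -` ?D)"
    proof (rule measure_pmf.finite_measure_mono)
      \<comment> \<open>The bound reached has no logarithm; as \<open>lg \<ge> 1\<close>, it implies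
        the stated one.\<close>
      have "20 * real n powr (2/3) * 1 \<le> 20 * real n powr (2/3) * lg powr (4/3)"
        using lg1 by (intro mult_left_mono ge_one_powr_ge_zero) auto
      then show "?G \<inter> set_pmf ?M \<subseteq> (\<lambda>xs. (Skip, h xs)) -` ?D" using h(2) m by auto
    qed simp
    also have "\<dots> = measure_pmf.prob (run_on algorithm 9 k n es (total_time n m k L)) ?D"
      unfolding run by simp
    finally show "1 - 1 / real n powr c \<le> measure_pmf.prob (run_on algorithm 9 k n es (total_time n m k L)) ?D" .
  qed
qed

theorem theorem2:
  shows "\<exists>(P :: prog) (d :: nat) (C_diam :: real). \<forall>c :: real. \<exists>(k :: nat) (C_time :: real) (C_size :: real).
    \<forall>(n :: nat) (es :: (nat \<times> nat) list) (E :: (nat \<times> nat) set) (m :: nat).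
      distinct es \<longrightarrow> set es = E \<longrightarrow> card E = m \<longrightarrow> is_digraph n E \<longrightarrow>
      n \<ge> 2 \<longrightarrow> real m \<ge> real n / 2 \<longrightarrow>
      (\<exists>t :: nat. real t \<le> C_time * real m * (log 2 (real n))\<^sup>2 \<and>
        (\<forall>cf \<in> set_pmf (run_on P d k n es t).
           halted cf \<and>
           output_arcs cf \<subseteq> shortcuts n E \<and>
           real (card (output_arcs cf)) \<le> C_size * real n * (log 2 (real n))\<^sup>2) \<and>
        measure_pmf.prob (run_on P d k n es t)
          {cf. real (digraph_diameter n (E \<union> output_arcs cf))
                 \<le> C_diam * real n powr (2/3) * log 2 (real n) powr (4/3)}
          \<ge> 1 - 1 / real n powr c)"
proof (rule exI[of _ algorithm], rule exI[of _ 9], rule exI[of _ "20 :: real"], rule allI)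
  fix c :: real
  \<comment> \<open>Only \<open>k\<close>, and with it the constants for time and size, depends on
    \<open>c\<close>; unification with \<open>guarantees\<close> supplies all three.\<close>
  have "real (nat \<lceil>c\<rceil> + 2) \<ge> c + 2" by linarith
  note guarantees = algorithm_guarantees[OF this]
  show "\<exists>k C_time C_size. \<forall>n es E m. distinct es \<longrightarrow> set es = E \<longrightarrow> card E = m \<longrightarrow> is_digraph n E \<longrightarrow>
      n \<ge> 2 \<longrightarrow> real m \<ge> real n / 2 \<longrightarrow>
      (\<exists>t. real t \<le> C_time * real m * (log 2 (real n))\<^sup>2 \<and>
        (\<forall>cf \<in> set_pmf (run_on algorithm 9 k n es t). halted cf \<and> output_arcs cf \<subseteq> shortcuts n E \<and>
           real (card (output_arcs cf)) \<le> C_size * real n * (log 2 (real n))\<^sup>2) \<and>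
        measure_pmf.prob (run_on algorithm 9 k n es t) {cf. real (digraph_diameter n (E \<union> output_arcs cf))
          \<le> 20 * real n powr (2/3) * log 2 (real n) powr (4/3)} \<ge> 1 - 1 / real n powr c)"
    by (rule exI, rule exI, rule exI, intro allI impI, rule guarantees)
qed

end
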